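(* Let $d\ge 2$, $0<s<d$, let $\Sigma\subset\mathbb{R}^d$ be an unbounded closed set, and let $Q$ be an external field on $\Sigma$ (as in the context) satisfying conditions A1 and A2 below. Then: (i) A solution $\mu_Q$ of the Riesz $s$-energy problem on $\Sigma$ with external field $Q$ exists if $$|x|^{s}\bigl(Q(x)-Q(\infty)\bigr)\le -1\quad\text{for all } x\in\Sigma \text{ with } |x| \text{ sufficiently large},$$ or if, for some Borel set $P\subset\mathbb{R}^d$ that is thin at infinity, $$\lim_{|x|\to+\infty,\;x\in\Sigma\setminus P}|x|^{s}\bigl(Q(x)-Q(\infty)\bigr)\le -1 .$$ (ii) Assume that the limit $\lim_{|x|\to+\infty,\,x\in\Sigma}|x|^{s}\bigl(Q(x)-Q(\infty)\bigr)$ exists. If $\Sigma$ admits a minimizing measure $\mu_Q$ with unbounded support, then this limit equals $-1$. (iii) If $d-2\le s<d$ and there exists a constant $c<1$ such that $$-\frac{c}{|x|^{s}}\le Q(x)-Q(\infty)\qquad\text{for all } x\in\Sigma,$$ then the Riesz energy problem on $\Sigma$ with external field $Q$ has no solution.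
   Context: For a (signed) measure $\sigma$, its Riesz $s$-potential is $U^\sigma(x)=\int|x-t|^{-s}\,d\sigma(t)$ and its $s$-energy is $I(\sigma)=\iint|x-t|^{-s}\,d\sigma(x)\,d\sigma(t)$. All positive measures are finite on compact sets and, if their support is unbounded, satisfy $\int_{|t|>1}|t|^{-s}d\mu(t)<\infty$. For a compact set $K$, $W(K)=\inf\{I(\sigma):\sigma \text{ a probability measure on } K\}$ and $\mathrm{cap}(K)=W(K)^{-1}$; for a Borel set $B$, $\mathrm{cap}(B)=\sup\{\mathrm{cap}(K): K\subset B \text{ compact}\}$; sets contained in a Borel set of zero capacity have capacity zero; "quasi-everywhere" means outside a set of zero capacity. A Borel set $E\subset\mathbb{R}^d$ is thin at infinity if $\sum_{k\ge1}2^{-ks}\mathrm{cap}(E^{(k)})<\infty$, where $E^{(k)}=\{x\in E: 2^k\le|x|<2^{k+1}\}$. External field: $Q:\Sigma\to(-\infty,+\infty]$ is lower semicontinuous, bounded below (since $\Sigma$ is unbounded), and $\{x\in\Sigma:Q(x)<+\infty\}$ has positive capacity. The Riesz energy problem asks for a probability measure $\mu_Q$ on $\Sigma$ minimizing $I_Q(\sigma)=I(\sigma)+2\int Q\,d\sigma$ over all probability measures $\sigma$ on $\Sigma$; a minimizer is called a solution (equilibrium measure). A1: $\Sigma$ is not thin at infinity. A2: the limit $Q(\infty):=\lim_{|x|\to+\infty,\,x\in\Sigma}Q(x)$ exists and is finite. *)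

theory Defs
  imports "HOL-Probability.Probability"
begin

definition riesz_kernel :: "real \<Rightarrow> 'a::euclidean_space \<Rightarrow> 'a \<Rightarrow> ennreal" where
  "riesz_kernel s x t = (if x = t then \<infinity> else ennreal (dist x t powr (- s)))"

definition riesz_energy :: "real \<Rightarrow> 'a::euclidean_space measure \<Rightarrow> ennreal" where
  "riesz_energy s \<sigma> = (\<integral>\<^sup>+ x. (\<integral>\<^sup>+ t. riesz_kernel s x t \<partial>\<sigma>) \<partial>\<sigma>)"

definition prob_on :: "'a::euclidean_space set \<Rightarrow> 'a measure \<Rightarrow> bool" where
  "prob_on A \<sigma> \<longleftrightarrow> prob_space \<sigma> \<and> sets \<sigma> = sets borel \<and> emeasure \<sigma> (UNIV - A) = 0"

definition W_const :: "real \<Rightarrow> 'a::euclidean_space set \<Rightarrow> ennreal" where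
  "W_const s K = (INF \<sigma>\<in>{\<sigma>. prob_on K \<sigma>}. riesz_energy s \<sigma>)"

definition cap_compact :: "real \<Rightarrow> 'a::euclidean_space set \<Rightarrow> ennreal" where
  "cap_compact s K = inverse (W_const s K)"

definition capacity :: "real \<Rightarrow> 'a::euclidean_space set \<Rightarrow> ennreal" where
  "capacity s B = (SUP K\<in>{K. compact K \<and> K \<subseteq> B}. cap_compact s K)"

definition shell :: "'a::euclidean_space set \<Rightarrow> nat \<Rightarrow> 'a set" where
  "shell E k = {x\<in>E. 2 ^ k \<le> norm x \<and> norm x < 2 ^ (k + 1)}"

definition thin_at_infinity :: "real \<Rightarrow> 'a::euclidean_space set \<Rightarrow> bool" where
  "thin_at_infinity s E \<longleftrightarrow>
     (\<Sum>k. ennreal (2 powr (- real (Suc k) * s)) * capacity s (shell E (Suc k))) < \<infinity>"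

definition lsc_on :: "'a::metric_space set \<Rightarrow> ('a \<Rightarrow> ereal) \<Rightarrow> bool" where
  "lsc_on A f \<longleftrightarrow> (\<forall>x\<in>A. \<forall>a. a < f x \<longrightarrow> (\<exists>e>0. \<forall>y\<in>A. dist y x < e \<longrightarrow> a < f y))"

definition external_field :: "real \<Rightarrow> 'a::euclidean_space set \<Rightarrow> ('a \<Rightarrow> ereal) \<Rightarrow> bool" where
  "external_field s \<Sigma> Q \<longleftrightarrow> lsc_on \<Sigma> Q \<and> (\<exists>b::real. \<forall>x\<in>\<Sigma>. ereal b \<le> Q x)
      \<and> capacity s {x\<in>\<Sigma>. Q x < \<infinity>} > 0"

text \<open>Integral of Q (bounded below on Sigma) against sigma, as a value in (-infinity, +infinity];
  Q is only used on Sigma.\<close>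
definition field_integral :: "'a::euclidean_space set \<Rightarrow> ('a \<Rightarrow> ereal) \<Rightarrow> 'a measure \<Rightarrow> ereal" where
  "field_integral \<Sigma> Q \<sigma> =
     enn2ereal (\<integral>\<^sup>+ x. e2ennreal (if x \<in> \<Sigma> then Q x else 0) \<partial>\<sigma>)
     - enn2ereal (\<integral>\<^sup>+ x. e2ennreal (if x \<in> \<Sigma> then - Q x else 0) \<partial>\<sigma>)"

definition weighted_energy :: "real \<Rightarrow> 'a::euclidean_space set \<Rightarrow> ('a \<Rightarrow> ereal) \<Rightarrow> 'a measure \<Rightarrow> ereal" where
  "weighted_energy s \<Sigma> Q \<sigma> = enn2ereal (riesz_energy s \<sigma>) + 2 * field_integral \<Sigma> Q \<sigma>"

definition is_solution :: "real \<Rightarrow> 'a::euclidean_space set \<Rightarrow> ('a \<Rightarrow> ereal) \<Rightarrow> 'a measure \<Rightarrow> bool" where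
  "is_solution s \<Sigma> Q \<mu> \<longleftrightarrow> prob_on \<Sigma> \<mu> \<and>
     (\<forall>\<sigma>. prob_on \<Sigma> \<sigma> \<longrightarrow> weighted_energy s \<Sigma> Q \<mu> \<le> weighted_energy s \<Sigma> Q \<sigma>)"

definition msupport :: "'a::metric_space measure \<Rightarrow> 'a set" where
  "msupport \<mu> = {x. \<forall>e>0. emeasure \<mu> (ball x e) > 0}"

abbreviation at_inf_within :: "'a::real_normed_vector set \<Rightarrow> 'a filter" where
  "at_inf_within A \<equiv> inf at_infinity (principal A)"

end

theory Submission
  imports Defs
begin

text \<open>
  Since \<open>\<Sigma>\<close> is not thin at infinity, it carries arbitrarily far out probability measures \<open>\<nu>\<close> of
  arbitrarily small energy. For a finite measure \<open>\<mu>\<close> of mass \<open>m\<close> they can be chosen such that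
  \<open>U\<^sup>\<mu>(x) \<le> (m + \<epsilon>) |x|\<^sup>-\<^sup>s\<close> on the support of \<open>\<nu>\<close>, because the set where this fails is thin.

  (i) A minimising sequence converges vaguely to some \<open>\<mu>\<close> of mass \<open>m \<le> 1\<close>, and the escaping mass costs
  \<open>2 (1 - m) Q(\<infinity>)\<close>. If \<open>m < 1\<close>, adding \<open>t \<nu>\<close> changes the limit energy by
  \<open>2 t \<integral>(U\<^sup>\<mu> + Q - Q(\<infinity>)) d\<nu> + O(t\<^sup>2)\<close>, which is negative for small \<open>t\<close>, a contradiction.

  (ii) A minimiser satisfies \<open>U\<^sup>\<mu> + Q \<le> F\<close> almost everywhere and \<open>F \<le> \<integral>(U\<^sup>\<mu> + Q) d\<nu>\<close> for all test
  measures \<open>\<nu>\<close>, whence \<open>F \<le> Q(\<infinity>)\<close>, with equality if the support is unbounded. As \<open>|x|\<^sup>s U\<^sup>\<mu>(x)\<close> is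
  about \<open>1\<close> near infinity, the first inequality gives that the limit is at most \<open>-1\<close>, the second that it
  is at least \<open>-1\<close>.

  (iii) Here \<open>U\<^sup>\<mu> \<le> c |x|\<^sup>-\<^sup>s\<close> almost everywhere. Under inversion this becomes a potential bounded by \<open>c\<close>
  almost everywhere on its support, hence at the origin by the maximum principle, where its value is
  the total mass \<open>1\<close> of \<open>\<mu>\<close>.
\<close>

section \<open>Potentials and mutual energy\<close>

text \<open>The available slack decides the shape of the proof. In (i) and (ii) crude constants,
  such as 4 for a union of two sets or \<open>2 powr s\<close> for potentials off a compact set,
  enter only through thinness, which is insensitive to constant factors. In (iii) the only slack is
  c < 1, so the maximum principle must hold with constant exactly 1. This is where s >= d - 2
  enters: the Laplacian of |x|^-s is s (s + 2 - d) |x|^(-s-2), which is then nonnegative off the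
  origin. It is used in the form of second differences under the integral sign. Compactness is
  obtained by coding R^d into [0,1]: the theorems of Helly and Skorohod on the line give random
  variables that converge pointwise, either in R^d or to infinity. Lower semicontinuity of the
  energy then becomes Fatou's lemma, applied once to the potential and once to the outer integral.
  Shifting the field to be nonnegative keeps all energies in \<open>ennreal\<close>, and the
  original field returns only at the end.\<close>

definition fin_borel :: "'a::euclidean_space measure \<Rightarrow> bool" where
  "fin_borel M \<longleftrightarrow> finite_measure M \<and> sets M = sets borel"

lemma fin_borelD:
  assumes "fin_borel M"
  shows "finite_measure M" "sets M = sets borel" "space M = UNIV" "sigma_finite_measure M"
    "emeasure M A < \<infinity>"
proof -
  show fm: "finite_measure M" and sb: "sets M = sets borel"
    using assms by (auto simp: fin_borel_def)
  show "space M = UNIV" using sets_eq_imp_space_eq[OF sb] by simp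
  show "sigma_finite_measure M" using fm by (simp add: finite_measure.sigma_finite_measure)
  show "emeasure M A < \<infinity>"
    using finite_measure.emeasure_finite[OF fm, of A] by (simp add: top.not_eq_extremum)
qed

lemma prob_onD:
  assumes "prob_on A M"
  shows "fin_borel M" "emeasure M UNIV = 1" "prob_space M" "emeasure M (UNIV - A) = 0"
proof -
  show p: "prob_space M" and "emeasure M (UNIV - A) = 0"
    using assms by (auto simp: prob_on_def)
  show f: "fin_borel M"
    using assms p by (auto simp: prob_on_def fin_borel_def prob_space_def)
  show "emeasure M UNIV = 1"
    using prob_space.emeasure_space_1[OF p] fin_borelD(3)[OF f] by simp
qed

lemma prob_onI:
  assumes "fin_borel M" "emeasure M UNIV = 1" "emeasure M (UNIV - A) = 0"
  shows "prob_on A M"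
  using assms fin_borelD[OF assms(1)] by (auto simp: prob_on_def intro: prob_spaceI)

lemma riesz_kernel_sym: "riesz_kernel s x y = riesz_kernel s y x"
  by (simp add: riesz_kernel_def dist_commute)

lemma riesz_kernel_measurable [measurable]:
  "(\<lambda>p. riesz_kernel s (fst p) (snd p :: 'a::euclidean_space)) \<in> borel_measurable (borel \<Otimes>\<^sub>M borel)"
proof -
  have "{p::'a \<times> 'a. fst p = snd p} \<in> sets (borel \<Otimes>\<^sub>M borel)"
    unfolding borel_prod by (intro borel_closed closed_Collect_eq continuous_intros)
  then have [measurable]: "Measurable.pred (borel \<Otimes>\<^sub>M borel) (\<lambda>p::'a \<times> 'a. fst p = snd p)"
    by (simp add: pred_def space_pair_measure)
  show ?thesis unfolding riesz_kernel_def by measurable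
qed

lemma riesz_kernel_measurable1 [measurable]:
  "riesz_kernel s x \<in> borel_measurable borel"
proof -
  have "(\<lambda>y. (x, y)) \<in> borel \<rightarrow>\<^sub>M borel \<Otimes>\<^sub>M borel" by simp
  from measurable_compose[OF this riesz_kernel_measurable] show ?thesis by simp
qed

lemma riesz_kernel_le:
  assumes "0 < s" "0 < r" "r \<le> dist x y"
  shows "riesz_kernel s x y \<le> ennreal (r powr (- s))"
  using assms by (auto simp: riesz_kernel_def intro!: ennreal_leI powr_mono2')

lemma riesz_kernel_ge:
  assumes "0 < s" "dist x y \<le> r"
  shows "ennreal (r powr (- s)) \<le> riesz_kernel s x y"
  using assms by (auto simp: riesz_kernel_def intro!: ennreal_leI powr_mono2')

text \<open>If \<open>x' = y\<close> the right side is infinite. The lemma is applied with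
  \<open>x'\<close> a point nearest to \<open>x\<close> in a compact set that carries the
  measure.\<close>

lemma riesz_kernel_le_mult:
  assumes "0 < s" "0 < a" "dist x' y \<le> a * dist x y"
  shows "riesz_kernel s x y \<le> ennreal (a powr s) * riesz_kernel s x' y"
proof (cases "x' = y")
  case True
  then show ?thesis using assms by (simp add: riesz_kernel_def ennreal_mult_top)
next
  case False
  then have "x \<noteq> y" using assms(3) by auto
  have "dist x y powr (- s) \<le> (dist x' y / a) powr (- s)"
    using False assms by (intro powr_mono2') (auto simp: field_simps)
  also have "\<dots> = a powr s * dist x' y powr (- s)"
    using assms by (simp add: powr_divide powr_minus divide_simps)
  finally show ?thesis
    using False \<open>x \<noteq> y\<close> by (simp add: riesz_kernel_def ennreal_leI flip: ennreal_mult)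
qed

definition potential :: "real \<Rightarrow> 'a::euclidean_space measure \<Rightarrow> 'a \<Rightarrow> ennreal" where
  "potential s M x = (\<integral>\<^sup>+ t. riesz_kernel s x t \<partial>M)"

definition mutual :: "real \<Rightarrow> 'a::euclidean_space measure \<Rightarrow> 'a measure \<Rightarrow> ennreal" where
  "mutual s M N = (\<integral>\<^sup>+ x. potential s M x \<partial>N)"

lemma riesz_energy_mutual: "riesz_energy s M = mutual s M M"
  by (simp add: riesz_energy_def mutual_def potential_def)

lemma potential_measurable [measurable]:
  assumes "fin_borel M" shows "potential s M \<in> borel_measurable borel"
proof -
  interpret sigma_finite_measure M using fin_borelD[OF assms] by simp
  have [measurable_cong]: "sets M = sets borel" using fin_borelD[OF assms] by simp
  have *: "sets (borel \<Otimes>\<^sub>M M) = sets (borel \<Otimes>\<^sub>M borel)"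
    by (intro sets_pair_measure_cong) (auto simp: fin_borelD[OF assms])
  have "(\<lambda>(x, y). riesz_kernel s x y) \<in> borel_measurable (borel \<Otimes>\<^sub>M M)"
    using riesz_kernel_measurable by (simp add: case_prod_beta' measurable_cong_sets[OF * refl])
  from borel_measurable_nn_integral[OF this] show ?thesis
    unfolding potential_def by simp
qed

lemma measurable_fin_borel:
  assumes "fin_borel M" shows "borel_measurable M = borel_measurable borel"
  by (rule measurable_cong_sets) (auto simp: fin_borelD[OF assms])

lemma mutual_sym:
  assumes "fin_borel M" "fin_borel N" shows "mutual s M N = mutual s N M"
proof -
  interpret M: sigma_finite_measure M using fin_borelD[OF assms(1)] by simp
  interpret N: sigma_finite_measure N using fin_borelD[OF assms(2)] by simp
  interpret pair_sigma_finite M N ..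
  have *: "sets (M \<Otimes>\<^sub>M N) = sets (borel \<Otimes>\<^sub>M borel)"
    using assms by (intro sets_pair_measure_cong) (auto simp: fin_borelD)
  have "(\<lambda>(x, y). riesz_kernel s x y) \<in> borel_measurable (M \<Otimes>\<^sub>M N)"
    using riesz_kernel_measurable by (simp add: case_prod_beta' measurable_cong_sets[OF * refl])
  from Fubini'[OF this] show ?thesis
    unfolding mutual_def potential_def by (simp add: riesz_kernel_sym)
qed

text \<open>A density rather than \<open>restrict_space\<close>, so that the space stays
  \<open>UNIV\<close> and the measurable sets stay the Borel sets.\<close>

definition restr :: "'a::euclidean_space measure \<Rightarrow> 'a set \<Rightarrow> 'a measure" where
  "restr M A = density M (indicator A)"

lemma restr:
  assumes "fin_borel M" "A \<in> sets borel"
  shows fin_borel_restr: "fin_borel (restr M A)"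
    and emeasure_restr: "\<And>B. B \<in> sets borel \<Longrightarrow> emeasure (restr M A) B = emeasure M (A \<inter> B)"
    and nn_integral_restr: "\<And>f. f \<in> borel_measurable borel \<Longrightarrow>
      (\<integral>\<^sup>+ x. f x \<partial>restr M A) = (\<integral>\<^sup>+ x. f x * indicator A x \<partial>M)"
proof -
  have sb: "sets M = sets borel" "space M = UNIV" using fin_borelD[OF assms(1)] by auto
  have [measurable]: "A \<in> sets M" using assms sb by simp
  show em: "emeasure (restr M A) B = emeasure M (A \<inter> B)" if "B \<in> sets borel" for B
  proof -
    have [measurable]: "B \<in> sets M" using that sb by simp
    have "emeasure (restr M A) B = (\<integral>\<^sup>+ x. indicator A x * indicator B x \<partial>M)"
      unfolding restr_def by (subst emeasure_density) auto
    also have "\<dots> = (\<integral>\<^sup>+ x. indicator (A \<inter> B) x \<partial>M)"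
      by (simp add: indicator_inter_arith)
    finally show ?thesis by simp
  qed
  have "emeasure (restr M A) UNIV < \<infinity>"
    using fin_borelD(5)[OF assms(1), of A] em[of UNIV] by simp
  then show "fin_borel (restr M A)"
    using sb unfolding fin_borel_def by (auto intro!: finite_measureI simp: restr_def)
  show "(\<integral>\<^sup>+ x. f x \<partial>restr M A) = (\<integral>\<^sup>+ x. f x * indicator A x \<partial>M)"
    if "f \<in> borel_measurable borel" for f
    using that unfolding restr_def
    by (subst nn_integral_density) (auto simp: measurable_fin_borel[OF assms(1)] mult.commute
      intro!: borel_measurable_indicator assms(2))
qed

lemma nn_integral_restr_le:
  assumes "fin_borel M" "A \<in> sets borel" "f \<in> borel_measurable borel"
  shows "(\<integral>\<^sup>+ x. f x \<partial>restr M A) \<le> (\<integral>\<^sup>+ x. f x \<partial>M)"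
  unfolding nn_integral_restr[OF assms] by (intro nn_integral_mono) (auto simp: indicator_def)

lemma potential_restr_le:
  assumes "fin_borel M" "A \<in> sets borel"
  shows "potential s (restr M A) x \<le> potential s M x"
  unfolding potential_def by (intro nn_integral_restr_le assms) auto

lemma energy_restr_le:
  assumes "fin_borel M" "A \<in> sets borel"
  shows "riesz_energy s (restr M A) \<le> riesz_energy s M"
proof -
  have "riesz_energy s (restr M A) \<le> (\<integral>\<^sup>+ x. potential s M x \<partial>restr M A)"
    unfolding riesz_energy_mutual mutual_def
    by (intro nn_integral_mono potential_restr_le assms)
  also have "\<dots> \<le> riesz_energy s M"
    unfolding riesz_energy_mutual mutual_def by (intro nn_integral_restr_le assms) (simp add: assms)
  finally show ?thesis .
qed

text \<open>The weights need not sum to 1: \<open>a = 1\<close> adds a multiple of \<open>N\<close>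
  to a limit measure that has lost mass, while \<open>a = 1 - t\<close>, \<open>b = t\<close> is the
  convex variation of a minimiser.\<close>

definition mix :: "ennreal \<Rightarrow> 'a::euclidean_space measure \<Rightarrow> ennreal \<Rightarrow> 'a measure \<Rightarrow> 'a measure" where
  "mix a M b N = measure_of UNIV (sets borel) (\<lambda>A. a * emeasure M A + b * emeasure N A)"

lemma sets_mix [simp]: "sets (mix a M b N) = sets borel"
  using sets.sigma_sets_eq[of borel] by (simp add: mix_def)

lemma emeasure_mix:
  assumes "fin_borel M" "fin_borel N" "A \<in> sets borel"
  shows "emeasure (mix a M b N) A = a * emeasure M A + b * emeasure N A"
  unfolding mix_def
proof (rule emeasure_measure_of_sigma)
  show "sigma_algebra UNIV (sets (borel :: 'a measure))"
    by (metis sets.sigma_algebra_axioms space_borel)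
  show "countably_additive (sets borel) (\<lambda>A. a * emeasure M A + b * emeasure N A)"
  proof (rule countably_additiveI)
    fix S :: "nat \<Rightarrow> 'a set"
    assume S: "range S \<subseteq> sets borel" "disjoint_family S" "\<Union> (range S) \<in> sets borel"
    have "(\<Sum>i. a * emeasure M (S i) + b * emeasure N (S i))
        = a * (\<Sum>i. emeasure M (S i)) + b * (\<Sum>i. emeasure N (S i))"
      by (simp add: suminf_add[symmetric])
    also have "(\<Sum>i. emeasure M (S i)) = emeasure M (\<Union> (range S))"
      using S fin_borelD(2)[OF assms(1)] by (intro suminf_emeasure) auto
    also have "(\<Sum>i. emeasure N (S i)) = emeasure N (\<Union> (range S))"
      using S fin_borelD(2)[OF assms(2)] by (intro suminf_emeasure) auto
    finally show "(\<Sum>i. a * emeasure M (S i) + b * emeasure N (S i))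
        = a * emeasure M (\<Union> (range S)) + b * emeasure N (\<Union> (range S))" .
  qed
qed (auto simp: positive_def assms)

lemma fin_borel_mix:
  assumes "fin_borel M" "fin_borel N" "a < \<infinity>" "b < \<infinity>"
  shows "fin_borel (mix a M b N)"
proof -
  have "space (mix a M b N) = UNIV" using sets_eq_imp_space_eq[OF sets_mix[of a M b N]] by simp
  then have "emeasure (mix a M b N) (space (mix a M b N)) < \<infinity>"
    using assms fin_borelD(5)[OF assms(1), of UNIV] fin_borelD(5)[OF assms(2), of UNIV]
    by (simp add: emeasure_mix ennreal_mult_less_top)
  then show ?thesis unfolding fin_borel_def by (auto intro!: finite_measureI)
qed

lemma nn_integral_mix:
  assumes "fin_borel M" "fin_borel N" "f \<in> borel_measurable borel"
  shows "(\<integral>\<^sup>+ x. f x \<partial>mix a M b N) = a * (\<integral>\<^sup>+ x. f x \<partial>M) + b * (\<integral>\<^sup>+ x. f x \<partial>N)"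
proof -
  note [measurable_cong] = fin_borelD(2)[OF assms(1)] fin_borelD(2)[OF assms(2)]
  have [measurable_cong]: "sets (mix a M b N) = sets borel" by simp
  show ?thesis using assms(3)
  proof (induct rule: borel_measurable_induct)
    case (cong f g)
    then show ?case by (metis (no_types, lifting) nn_integral_cong space_borel UNIV_I)
  next
    case (set A)
    then show ?case using assms by (simp add: emeasure_mix fin_borelD)
  next
    case (mult u c)
    note [measurable] = mult(2)
    show ?case by (simp add: nn_integral_cmult mult algebra_simps)
  next
    case (add u v)
    note [measurable] = add(1) add(4)
    show ?case by (simp add: nn_integral_add add algebra_simps)
  next
    case (seq U)
    note [measurable] = seq(1)
    have inc: "incseq U" by fact
    have mc: "(\<integral>\<^sup>+ x. (SUP i. U i) x \<partial>K) = (SUP i. (\<integral>\<^sup>+ x. U i x \<partial>K))"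
      if [measurable_cong]: "sets K = sets borel" for K
      unfolding SUP_apply by (intro nn_integral_monotone_convergence_SUP inc) measurable
    have i: "incseq (\<lambda>i. c * (\<integral>\<^sup>+ x. U i x \<partial>K))" for c and K :: "'a measure"
      using inc by (intro incseq_SucI mult_left_mono nn_integral_mono)
        (auto simp: incseq_Suc_iff le_fun_def)
    show ?case
      unfolding mc[OF sets_mix] mc[OF fin_borelD(2)[OF assms(1)]] mc[OF fin_borelD(2)[OF assms(2)]] seq
      by (simp add: SUP_mult_left_ennreal ennreal_SUP_add[OF i i])
  qed
qed

lemma potential_mix:
  assumes "fin_borel M" "fin_borel N"
  shows "potential s (mix a M b N) x = a * potential s M x + b * potential s N x"
  unfolding potential_def by (intro nn_integral_mix assms) simp

lemma energy_mix:
  assumes "fin_borel M" "fin_borel N"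
  shows "riesz_energy s (mix a M b N)
    = a * a * riesz_energy s M + 2 * a * b * mutual s M N + b * b * riesz_energy s N"
proof -
  note [measurable_cong] = fin_borelD(2)[OF assms(1)] fin_borelD(2)[OF assms(2)]
  note [measurable] = potential_measurable[OF assms(1)] potential_measurable[OF assms(2)]
  have "riesz_energy s (mix a M b N)
      = (\<integral>\<^sup>+ x. a * potential s M x + b * potential s N x \<partial>mix a M b N)"
    unfolding riesz_energy_mutual mutual_def potential_mix[OF assms] ..
  also have "\<dots> = a * (a * mutual s M M + b * mutual s N M) + b * (a * mutual s M N + b * mutual s N N)"
    by (subst nn_integral_mix[OF assms]) (simp_all add: nn_integral_add nn_integral_cmult mutual_def)
  also have "mutual s N M = mutual s M N" using assms by (intro mutual_sym)
  finally show ?thesis by (simp add: riesz_energy_mutual algebra_simps mult_2)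
qed

lemma fin_borel_scale:
  assumes "fin_borel M" "a < \<infinity>" shows "fin_borel (scale_measure a M)"
  using fin_borelD(2,3)[OF assms(1)] fin_borelD(5)[OF assms(1), of UNIV] assms(2) unfolding fin_borel_def
  by (auto intro!: finite_measureI simp: space_scale_measure ennreal_mult_eq_top_iff)

lemma potential_scale:
  assumes "fin_borel M"
  shows "potential s (scale_measure a M) x = a * potential s M x"
  unfolding potential_def
  by (intro nn_integral_scale_measure) (simp add: measurable_fin_borel[OF assms])

lemma energy_scale:
  assumes "fin_borel M"
  shows "riesz_energy s (scale_measure a M) = a * a * riesz_energy s M"
proof -
  have [measurable]: "potential s M \<in> borel_measurable M"
    using assms by (simp add: measurable_fin_borel[OF assms] potential_measurable)
  show ?thesis
    unfolding riesz_energy_mutual mutual_def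
    unfolding potential_scale[OF assms]
    by (simp add: nn_integral_scale_measure nn_integral_cmult mult.assoc)
qed

section \<open>Capacity\<close>

lemma ennreal_half_add_half: "ennreal (1/2) + ennreal (1/2) = 1"
  by (subst ennreal_plus[symmetric]) auto

lemma ennreal_powr_minus_mult: "ennreal (2 powr (- x)) * ennreal (2 powr x) = 1"
  by (simp flip: ennreal_mult powr_add)

lemma ennreal_inverse_le_inverse: "a \<le> b \<Longrightarrow> inverse b \<le> inverse (a::ennreal)"
proof (cases a; cases b)
  fix x y :: real assume "a \<le> b" "0 \<le> x" "a = ennreal x" "0 \<le> y" "b = ennreal y"
  then show ?thesis by (cases "x = 0") (auto simp: inverse_ennreal)
qed (auto simp: top_unique)

lemma ennreal_inverse_inverse: "inverse (inverse a) = (a::ennreal)"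
proof (cases a)
  case (real x)
  then show ?thesis by (cases "x = 0") (auto simp: inverse_ennreal)
qed simp

lemma capacity_mono: "A \<subseteq> B \<Longrightarrow> capacity s A \<le> capacity s B"
  unfolding capacity_def by (intro SUP_subset_mono) auto

text \<open>Reduces a capacity bound to single measures of finite energy. The infimum in
  \<open>W_const\<close> need not be attained, so the test is made for every real upper bound
  \<open>r\<close> of the energy.\<close>

lemma capacity_leI:
  assumes "\<And>K \<sigma> r. compact K \<Longrightarrow> K \<subseteq> B \<Longrightarrow> prob_on K \<sigma> \<Longrightarrow> 0 < r \<Longrightarrow>
    riesz_energy s \<sigma> \<le> ennreal r \<Longrightarrow> ennreal (1 / r) \<le> c"
  shows "capacity s B \<le> c"
  unfolding capacity_def
proof (intro SUP_least, clarsimp)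
  fix K :: "'a set" assume K: "compact K" "K \<subseteq> B"
  show "cap_compact s K \<le> c"
  proof (rule ccontr)
    assume "\<not> cap_compact s K \<le> c"
    then have "c < inverse (W_const s K)" by (simp add: cap_compact_def)
    then have "W_const s K < inverse c"
      by (metis ennreal_inverse_le_inverse linorder_not_le ennreal_inverse_inverse)
    then obtain \<sigma> where \<sigma>: "prob_on K \<sigma>" "riesz_energy s \<sigma> < inverse c"
      unfolding W_const_def by (auto simp: INF_less_iff)
    \<comment> \<open>A value strictly in between is positive and finite even if the energy is 0 or
      \<open>inverse c\<close> is infinite.\<close>
    obtain u where u: "riesz_energy s \<sigma> < u" "u < inverse c" using dense[OF \<sigma>(2)] by blast
    have "0 < u" "u < \<infinity>" using u by (auto simp: less_top[symmetric] intro: le_less_trans)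
    then obtain r where r: "u = ennreal r" "r > 0"
      by (cases u) (auto simp: ennreal_less_zero_iff)
    have "inverse (ennreal r) \<le> c"
      using assms[OF K \<sigma>(1) r(2)] u r by (simp add: inverse_ennreal divide_inverse less_imp_le)
    then have "inverse c \<le> ennreal r"
      by (metis ennreal_inverse_le_inverse ennreal_inverse_inverse)
    then show False using u r by simp
  qed
qed

lemma W_const_le: "prob_on K \<sigma> \<Longrightarrow> W_const s K \<le> riesz_energy s \<sigma>"
  unfolding W_const_def by (intro INF_lower) auto

text \<open>The slack \<open>r\<close> avoids the junk product \<open>\<infinity> * 0\<close>.\<close>
lemma mass_sq_le_capacity_times_energy:
  assumes \<sigma>: "fin_borel \<sigma>" and A: "A \<in> sets borel" and r: "0 < r"
    and e: "riesz_energy s \<sigma> \<le> ennreal r"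
  shows "emeasure \<sigma> A * emeasure \<sigma> A \<le> capacity s A * ennreal r"
proof -
  define \<K> where "\<K> = {K. K \<subseteq> A \<and> compact K}"
  have *: "emeasure \<sigma> K * emeasure \<sigma> K \<le> capacity s A * ennreal r" if "K \<in> \<K>" for K
  proof (cases "emeasure \<sigma> K = 0")
    case False
    have K: "compact K" "K \<subseteq> A" using that by (auto simp: \<K>_def)
    have Kb: "K \<in> sets borel" using K by (simp add: compact_imp_closed)
    obtain m where m: "emeasure \<sigma> K = ennreal m" "0 < m"
      using False fin_borelD(5)[OF \<sigma>, of K] by (cases "emeasure \<sigma> K") auto
    \<comment> \<open>Normalising the restriction to \<open>K\<close> divides the energy by m^2, so
      \<open>K\<close> has capacity at least m^2 / r.\<close>
    define \<tau> where "\<tau> = scale_measure (ennreal (1 / m)) (restr \<sigma> K)"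
    have "prob_on K \<tau>"
    proof (rule prob_onI)
      show "fin_borel \<tau>" unfolding \<tau>_def by (intro fin_borel_scale fin_borel_restr \<sigma> Kb) simp
      show "emeasure \<tau> UNIV = 1"
        using m by (simp add: \<tau>_def emeasure_restr[OF \<sigma> Kb] flip: ennreal_mult)
      show "emeasure \<tau> (UNIV - K) = 0"
        using Kb by (simp add: \<tau>_def emeasure_restr[OF \<sigma> Kb, of "UNIV - K"])
    qed
    then have "W_const s K \<le> riesz_energy s \<tau>" by (rule W_const_le)
    also have "\<dots> \<le> ennreal (1 / m) * ennreal (1 / m) * ennreal r"
      unfolding \<tau>_def energy_scale[OF fin_borel_restr[OF \<sigma> Kb]]
      by (intro mult_left_mono order_trans[OF energy_restr_le[OF \<sigma> Kb] e]) auto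
    also have "\<dots> = ennreal (r / (m * m))" using m r by (simp flip: ennreal_mult)
    finally have "inverse (ennreal (r / (m * m))) \<le> cap_compact s K"
      unfolding cap_compact_def by (rule ennreal_inverse_le_inverse)
    also have "\<dots> \<le> capacity s A" unfolding capacity_def using K by (intro SUP_upper) auto
    finally have "ennreal (m * m / r) \<le> capacity s A" using m r by (simp add: inverse_ennreal)
    then have "ennreal (m * m / r) * ennreal r \<le> capacity s A * ennreal r"
      by (rule mult_right_mono) simp
    then show ?thesis using m r by (simp flip: ennreal_mult)
  qed simp
  have ir: "emeasure \<sigma> A = (SUP K\<in>\<K>. emeasure \<sigma> K)"
    unfolding \<K>_def using fin_borelD(2)[OF \<sigma>] fin_borelD(5)[OF \<sigma>] A
    by (intro inner_regular) (auto simp: less_top)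
  \<comment> \<open>A product of two suprema over compact sets is a supremum over pairs, and
    \<open>K \<union> L\<close> serves both factors.\<close>
  have "(SUP K\<in>\<K>. emeasure \<sigma> K) * (SUP L\<in>\<K>. emeasure \<sigma> L) \<le> capacity s A * ennreal r"
    unfolding SUP_mult_right_ennreal SUP_mult_left_ennreal
  proof (intro SUP_least)
    fix K L assume KL: "K \<in> \<K>" "L \<in> \<K>"
    then have KLb: "K \<union> L \<in> sets \<sigma>"
      by (auto simp: \<K>_def fin_borelD(2)[OF \<sigma>] intro!: sets.Un borel_closed compact_imp_closed)
    have "emeasure \<sigma> K * emeasure \<sigma> L \<le> emeasure \<sigma> (K \<union> L) * emeasure \<sigma> (K \<union> L)"
      using KLb by (intro mult_mono emeasure_mono) auto
    also have "\<dots> \<le> capacity s A * ennreal r"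
      using KL by (intro *) (auto simp: \<K>_def)
    finally show "emeasure \<sigma> K * emeasure \<sigma> L \<le> capacity s A * ennreal r" .
  qed
  then show ?thesis unfolding ir .
qed

lemma emeasure_prob_on_Int:
  assumes "prob_on K \<sigma>" "K \<in> sets borel" "A \<in> sets borel"
  shows "emeasure \<sigma> (A \<inter> K) = emeasure \<sigma> A"
proof (rule antisym)
  have sb: "sets \<sigma> = sets borel" using prob_onD(1)[OF assms(1)] by (rule fin_borelD)
  show "emeasure \<sigma> (A \<inter> K) \<le> emeasure \<sigma> A" using assms sb by (intro emeasure_mono) auto
  have "emeasure \<sigma> A \<le> emeasure \<sigma> ((A \<inter> K) \<union> (UNIV - K))"
    using assms sb by (intro emeasure_mono) auto
  also have "\<dots> \<le> emeasure \<sigma> (A \<inter> K) + emeasure \<sigma> (UNIV - K)"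
    using assms sb by (intro emeasure_subadditive) auto
  finally show "emeasure \<sigma> A \<le> emeasure \<sigma> (A \<inter> K)" using prob_onD(4)[OF assms(1)] by simp
qed

text \<open>One of the two sets carries at least half of a given probability measure, and the mass
  enters squared, whence the factor 4. This weak subadditivity suffices for finite unions of thin
  sets.\<close>

lemma capacity_Un_le:
  assumes A: "A \<in> sets borel" and B: "B \<in> sets borel"
  shows "capacity s (A \<union> B) \<le> 4 * (capacity s A + capacity s B)"
proof (rule capacity_leI)
  fix K \<sigma> and r :: real
  assume K: "compact K" "K \<subseteq> A \<union> B" and \<sigma>: "prob_on K \<sigma>" and r: "0 < r"
    and e: "riesz_energy s \<sigma> \<le> ennreal r"
  note fb = prob_onD(1)[OF \<sigma>]
  have Kb: "K \<in> sets borel" using K by (simp add: compact_imp_closed)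
  have "1 = emeasure \<sigma> K"
    using emeasure_prob_on_Int[OF \<sigma> Kb, of UNIV] prob_onD(2)[OF \<sigma>] by simp
  also have "\<dots> \<le> emeasure \<sigma> (A \<union> B)"
    using K A B fin_borelD(2)[OF fb] by (intro emeasure_mono) auto
  also have "\<dots> \<le> emeasure \<sigma> A + emeasure \<sigma> B"
    using A B fin_borelD(2)[OF fb] by (intro emeasure_subadditive) auto
  finally have sum: "1 \<le> emeasure \<sigma> A + emeasure \<sigma> B" .
  have key: "ennreal (1 / r) \<le> 4 * capacity s C"
    if C: "C \<in> sets borel" "ennreal (1/2) \<le> emeasure \<sigma> C" for C
  proof -
    have "ennreal (1/2) * ennreal (1/2) \<le> capacity s C * ennreal r"
      using mass_sq_le_capacity_times_energy[OF fb C(1) r e] C(2)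
      by (meson mult_mono order_trans zero_le)
    then have "ennreal (4 / r) * (ennreal (1/2) * ennreal (1/2)) \<le> ennreal (4 / r) * (capacity s C * ennreal r)"
      by (rule mult_left_mono) simp
    also have "ennreal (4 / r) * (capacity s C * ennreal r) = ennreal (4 / r) * ennreal r * capacity s C"
      by (simp add: ac_simps)
    also have "ennreal (4 / r) * ennreal r = 4" using r by (simp flip: ennreal_mult)
    also have "ennreal (4 / r) * (ennreal (1/2) * ennreal (1/2)) = ennreal (4 / r * (1 / 2 * (1 / 2)))"
      using r by (subst ennreal_mult[symmetric], simp, simp, subst ennreal_mult[symmetric], simp_all del: ennreal_half)
    finally show ?thesis by simp
  qed
  have "ennreal (1/2) \<le> emeasure \<sigma> A \<or> ennreal (1/2) \<le> emeasure \<sigma> B"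
  proof (rule ccontr)
    assume "\<not> ?thesis"
    then have "emeasure \<sigma> A + emeasure \<sigma> B < ennreal (1/2) + ennreal (1/2)"
      by (intro add_strict_mono) auto
    also have "\<dots> = 1" by (rule ennreal_half_add_half)
    finally show False using sum by simp
  qed
  then show "ennreal (1 / r) \<le> 4 * (capacity s A + capacity s B)"
  proof
    assume "ennreal (1/2) \<le> emeasure \<sigma> A"
    from key[OF A this] show ?thesis by (simp add: distrib_left add_increasing2)
  next
    assume "ennreal (1/2) \<le> emeasure \<sigma> B"
    from key[OF B this] show ?thesis by (simp add: distrib_left add_increasing)
  qed
qed

text \<open>Distances in \<open>B\<close> are at most 2 R, so every probability measure on a compact
  subset has energy at least (2 R)^-s.\<close>

lemma capacity_cball_less_top:
  assumes "0 < s" "0 < R" "B \<subseteq> cball 0 R"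
  shows "capacity s B < \<infinity>"
proof -
  have "capacity s B \<le> ennreal ((2 * R) powr s)"
  proof (rule capacity_leI)
    fix K \<sigma> and r :: real
    assume K: "compact K" "K \<subseteq> B" and \<sigma>: "prob_on K \<sigma>" and r: "0 < r"
      and e: "riesz_energy s \<sigma> \<le> ennreal r"
    note fb = prob_onD(1)[OF \<sigma>]
    have Kb: "K \<in> sets borel" using K by (simp add: compact_imp_closed)
    have "UNIV - K \<in> null_sets \<sigma>"
      using prob_onD(4)[OF \<sigma>] Kb fin_borelD(2)[OF fb] by (auto simp: null_sets_def)
    then have AE: "AE x in \<sigma>. x \<in> K" by (rule AE_I') auto
    have d: "dist x y \<le> 2 * R" if "x \<in> K" "y \<in> K" for x y
    proof -
      have "norm x \<le> R" "norm y \<le> R" using that K assms(3) by auto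
      then show ?thesis using dist_triangle_le[of x 0 y "2 * R"] by (simp add: dist_norm)
    qed
    have "ennreal ((2 * R) powr (- s)) = (\<integral>\<^sup>+ x. (\<integral>\<^sup>+ t. ennreal ((2 * R) powr (- s)) \<partial>\<sigma>) \<partial>\<sigma>)"
      using prob_onD(2)[OF \<sigma>] fin_borelD(3)[OF fb] by simp
    also have "\<dots> \<le> riesz_energy s \<sigma>"
      unfolding riesz_energy_def
    proof (rule nn_integral_mono_AE)
      show "AE x in \<sigma>. (\<integral>\<^sup>+ t. ennreal ((2 * R) powr (- s)) \<partial>\<sigma>) \<le> (\<integral>\<^sup>+ t. riesz_kernel s x t \<partial>\<sigma>)"
        using AE
      proof eventually_elim
        case (elim x)
        show ?case
          by (rule nn_integral_mono_AE)
            (use AE in eventually_elim, auto intro!: riesz_kernel_ge d assms elim)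
      qed
    qed
    also have "\<dots> \<le> ennreal r" by (rule e)
    finally have "(2 * R) powr (- s) \<le> r" using r by simp
    then have "1 / r \<le> 1 / ((2 * R) powr (- s))" using assms r by (intro divide_left_mono) auto
    then show "ennreal (1 / r) \<le> ennreal ((2 * R) powr s)"
      by (intro ennreal_leI) (simp add: powr_minus divide_simps)
  qed
  then show ?thesis by (simp add: le_less_trans)
qed

text \<open>A weak maximum principle: if \<open>x'\<close> is the point of \<open>K\<close> nearest
  to \<open>x\<close>, then |x' - t| <= 2 |x - t| for every \<open>t\<close> in
  \<open>K\<close>.\<close>

lemma potential_le_on_compact_imp_le:
  assumes s: "0 < s" and K: "compact K" "K \<noteq> {}" and \<sigma>: "fin_borel \<sigma>" "emeasure \<sigma> (UNIV - K) = 0"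
    and le: "\<And>x. x \<in> K \<Longrightarrow> potential s \<sigma> x \<le> C"
  shows "potential s \<sigma> x \<le> ennreal (2 powr s) * C"
proof -
  obtain x' where x': "x' \<in> K" "\<And>y. y \<in> K \<Longrightarrow> dist x x' \<le> dist x y"
    using distance_attains_inf[OF compact_imp_closed[OF K(1)] K(2), of x] by blast
  have "UNIV - K \<in> null_sets \<sigma>"
    using \<sigma>(2) K fin_borelD(2)[OF \<sigma>(1)] by (auto simp: null_sets_def compact_imp_closed)
  then have AE: "AE x in \<sigma>. x \<in> K" by (rule AE_I') auto
  have "potential s \<sigma> x \<le> (\<integral>\<^sup>+ t. ennreal (2 powr s) * riesz_kernel s x' t \<partial>\<sigma>)"
    unfolding potential_def
  proof (rule nn_integral_mono_AE)
    show "AE t in \<sigma>. riesz_kernel s x t \<le> ennreal (2 powr s) * riesz_kernel s x' t"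
      using AE
    proof eventually_elim
      case (elim t)
      show ?case
        using x'(2)[OF elim] dist_triangle[of x' t x] by (intro riesz_kernel_le_mult s) (simp_all add: dist_commute)
    qed
  qed
  also have "\<dots> = ennreal (2 powr s) * potential s \<sigma> x'"
    unfolding potential_def
    by (intro nn_integral_cmult) (simp add: measurable_fin_borel[OF \<sigma>(1)])
  also have "\<dots> \<le> ennreal (2 powr s) * C" by (intro mult_left_mono le x') simp
  finally show ?thesis .
qed

text \<open>A measure of finite energy loses at most half of its mass when restricted to where its potential is
  at most twice the energy; the restriction then has bounded potential everywhere, which is integrated
  against \<open>\<nu>\<close>.\<close>
lemma capacity_superlevel_le:
  assumes s: "0 < s" and \<nu>: "fin_borel \<nu>" and l: "0 < l"
    and B: "\<And>x. x \<in> B \<Longrightarrow> ennreal l \<le> potential s \<nu> x"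
  shows "capacity s B \<le> ennreal (8 * 2 powr s / l) * emeasure \<nu> UNIV"
proof (rule capacity_leI)
  fix K \<sigma> and r :: real
  assume K: "compact K" "K \<subseteq> B" and \<sigma>: "prob_on K \<sigma>" and r: "0 < r"
    and e: "riesz_energy s \<sigma> \<le> ennreal r"
  note fb = prob_onD(1)[OF \<sigma>]
  note sb = fin_borelD(2)[OF fb]
  have Kb: "K \<in> sets borel" using K by (simp add: compact_imp_closed)
  have [measurable]: "potential s \<sigma> \<in> borel_measurable borel" "potential s \<nu> \<in> borel_measurable borel"
    by (intro potential_measurable fb \<nu>)+
  have [measurable]: "potential s \<sigma> \<in> borel_measurable \<sigma>" by (simp add: measurable_fin_borel[OF fb])
  \<comment> \<open>The threshold is twice the energy bound, so by Markov's inequality at least half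
    of the mass lies in \<open>A\<close>.\<close>
  define A where "A = {x. potential s \<sigma> x \<le> ennreal (2 * r)}"
  have Ab: "A \<in> sets borel" unfolding A_def by measurable
  have "emeasure \<sigma> (UNIV - A) \<le> emeasure \<sigma> {x \<in> UNIV. 1 \<le> ennreal (1 / (2 * r)) * potential s \<sigma> x}"
  proof (rule emeasure_mono)
    show "UNIV - A \<subseteq> {x \<in> UNIV. 1 \<le> ennreal (1 / (2 * r)) * potential s \<sigma> x}"
    proof (clarsimp simp: A_def not_le)
      fix x assume "ennreal (2 * r) < potential s \<sigma> x"
      then have "ennreal (1 / (2 * r)) * ennreal (2 * r) \<le> ennreal (1 / (2 * r)) * potential s \<sigma> x"
        by (intro mult_left_mono) auto
      then show "1 \<le> ennreal (1 / (2 * r)) * potential s \<sigma> x" using r by (simp flip: ennreal_mult)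
    qed
  qed (simp add: sb)
  also have "\<dots> \<le> ennreal (1 / (2 * r)) * (\<integral>\<^sup>+ x. potential s \<sigma> x * indicator UNIV x \<partial>\<sigma>)"
    by (intro nn_integral_Markov_inequality) (auto simp: sb)
  also have "\<dots> \<le> ennreal (1 / (2 * r)) * ennreal r"
    using e by (intro mult_left_mono) (auto simp: riesz_energy_mutual mutual_def)
  also have "\<dots> = ennreal (1/2)" using r by (simp flip: ennreal_mult)
  finally have c: "emeasure \<sigma> (UNIV - A) \<le> ennreal (1/2)" .
  have "ennreal (1/2) + ennreal (1/2) = emeasure \<sigma> UNIV"
    using prob_onD(2)[OF \<sigma>] ennreal_half_add_half by simp
  also have "\<dots> = emeasure \<sigma> (A \<union> (UNIV - A))" by simp
  also have "\<dots> \<le> emeasure \<sigma> A + emeasure \<sigma> (UNIV - A)"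
    using Ab by (intro emeasure_subadditive) (auto simp: sb)
  also have "\<dots> \<le> emeasure \<sigma> A + ennreal (1/2)" by (intro add_left_mono c)
  finally have "ennreal (1/2) \<le> emeasure \<sigma> A" by simp
  also have "\<dots> = emeasure \<sigma> (A \<inter> K)" using emeasure_prob_on_Int[OF \<sigma> Kb Ab] by simp
  also have "\<dots> = (SUP L\<in>{L. L \<subseteq> A \<inter> K \<and> compact L}. emeasure \<sigma> L)"
    using sb fin_borelD(5)[OF fb] Ab Kb by (intro inner_regular) (auto simp: less_top)
  \<comment> \<open>Passing to a compact subset costs mass, and 1/4 leaves room below 1/2. Together
    with the threshold 2 r it produces the constant 8 = 4 * 2.\<close>
  finally have "ennreal (1/4) < (SUP L\<in>{L. L \<subseteq> A \<inter> K \<and> compact L}. emeasure \<sigma> L)"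
    by (rule less_le_trans[rotated]) (simp add: ennreal_less_iff del: ennreal_half)
  then obtain L where L: "L \<subseteq> A" "L \<subseteq> K" "compact L" "ennreal (1/4) < emeasure \<sigma> L"
    by (auto simp: less_SUP_iff)
  have Lb: "L \<in> sets borel" using L by (simp add: compact_imp_closed)
  have Ln: "L \<noteq> {}" using L by auto
  define \<tau> where "\<tau> = restr \<sigma> L"
  have \<tau>: "fin_borel \<tau>" unfolding \<tau>_def by (intro fin_borel_restr fb Lb)
  have pt: "potential s \<tau> x \<le> ennreal (2 powr s) * ennreal (2 * r)" for x
  proof (rule potential_le_on_compact_imp_le[OF s L(3) Ln \<tau>])
    show "emeasure \<tau> (UNIV - L) = 0" using Lb by (simp add: \<tau>_def emeasure_restr[OF fb Lb, of "UNIV - L"])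
    show "potential s \<tau> x \<le> ennreal (2 * r)" if "x \<in> L" for x
      using potential_restr_le[OF fb Lb, of s x] that L(1) unfolding \<tau>_def A_def by auto
  qed
  have "ennreal l * ennreal (1/4) \<le> ennreal l * emeasure \<sigma> L"
    using L by (intro mult_left_mono) auto
  also have "\<dots> = (\<integral>\<^sup>+ x. ennreal l * indicator L x \<partial>\<sigma>)"
    using Lb by (simp add: nn_integral_cmult_indicator sb)
  also have "\<dots> \<le> (\<integral>\<^sup>+ x. potential s \<nu> x * indicator L x \<partial>\<sigma>)"
    using B L(2) K(2) by (intro nn_integral_mono) (auto simp: indicator_def)
  also have "\<dots> = mutual s \<nu> \<tau>"
    unfolding mutual_def \<tau>_def by (simp add: nn_integral_restr[OF fb Lb])
  also have "\<dots> = mutual s \<tau> \<nu>" by (intro mutual_sym \<tau> \<nu>)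
  also have "\<dots> \<le> (\<integral>\<^sup>+ x. ennreal (2 powr s) * ennreal (2 * r) \<partial>\<nu>)"
    unfolding mutual_def by (intro nn_integral_mono pt)
  also have "\<dots> = ennreal (2 powr s) * ennreal (2 * r) * emeasure \<nu> UNIV"
    by (simp add: fin_borelD(3)[OF \<nu>])
  finally have *: "ennreal l * ennreal (1/4) \<le> ennreal (2 powr s) * ennreal (2 * r) * emeasure \<nu> UNIV" .
  obtain n where n: "emeasure \<nu> UNIV = ennreal n" "0 \<le> n"
    using fin_borelD(5)[OF \<nu>, of UNIV] by (cases "emeasure \<nu> UNIV") auto
  have "l * (1/4) \<le> 2 powr s * (2 * r) * n"
    using * n l r by (simp flip: ennreal_mult)
  then have "1 / r \<le> 8 * 2 powr s / l * n"
    using l r by (simp add: divide_simps ac_simps)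
  then show "ennreal (1 / r) \<le> ennreal (8 * 2 powr s / l) * emeasure \<nu> UNIV"
    using n l by (simp flip: ennreal_mult)
qed

section \<open>Thinness at infinity\<close>

lemma shell_subset_cball: "shell E k \<subseteq> cball 0 (2 ^ (k + 1))"
  by (auto simp: shell_def)

lemma shell_borel [measurable]: "E \<in> sets borel \<Longrightarrow> shell E k \<in> sets (borel :: 'a::euclidean_space measure)"
proof -
  assume "E \<in> sets borel"
  moreover have "shell E k = E \<inter> {x. 2 ^ k \<le> norm x \<and> norm x < 2 ^ (k + 1)}"
    by (auto simp: shell_def)
  ultimately show ?thesis by simp
qed

lemma shell_Un: "shell (E \<union> F) k = shell E k \<union> shell F k"
  by (auto simp: shell_def)

lemma thin_at_infinity_subset:
  assumes "thin_at_infinity s F" "E \<subseteq> F" shows "thin_at_infinity s E"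
proof -
  have "(\<Sum>k. ennreal (2 powr (- real (Suc k) * s)) * capacity s (shell E (Suc k)))
      \<le> (\<Sum>k. ennreal (2 powr (- real (Suc k) * s)) * capacity s (shell F (Suc k)))"
    using assms(2) by (intro suminf_le mult_left_mono capacity_mono) (auto simp: shell_def)
  then show ?thesis using assms(1) unfolding thin_at_infinity_def by (rule le_less_trans)
qed

lemma thin_at_infinity_Un:
  assumes "thin_at_infinity s E" "thin_at_infinity s F" "E \<in> sets borel" "F \<in> sets borel"
  shows "thin_at_infinity s (E \<union> F)"
proof -
  have "(\<Sum>k. ennreal (2 powr (- real (Suc k) * s)) * capacity s (shell (E \<union> F) (Suc k)))
      \<le> (\<Sum>k. 4 * (ennreal (2 powr (- real (Suc k) * s)) * capacity s (shell E (Suc k))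
            + ennreal (2 powr (- real (Suc k) * s)) * capacity s (shell F (Suc k))))"
  proof (intro suminf_le)
    fix k
    have "capacity s (shell (E \<union> F) (Suc k)) \<le> 4 * (capacity s (shell E (Suc k)) + capacity s (shell F (Suc k)))"
      unfolding shell_Un using assms by (intro capacity_Un_le shell_borel)
    then have "ennreal (2 powr (- real (Suc k) * s)) * capacity s (shell (E \<union> F) (Suc k))
      \<le> ennreal (2 powr (- real (Suc k) * s)) * (4 * (capacity s (shell E (Suc k)) + capacity s (shell F (Suc k))))"
      by (rule mult_left_mono) simp
    then show "ennreal (2 powr (- real (Suc k) * s)) * capacity s (shell (E \<union> F) (Suc k))
      \<le> 4 * (ennreal (2 powr (- real (Suc k) * s)) * capacity s (shell E (Suc k))
            + ennreal (2 powr (- real (Suc k) * s)) * capacity s (shell F (Suc k)))"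
      by (simp only: algebra_simps)
  qed auto
  also have "\<dots> = 4 * ((\<Sum>k. ennreal (2 powr (- real (Suc k) * s)) * capacity s (shell E (Suc k)))
      + (\<Sum>k. ennreal (2 powr (- real (Suc k) * s)) * capacity s (shell F (Suc k))))"
    by (simp only: ennreal_suminf_cmult) (simp add: suminf_add)
  also have "\<dots> < \<infinity>"
    using assms(1,2) unfolding thin_at_infinity_def by (simp add: ennreal_mult_less_top)
  finally show ?thesis unfolding thin_at_infinity_def .
qed

text \<open>Only the tail of the series has to be controlled, since each shell is bounded and so has
  finite capacity.\<close>

lemma thin_at_infinityI:
  fixes E :: "'a::euclidean_space set"
  assumes s: "0 < s"
    and le: "\<And>k. capacity s (shell E (k + Suc n)) \<le> ennreal (2 powr (real (k + Suc n) * s)) * f k"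
    and f: "(\<Sum>k. f k) < \<infinity>"
  shows "thin_at_infinity s E"
proof -
  define g where "g k = ennreal (2 powr (- real (Suc k) * s)) * capacity s (shell E (Suc k))" for k
  have "suminf g = (\<Sum>k. g (k + n)) + (\<Sum>j<n. g j)"
    by (rule suminf_offset) auto
  also have "\<dots> < \<infinity>"
  proof -
    have "(\<Sum>k. g (k + n)) \<le> (\<Sum>k. f k)"
    proof (intro suminf_le)
      fix k
      have "g (k + n) \<le> ennreal (2 powr (- real (k + Suc n) * s))
          * (ennreal (2 powr (real (k + Suc n) * s)) * f k)"
        unfolding g_def using le[of k] by (intro mult_mono) auto
      also have "\<dots> = f k"
        by (simp only: mult_minus_left ennreal_powr_minus_mult mult.assoc[symmetric]) simp
      finally show "g (k + n) \<le> f k" .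
    qed auto
    then have "(\<Sum>k. g (k + n)) < \<infinity>" using f by simp
    moreover have "(\<Sum>j<n. g j) < \<infinity>"
      unfolding g_def
      using capacity_cball_less_top[OF s _ shell_subset_cball[of E]]
      by (simp add: ennreal_mult_less_top)
    ultimately show ?thesis by simp
  qed
  finally show ?thesis unfolding thin_at_infinity_def g_def .
qed

text \<open>If the capacities of the far shells were all at most \<open>c\<close>, the series would
  be dominated by a geometric series with ratio 2^-s.\<close>

lemma not_thin_imp_capacity_large:
  assumes s: "0 < s" and nt: "\<not> thin_at_infinity s E" and c: "c < \<infinity>"
  obtains k where "k \<ge> n" "c < capacity s (shell E k)"
proof -
  have "\<exists>k\<ge>n. c < capacity s (shell E k)"
  proof (rule ccontr)
    assume "\<not> ?thesis"
    then have le: "\<And>k. n \<le> k \<Longrightarrow> capacity s (shell E k) \<le> c" by (meson not_le)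
    have "thin_at_infinity s E"
    proof (rule thin_at_infinityI[OF s])
      fix k
      have "c = ennreal (2 powr (real (k + Suc n) * s)) * (ennreal (2 powr (- real (k + Suc n) * s)) * c)"
        using ennreal_powr_minus_mult[of "real (k + Suc n) * s"]
        by (simp only: mult_minus_left mult.assoc[symmetric] mult.commute[of "ennreal (2 powr (real _ * s))"]) simp
      also have "2 powr (- real (k + Suc n) * s) \<le> (2 powr (- s)) ^ k"
      proof -
        have "2 powr (- real (k + Suc n) * s) \<le> 2 powr (real k * (- s))"
          using order_trans[of "- s" 0 "s * real n"] s by (intro powr_mono) (simp_all add: algebra_simps)
        then show ?thesis by (simp add: powr_powr flip: powr_realpow) (simp add: mult.commute)
      qed
      finally have "c \<le> ennreal (2 powr (real (k + Suc n) * s)) * (ennreal ((2 powr (- s)) ^ k) * c)"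
        by (simp add: mult_left_mono mult_right_mono ennreal_leI)
      then show "capacity s (shell E (k + Suc n))
        \<le> ennreal (2 powr (real (k + Suc n) * s)) * (ennreal ((2 powr (- s)) ^ k) * c)"
        using le[of "k + Suc n"] by simp
    next
      have "2 powr (- s) < (1::real)" using s by (simp add: powr_less_one)
      then have "summable (\<lambda>k. (2 powr (- s)) ^ k :: real)" by (intro summable_geometric) auto
      then have "(\<Sum>k. ennreal ((2 powr (- s)) ^ k)) \<noteq> \<top>" by (intro ennreal_suminf_neq_top) auto
      then show "(\<Sum>k. ennreal ((2 powr (- s)) ^ k) * c) < \<infinity>"
        using c by (simp add: ennreal_mult_less_top less_top)
    qed
    then show False using nt by simp
  qed
  then show ?thesis using that by blast
qed

text \<open>Each annulus consists of \<open>p\<close> consecutive dyadic shells, so a point lies in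
  at most \<open>p\<close> annuli. The induction peels off the outermost shells, which form a
  disjoint family.\<close>

lemma suminf_emeasure_annuli_le:
  fixes M :: "'a::euclidean_space measure"
  assumes M: "fin_borel M"
  shows "(\<Sum>k. emeasure M {t. 2 ^ k \<le> norm t \<and> norm t < 2 ^ (k + p)}) \<le> of_nat p * emeasure M UNIV"
proof (induction p)
  case 0
  have "{t::'a. 2 ^ k \<le> norm t \<and> norm t < 2 ^ (k + 0)} = {}" for k by auto
  then show ?case by (simp only: emeasure_empty) simp
next
  case (Suc p)
  note sb = fin_borelD(2)[OF M]
  let ?A = "\<lambda>k. {t::'a. 2 ^ (k + p) \<le> norm t \<and> norm t < 2 ^ (k + Suc p)}"
  have dis: "disjoint_family ?A"
    unfolding disjoint_family_on_def
  proof (intro ballI impI)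
    fix m n :: nat assume "m \<noteq> n"
    have *: "?A m \<inter> ?A n = {}" if "m < n" for m n
    proof -
      have "(2::real) ^ (m + Suc p) \<le> 2 ^ (n + p)" using that by (intro power_increasing) auto
      then show ?thesis by auto
    qed
    show "?A m \<inter> ?A n = {}" using \<open>m \<noteq> n\<close> *[of m n] *[of n m] by (cases "m < n") auto
  qed
  have "(\<Sum>k. emeasure M {t. 2 ^ k \<le> norm t \<and> norm t < 2 ^ (k + Suc p)})
      \<le> (\<Sum>k. emeasure M {t. 2 ^ k \<le> norm t \<and> norm t < 2 ^ (k + p)} + emeasure M (?A k))"
  proof (intro suminf_le)
    fix k
    have "emeasure M {t. 2 ^ k \<le> norm t \<and> norm t < 2 ^ (k + Suc p)}
      \<le> emeasure M ({t. 2 ^ k \<le> norm t \<and> norm t < 2 ^ (k + p)} \<union> ?A k)"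
      by (intro emeasure_mono) (auto simp: sb)
    also have "\<dots> \<le> emeasure M {t. 2 ^ k \<le> norm t \<and> norm t < 2 ^ (k + p)} + emeasure M (?A k)"
      by (intro emeasure_subadditive) (auto simp: sb)
    finally show "emeasure M {t. 2 ^ k \<le> norm t \<and> norm t < 2 ^ (k + Suc p)}
      \<le> emeasure M {t. 2 ^ k \<le> norm t \<and> norm t < 2 ^ (k + p)} + emeasure M (?A k)" .
  qed auto
  also have "\<dots> = (\<Sum>k. emeasure M {t. 2 ^ k \<le> norm t \<and> norm t < 2 ^ (k + p)}) + (\<Sum>k. emeasure M (?A k))"
    by (intro suminf_add[symmetric]) auto
  also have "(\<Sum>k. emeasure M (?A k)) = emeasure M (\<Union>k. ?A k)"
    using dis by (intro suminf_emeasure) (auto simp: sb)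
  also have "\<dots> \<le> emeasure M UNIV" by (intro emeasure_mono) (auto simp: sb)
  finally show ?case using Suc by (simp add: algebra_simps add_mono order_trans add_left_mono)
qed

text \<open>For \<open>x\<close> in the \<open>n\<close>-th shell, the mass well inside acts as if it were at the origin and the mass far
  outside is negligible. The mass in the neighbouring shells is controlled by
  \<open>capacity_superlevel_le\<close>, and its sum over \<open>n\<close> is finite.\<close>
lemma thin_potential_superlevel:
  fixes \<mu> :: "'a::euclidean_space measure"
  assumes s: "0 < s" and \<mu>: "fin_borel \<mu>" and \<epsilon>: "0 < \<epsilon>"
  shows "thin_at_infinity s {x. (emeasure \<mu> UNIV + ennreal \<epsilon>) * ennreal (norm x powr (- s)) < potential s \<mu> x}"
    (is "thin_at_infinity s ?B")
proof -
  interpret finite_measure \<mu> using \<mu> by (rule fin_borelD)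
  note sb = fin_borelD(2)[OF \<mu>]
  define m where "m = measure \<mu> UNIV"
  have m: "emeasure \<mu> UNIV = ennreal m" "0 \<le> m" by (auto simp: m_def emeasure_eq_measure)
  \<comment> \<open>If |x| >= 2^n and |t| < 2^(n-j), then |x - t| >= (1 - 2^-j) |x|. The number
    \<open>j\<close> is chosen so that this factor inflates the mass \<open>m\<close> by less than
    \<epsilon>/2.\<close>
  have "((\<lambda>j. (1 - (1/2) ^ j) powr (- s) * m) \<longlongrightarrow> (1 - 0) powr (- s) * m) sequentially"
    by (intro tendsto_mult tendsto_powr tendsto_diff tendsto_const LIMSEQ_power_zero) auto
  then have "\<forall>\<^sub>F j in sequentially. (1 - (1/2) ^ j) powr (- s) * m < m + \<epsilon> / 2"
    by (rule order_tendstoD(2)) (use \<epsilon> in simp)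
  from eventually_happens[OF eventually_conj[OF this eventually_ge_at_top[of 1]]]
  obtain j :: nat where j: "1 \<le> j" "(1 - (1/2) ^ j) powr (- s) * m < m + \<epsilon> / 2"
    by auto
  define a :: real where "a = (1 - (1/2) ^ j) powr (- s)"
  have half: "0 < 1 - (1/2::real) ^ j" using j(1) by (simp add: power_less_one_iff)
  have "(\<lambda>n. measure \<mu> {t::'a. 2 ^ n \<le> norm t}) \<longlonglongrightarrow> measure \<mu> (\<Inter>n. {t. 2 ^ n \<le> norm t})"
  proof (intro finite_Lim_measure_decseq)
    show "range (\<lambda>n. {t::'a. 2 ^ n \<le> norm t}) \<subseteq> sets \<mu>" by (auto simp: sb)
    show "decseq (\<lambda>n. {t::'a. 2 ^ n \<le> norm t})"
      by (auto simp: decseq_def intro: order_trans[OF power_increasing])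
  qed
  moreover have "(\<Inter>n. {t::'a. 2 ^ n \<le> norm t}) = {}"
    by auto (metis real_arch_pow one_less_numeral_iff semiring_norm(76) not_le)
  ultimately have "(\<lambda>n. measure \<mu> {t::'a. 2 ^ n \<le> norm t}) \<longlonglongrightarrow> 0" by simp
  then have "\<forall>\<^sub>F n in sequentially. measure \<mu> {t. 2 ^ n \<le> norm t} < \<epsilon> / 4"
    by (rule order_tendstoD(2)) (use \<epsilon> in simp)
  then obtain n0 where n0: "\<And>n. n0 \<le> n \<Longrightarrow> measure \<mu> {t. 2 ^ n \<le> norm t} < \<epsilon> / 4"
    by (auto simp: eventually_sequentially)
  \<comment> \<open>With i = n - j this is the region from 2^(n-j) to 2^(n+2), that is, all mass
    that is neither well inside nor far outside for a point of the n-th shell.\<close>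
  define mid where "mid k = {t::'a. 2 ^ k \<le> norm t \<and> norm t < 2 ^ (k + (j + 2))}" for k
  have midb: "mid k \<in> sets borel" for k unfolding mid_def by measurable
  \<comment> \<open>The constant of \<open>capacity_superlevel_le\<close> for the level \<epsilon>/4
    is 32 * 2^s / \<epsilon>. The second factor 2^s comes from bounding |x| by 2^(n+1) instead of
    2^n.\<close>
  define C where "C = 32 * 2 powr s * 2 powr s / \<epsilon>"
  have C: "0 \<le> C" using \<epsilon> by (simp add: C_def)
  show ?thesis
  proof (rule thin_at_infinityI[OF s, where n = "j + n0"])
    fix k
    define n where "n = k + Suc (j + n0)"
    define i where "i = k + Suc n0"
    have ni: "n = i + j" by (simp add: n_def i_def)
    have "capacity s (shell ?B n) \<le>
      ennreal (8 * 2 powr s / (\<epsilon> / 4 * 2 powr (- (real (n + 1) * s)))) * emeasure (restr \<mu> (mid i)) UNIV"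
    proof (rule capacity_superlevel_le[OF s fin_borel_restr[OF \<mu> midb]])
      show "0 < \<epsilon> / 4 * 2 powr (- (real (n + 1) * s))" using \<epsilon> by simp
      fix x assume "x \<in> shell ?B n"
      then have x: "2 ^ n \<le> norm x" "norm x < 2 ^ (n + 1)"
        "(emeasure \<mu> UNIV + ennreal \<epsilon>) * ennreal (norm x powr (- s)) < potential s \<mu> x"
        by (auto simp: shell_def)
      have X: "0 < norm x" using x(1) by (meson less_le_trans zero_less_numeral zero_less_power)
      define q where "q = norm x powr (- s)"
      have q: "0 < q" using X by (simp add: q_def)
      define far where "far = {t::'a. 2 ^ (n + 2) \<le> norm t}"
      have [measurable]: "far \<in> sets borel" "mid i \<in> sets borel" using midb by (auto simp: far_def)
      have farm: "emeasure \<mu> far \<le> ennreal (\<epsilon> / 4)"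
        using n0[of "n + 2"] by (auto simp: far_def n_def emeasure_eq_measure intro!: ennreal_leI)
      have ker: "riesz_kernel s x t \<le> ennreal (a * q) + ennreal q * indicator far t
          + riesz_kernel s x t * indicator (mid i) t" for t
      proof -
        consider "norm t < 2 ^ i" | "t \<in> mid i" | "t \<in> far"
          by (force simp: mid_def far_def ni)
        then show ?thesis
        proof cases
          case 1
          have "(2::real) ^ i = 2 ^ n * (1/2) ^ j" by (simp add: ni power_add power_one_over)
          also have "\<dots> \<le> norm x * (1/2) ^ j" using x(1) by (intro mult_right_mono) auto
          finally have "norm x * (1 - (1/2) ^ j) \<le> dist x t"
            using 1 norm_triangle_sub[of x t] by (simp add: dist_norm algebra_simps)
          then have "riesz_kernel s x t \<le> ennreal ((norm x * (1 - (1/2) ^ j)) powr (- s))"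
            using X half by (intro riesz_kernel_le s) auto
          also have "(norm x * (1 - (1/2) ^ j)) powr (- s) = a * q"
            using half by (simp add: powr_mult a_def q_def)
          finally show ?thesis by (simp add: add_increasing2)
        next
          case 2
          then show ?thesis by simp
        next
          case 3
          have "norm x \<le> dist x t"
            using 3 x(2) norm_triangle_sub[of t x] by (simp add: dist_norm far_def norm_minus_commute)
          then have "riesz_kernel s x t \<le> ennreal q"
            unfolding q_def using X by (intro riesz_kernel_le s) auto
          then show ?thesis using 3 by (simp add: add_increasing add_increasing2)
        qed
      qed
      have "potential s \<mu> x \<le> (\<integral>\<^sup>+ t. ennreal (a * q) + ennreal q * indicator far t
          + riesz_kernel s x t * indicator (mid i) t \<partial>\<mu>)"
        unfolding potential_def by (intro nn_integral_mono ker)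
      also have "\<dots> = ennreal (a * q) * ennreal m + ennreal q * emeasure \<mu> far
          + potential s (restr \<mu> (mid i)) x"
        unfolding potential_def
        by (simp add: nn_integral_add nn_integral_cmult_indicator measurable_fin_borel[OF \<mu>] sb
          fin_borelD(3)[OF \<mu>] m nn_integral_restr[OF \<mu> midb])
      also have "\<dots> \<le> ennreal (a * q) * ennreal m + ennreal q * ennreal (\<epsilon> / 4)
          + potential s (restr \<mu> (mid i)) x"
        by (intro add_mono mult_left_mono farm) auto
      finally have le: "potential s \<mu> x \<le> \<dots>" .
      \<comment> \<open>The excess \<epsilon> pays \<epsilon>/2 for the inner mass and \<epsilon>/4
        for the outer mass. The remaining \<epsilon>/4 must come from \<open>mid i\<close>.\<close>
      have "ennreal (\<epsilon> / 4 * q) \<le> potential s (restr \<mu> (mid i)) x"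
      proof (cases "potential s (restr \<mu> (mid i)) x")
        case (real u)
        have "ennreal ((m + \<epsilon>) * q) < ennreal (a * q * m + q * (\<epsilon> / 4) + u)"
          using less_le_trans[OF x(3) le] m q \<epsilon> real
          by (simp add: a_def ennreal_mult ennreal_plus del: times_divide_eq_right flip: q_def)
        then have "(m + \<epsilon>) * q < a * q * m + q * (\<epsilon> / 4) + u"
          by (metis ennreal_leI linorder_not_le)
        moreover have "a * m * q \<le> (m + \<epsilon> / 2) * q"
          using j(2) q by (intro mult_right_mono) (auto simp: a_def)
        ultimately have "\<epsilon> / 4 * q \<le> u" by (simp add: algebra_simps)
        then show ?thesis using real by (simp add: ennreal_leI)
      qed simp
      moreover have "2 powr (- (real (n + 1) * s)) \<le> q"
      proof -
        have "(2 ^ (n + 1)) powr (- s) \<le> q"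
          unfolding q_def using x X s by (intro powr_mono2') auto
        also have "(2 ^ (n + 1)) powr (- s) = 2 powr (- (real (n + 1) * s))"
          by (simp add: powr_powr del: power_Suc of_nat_Suc flip: powr_realpow)
        finally show ?thesis .
      qed
      ultimately show "ennreal (\<epsilon> / 4 * 2 powr (- (real (n + 1) * s))) \<le> potential s (restr \<mu> (mid i)) x"
        using \<epsilon> by (meson ennreal_leI mult_left_mono order_trans less_imp_le half_gt_zero divide_pos_pos zero_less_numeral)
    qed
    also have "8 * 2 powr s / (\<epsilon> / 4 * 2 powr (- (real (n + 1) * s))) = 2 powr (real n * s) * C"
    proof -
      have "real (n + 1) * s = real n * s + s" by (simp add: algebra_simps)
      then have "2 powr (- (real (n + 1) * s)) = 1 / (2 powr (real n * s) * 2 powr s)"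
        by (simp only: powr_minus powr_add inverse_eq_divide)
      then show ?thesis using \<epsilon> by (simp add: C_def)
    qed
    also have "emeasure (restr \<mu> (mid i)) UNIV = emeasure \<mu> (mid i)"
      by (simp add: emeasure_restr[OF \<mu> midb])
    also have "ennreal (2 powr (real n * s) * C) * emeasure \<mu> (mid i)
        = ennreal (2 powr (real n * s)) * (ennreal C * emeasure \<mu> (mid i))"
      using C by (simp add: ennreal_mult mult.assoc)
    finally show "capacity s (shell ?B (k + Suc (j + n0)))
      \<le> ennreal (2 powr (real (k + Suc (j + n0)) * s)) * (ennreal C * emeasure \<mu> (mid (k + Suc n0)))"
      by (simp only: n_def i_def)
  next
    have "(\<Sum>k. ennreal C * emeasure \<mu> (mid (k + Suc n0))) = ennreal C * (\<Sum>k. emeasure \<mu> (mid (k + Suc n0)))"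
      by simp
    also have "\<dots> \<le> ennreal C * (\<Sum>k. emeasure \<mu> (mid k))"
      by (intro mult_left_mono) (auto simp: suminf_offset[of "\<lambda>k. emeasure \<mu> (mid k)" "Suc n0"])
    also have "\<dots> \<le> ennreal C * (of_nat (j + 2) * emeasure \<mu> UNIV)"
      unfolding mid_def by (intro mult_left_mono suminf_emeasure_annuli_le \<mu>) simp
    also have "\<dots> < \<infinity>" by (simp add: ennreal_mult_less_top m of_nat_less_top)
    finally show "(\<Sum>k. ennreal C * emeasure \<mu> (mid (k + Suc n0))) < \<infinity>" .
  qed
qed

text \<open>Up to \<open>\<epsilon>\<close>, the last bound is the potential of the whole mass of \<open>\<mu>\<close> placed at the origin.\<close>
lemma not_thin_imp_test_measure:
  fixes \<mu> :: "'a::euclidean_space measure"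
  assumes s: "0 < s" and \<Sigma>: "\<Sigma> \<in> sets borel" "\<not> thin_at_infinity s \<Sigma>"
    and P: "P \<in> sets borel" "thin_at_infinity s P"
    and \<mu>: "fin_borel \<mu>" and \<epsilon>: "0 < \<epsilon>" and \<eta>: "0 < \<eta>"
  obtains K \<nu> where "compact K" "K \<subseteq> \<Sigma> - P" "prob_on K \<nu>" "riesz_energy s \<nu> \<le> ennreal \<eta>"
    "\<And>x. x \<in> K \<Longrightarrow> R \<le> norm x"
    "\<And>x. x \<in> K \<Longrightarrow> potential s \<mu> x \<le> (emeasure \<mu> UNIV + ennreal \<epsilon>) * ennreal (norm x powr (- s))"
proof -
  define B where "B = {x. (emeasure \<mu> UNIV + ennreal \<epsilon>) * ennreal (norm x powr (- s)) < potential s \<mu> x}"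
  have thinB: "thin_at_infinity s B" unfolding B_def by (intro thin_potential_superlevel s \<mu> \<epsilon>)
  note [measurable] = potential_measurable[OF \<mu>]
  have Bb: "B \<in> sets borel" unfolding B_def by measurable
  \<comment> \<open>Removing two thin sets cannot make a set thin that was not. Hence some far shell
    of the remainder has capacity above 1/\<eta>, which means that it carries a probability measure
    of energy below \<eta>.\<close>
  have "\<not> thin_at_infinity s (\<Sigma> - P - B)"
  proof
    assume "thin_at_infinity s (\<Sigma> - P - B)"
    then have "thin_at_infinity s ((\<Sigma> - P - B) \<union> (P \<union> B))"
      using P thinB Bb \<Sigma>(1) by (intro thin_at_infinity_Un) auto
    then have "thin_at_infinity s \<Sigma>" by (rule thin_at_infinity_subset) auto
    then show False using \<Sigma>(2) by simp
  qed
  moreover obtain n :: nat where n: "R < 2 ^ n" using real_arch_pow[of 2 R] by auto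
  ultimately obtain k where k: "n \<le> k" "inverse (ennreal \<eta>) < capacity s (shell (\<Sigma> - P - B) k)"
    using \<eta> by (elim not_thin_imp_capacity_large[OF s, where c = "inverse (ennreal \<eta>)" and n = n])
      (auto simp: inverse_ennreal)
  then obtain K where K: "compact K" "K \<subseteq> shell (\<Sigma> - P - B) k" "inverse (ennreal \<eta>) < cap_compact s K"
    unfolding capacity_def by (auto simp: less_SUP_iff)
  then have "W_const s K < ennreal \<eta>"
    unfolding cap_compact_def by (meson ennreal_inverse_le_inverse not_le)
  then obtain \<nu> where \<nu>: "prob_on K \<nu>" "riesz_energy s \<nu> < ennreal \<eta>"
    unfolding W_const_def by (auto simp: INF_less_iff)
  show ?thesis
  proof (rule that[OF K(1) _ \<nu>(1) less_imp_le[OF \<nu>(2)]])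
    show "K \<subseteq> \<Sigma> - P" using K(2) by (auto simp: shell_def)
    fix x assume "x \<in> K"
    then have x: "2 ^ k \<le> norm x" "x \<notin> B" using K(2) by (auto simp: shell_def)
    show "R \<le> norm x" using n x(1) power_increasing[OF k(1), of "2::real"] by linarith
    show "potential s \<mu> x \<le> (emeasure \<mu> UNIV + ennreal \<epsilon>) * ennreal (norm x powr (- s))"
      using x(2) by (auto simp: B_def)
  qed
qed

section \<open>A subsequence converging pointwise in the one-point compactification\<close>

text \<open>A continuous function of period 2 that is 0 within 1/3 of the even integers and 1 within
  1/3 of the odd ones.\<close>

definition schoenberg_bit :: "real \<Rightarrow> real" where
  "schoenberg_bit t = max 0 (min 1 (1/2 - cos (pi * t)))"

text \<open>For digits \<open>a k\<close> in {0, 1} this is the point of the Cantor set with ternary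
  digits \<open>2 * a k\<close>.\<close>

definition ternary_sum :: "(nat \<Rightarrow> real) \<Rightarrow> real" where
  "ternary_sum a = (\<Sum>k. 2 * a k / 3 ^ Suc k)"

definition binary_digit :: "nat \<Rightarrow> real \<Rightarrow> real" where
  "binary_digit k x = real_of_int (\<lfloor>2 ^ Suc k * x\<rfloor> - 2 * \<lfloor>2 ^ k * x\<rfloor>)"

lemma summable_ternary:
  assumes "\<And>k. a k \<in> {0, 1::real}"
  shows "summable (\<lambda>k. 2 * a k / 3 ^ Suc k)"
proof (rule summable_comparison_test)
  show "\<exists>N. \<forall>k\<ge>N. norm (2 * a k / 3 ^ Suc k) \<le> 2 / 3 * (1/3) ^ k"
  proof (intro exI[of _ 0] allI impI)
    fix k :: nat
    have "a k = 0 \<or> a k = 1" using assms[of k] by simp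
    then show "norm (2 * a k / 3 ^ Suc k) \<le> 2 / 3 * (1/3) ^ k" by (auto simp: power_one_over)
  qed
  show "summable (\<lambda>k. 2 / 3 * (1/3) ^ k :: real)"
    by (intro summable_mult summable_geometric) auto
qed

lemma ternary_sum_bounds:
  assumes "\<And>k. a k \<in> {0, 1::real}"
  shows "0 \<le> ternary_sum a" "ternary_sum a \<le> 1"
proof -
  have a: "0 \<le> a k" "a k \<le> 1" for k using assms[of k] by auto
  show "0 \<le> ternary_sum a" unfolding ternary_sum_def
    using a by (intro suminf_nonneg summable_ternary assms) auto
  have g: "(\<lambda>k. 2 / 3 * (1/3) ^ k) sums (2 / 3 * (1 / (1 - 1/3)) :: real)"
    by (intro sums_mult geometric_sums) auto
  have "ternary_sum a \<le> (\<Sum>k. 2 / 3 * (1/3) ^ k)" unfolding ternary_sum_def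
  proof (intro suminf_le summable_ternary assms)
    show "summable (\<lambda>k. 2 / 3 * (1/3) ^ k :: real)" using g by (rule sums_summable)
    show "2 * a k / 3 ^ Suc k \<le> 2 / 3 * (1/3) ^ k" for k
      using a[of k] by (simp add: power_one_over field_simps)
  qed
  then show "ternary_sum a \<le> 1" using sums_unique[OF g] by simp
qed

lemma ternary_sum_shift:
  assumes "\<And>k. a k \<in> {0, 1::real}"
  shows "3 * ternary_sum a = 2 * a 0 + ternary_sum (\<lambda>k. a (Suc k))"
proof -
  have "ternary_sum a = (\<Sum>k. 2 * a (Suc k) / 3 ^ Suc (Suc k)) + 2 * a 0 / 3"
    unfolding ternary_sum_def using suminf_split_head[OF summable_ternary[of a, OF assms]] by simp
  also have "(\<Sum>k. 2 * a (Suc k) / 3 ^ Suc (Suc k)) = (\<Sum>k. (1/3) * (2 * a (Suc k) / 3 ^ Suc k))"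
    by (intro suminf_cong) simp
  also have "\<dots> = (1/3) * ternary_sum (\<lambda>k. a (Suc k))"
    unfolding ternary_sum_def by (intro suminf_mult summable_ternary assms)
  finally show ?thesis by simp
qed

text \<open>Multiplying by 3^m shifts the ternary digits. They are 0 or 2, so the part that becomes
  integral is even and disappears by periodicity. What remains lies in [0, 1/3] or in [2/3, 1]
  according to \<open>a m\<close>.\<close>

lemma schoenberg_bit_ternary_sum:
  assumes a: "\<And>k. a k \<in> {0, 1::real}"
  shows "schoenberg_bit (3 ^ m * ternary_sum a) = a m"
proof -
  have "\<exists>z::int. 3 ^ m * ternary_sum a = 2 * of_int z + ternary_sum (\<lambda>k. a (k + m))"
  proof (induction m)
    case 0
    show ?case by (intro exI[of _ 0]) simp
  next
    case (Suc m)
    then obtain z :: int where z: "3 ^ m * ternary_sum a = 2 * of_int z + ternary_sum (\<lambda>k. a (k + m))" by blast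
    obtain i :: int where i: "a m = of_int i" using a[of m] by (metis insertE of_int_0 of_int_1 singletonD)
    have "3 ^ Suc m * ternary_sum a = 3 * (3 ^ m * ternary_sum a)" by simp
    also have "\<dots> = 6 * of_int z + 3 * ternary_sum (\<lambda>k. a (k + m))" by (simp add: z)
    also have "3 * ternary_sum (\<lambda>k. a (k + m)) = 2 * of_int i + ternary_sum (\<lambda>k. a (k + Suc m))"
      using ternary_sum_shift[of "\<lambda>k. a (k + m)"] a i by simp
    finally show ?case by (intro exI[of _ "3 * z + i"]) simp
  qed
  then obtain z :: int where z: "3 ^ m * ternary_sum a = 2 * of_int z + ternary_sum (\<lambda>k. a (k + m))" by blast
  define y where "y = ternary_sum (\<lambda>k. a (k + m))"
  have y3: "3 * y = 2 * a m + ternary_sum (\<lambda>k. a (Suc k + m))"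
    unfolding y_def using ternary_sum_shift[of "\<lambda>k. a (k + m)"] a by simp
  have b: "0 \<le> ternary_sum (\<lambda>k. a (Suc k + m))" "ternary_sum (\<lambda>k. a (Suc k + m)) \<le> 1"
    by (intro ternary_sum_bounds a)+
  have c: "cos (pi * (3 ^ m * ternary_sum a)) = cos (pi * y)"
  proof -
    have "pi * (3 ^ m * ternary_sum a) = pi * y + (2 * pi) * of_int z"
      unfolding z y_def by (simp add: algebra_simps)
    then show ?thesis by (simp only: cos_add cos_int_2pin sin_int_2pin mult_1_right mult_zero_right diff_zero)
  qed
  consider "a m = 0" | "a m = 1" using a[of m] by auto
  then show ?thesis
  proof cases
    case 1
    then have "0 \<le> pi * y" "pi * y \<le> pi / 3" using y3 b by auto
    then have "cos (pi / 3) \<le> cos (pi * y)" by (intro cos_monotone_0_pi_le) auto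
    then show ?thesis using 1 by (simp add: schoenberg_bit_def c cos_60)
  next
    case 2
    then have "2 * pi / 3 \<le> pi * y" "pi * y \<le> pi" using y3 b by (auto simp: field_simps)
    then have "cos (pi * y) \<le> cos (2 * pi / 3)" by (intro cos_monotone_0_pi_le) auto
    then show ?thesis using 2 by (simp add: schoenberg_bit_def c cos_120)
  qed
qed

lemma binary_digit_01: "binary_digit k x \<in> {0, 1}"
proof -
  have "\<lfloor>2 ^ Suc k * x\<rfloor> - 2 * \<lfloor>2 ^ k * x\<rfloor> = 0 \<or> \<lfloor>2 ^ Suc k * x\<rfloor> - 2 * \<lfloor>2 ^ k * x\<rfloor> = 1"
    unfolding power_Suc mult.assoc by linarith
  then show ?thesis unfolding binary_digit_def by auto
qed

text \<open>The partial sums telescope to floor(2^n x) / 2^n.\<close>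

lemma binary_digits_sums:
  assumes "0 \<le> x" "x < 1"
  shows "(\<lambda>k. binary_digit k x / 2 ^ Suc k) sums x"
proof -
  have "(\<Sum>k<n. binary_digit k x / 2 ^ Suc k) = of_int \<lfloor>2 ^ n * x\<rfloor> / 2 ^ n" for n
  proof (induction n)
    case 0
    have "\<lfloor>x\<rfloor> = 0" using assms by linarith
    then show ?case by simp
  qed (simp add: binary_digit_def field_simps)
  moreover have "(\<lambda>n. of_int \<lfloor>2 ^ n * x\<rfloor> / 2 ^ n) \<longlonglongrightarrow> x"
  proof (rule tendsto_sandwich)
    have l: "2 ^ n * x - 1 \<le> of_int \<lfloor>2 ^ n * x\<rfloor>" "of_int \<lfloor>2 ^ n * x\<rfloor> \<le> 2 ^ n * x" for n by linarith+
    show "\<forall>\<^sub>F n in sequentially. x - (1/2) ^ n \<le> of_int \<lfloor>2 ^ n * x\<rfloor> / 2 ^ n"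
    proof (intro always_eventually allI)
      fix n
      have "(2 ^ n * x - 1) / 2 ^ n \<le> of_int \<lfloor>2 ^ n * x\<rfloor> / 2 ^ n"
        by (intro divide_right_mono l(1)) simp
      then show "x - (1/2) ^ n \<le> of_int \<lfloor>2 ^ n * x\<rfloor> / 2 ^ n"
        by (simp add: diff_divide_distrib power_one_over)
    qed
    show "\<forall>\<^sub>F n in sequentially. of_int \<lfloor>2 ^ n * x\<rfloor> / 2 ^ n \<le> x"
      using l(2) by (intro always_eventually allI) (simp add: field_simps)
    have "(\<lambda>n. (1/2::real) ^ n) \<longlonglongrightarrow> 0" by (rule LIMSEQ_power_zero) simp
    from tendsto_diff[OF tendsto_const this, of x] show "(\<lambda>n. x - (1/2) ^ n) \<longlonglongrightarrow> x" by simp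
  qed simp
  ultimately show ?thesis by (simp add: sums_def)
qed

text \<open>The components \<open>f b\<close> form a Schoenberg space-filling curve; \<open>e\<close> is a Borel section of it over
  \<open>\<real>\<^sup>d\<close>, identified with the open cube by \<open>y \<mapsto> 1/2 + arctan y / pi\<close> in each coordinate.\<close>
lemma ex_space_filling_encoding:
  obtains e :: "'a::euclidean_space \<Rightarrow> real" and f :: "'a \<Rightarrow> real \<Rightarrow> real" where
    "e \<in> borel_measurable borel" "\<And>x. e x \<in> {0..1}"
    "\<And>b. continuous_on UNIV (f b)" "\<And>b t. f b t \<in> {0..1}"
    "\<And>x b. b \<in> Basis \<Longrightarrow> f b (e x) = 1/2 + arctan (x \<bullet> b) / pi"
proof -
  define d where "d = DIM('a)"
  have d: "0 < d" by (simp add: d_def)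
  obtain g :: "nat \<Rightarrow> 'a" where g: "bij_betw g {0..<d} Basis"
    unfolding d_def using ex_bij_betw_nat_finite[OF finite_Basis] by blast
  define idx where "idx b = the_inv_into {0..<d} g b" for b
  have idx: "idx b < d" "g (idx b) = b" if "b \<in> Basis" for b
  proof -
    show "g (idx b) = b" unfolding idx_def using g that by (intro f_the_inv_into_f_bij_betw) auto
    have "the_inv_into {0..<d} g b \<in> {0..<d}"
      using g that by (intro the_inv_into_into) (auto simp: bij_betw_def)
    then show "idx b < d" by (simp add: idx_def)
  qed
  define h where "h y = 1/2 + arctan y / pi" for y
  have h: "0 \<le> h y" "h y < 1" for y
    using arctan_bounded[of y] by (auto simp: h_def field_simps)
  \<comment> \<open>The binary digits of the d coordinates are interleaved: place \<open>m\<close>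
    holds digit \<open>m div d\<close> of coordinate \<open>m mod d\<close>. The function
    \<open>f b\<close> reads the places congruent to \<open>idx b\<close> back.\<close>
  define a where "a x m = binary_digit (m div d) (h (x \<bullet> g (m mod d)))" for x m
  define e where "e x = ternary_sum (a x)" for x
  define f where "f b t = (\<Sum>k. schoenberg_bit (3 ^ (d * k + idx b) * t) / 2 ^ Suc k)" for b t
  have a01: "a x m \<in> {0, 1}" for x m unfolding a_def by (rule binary_digit_01)
  have p: "0 \<le> schoenberg_bit t" "schoenberg_bit t \<le> 1" for t by (auto simp: schoenberg_bit_def)
  have half: "(\<lambda>k. 1 / 2 ^ Suc k :: real) sums 1"
    using power_half_series by (simp add: power_one_over)
  have sm: "summable (\<lambda>k. schoenberg_bit (3 ^ (d * k + idx b) * t) / 2 ^ Suc k)" for b t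
    by (rule summable_comparison_test[OF _ sums_summable[OF half]])
      (use p in \<open>auto intro!: exI[of _ 0] divide_right_mono\<close>)
  show ?thesis
  proof (rule that[of e f])
    show "e \<in> borel_measurable borel"
      unfolding e_def a_def h_def ternary_sum_def binary_digit_def by measurable
    show "e x \<in> {0..1}" for x using ternary_sum_bounds[of "a x", OF a01] by (auto simp: e_def)
    show "f b t \<in> {0..1}" for b t
    proof -
      have "0 \<le> f b t" unfolding f_def by (intro suminf_nonneg sm) (use p in auto)
      moreover have "f b t \<le> (\<Sum>k. 1 / 2 ^ Suc k)"
        unfolding f_def
        by (intro suminf_le sm sums_summable[OF half]) (use p in \<open>auto intro!: divide_right_mono\<close>)
      ultimately show ?thesis using sums_unique[OF half] by simp
    qed
    show "continuous_on UNIV (f b)" for b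
    proof (rule uniform_limit_theorem)
      show "uniform_limit UNIV (\<lambda>n t. \<Sum>k<n. schoenberg_bit (3 ^ (d * k + idx b) * t) / 2 ^ Suc k) (f b) sequentially"
        unfolding f_def
        by (rule Weierstrass_m_test[OF _ sums_summable[OF half]])
          (use p in \<open>auto intro!: divide_right_mono\<close>)
      show "\<forall>\<^sub>F n in sequentially. continuous_on UNIV (\<lambda>t. \<Sum>k<n. schoenberg_bit (3 ^ (d * k + idx b) * t) / 2 ^ Suc k)"
        unfolding schoenberg_bit_def by (intro always_eventually allI continuous_intros) auto
    qed simp
    show "f b (e x) = 1/2 + arctan (x \<bullet> b) / pi" if b: "b \<in> Basis" for x b
    proof -
      have "a x (d * k + idx b) = binary_digit k (h (x \<bullet> b))" for k
        using idx[OF b] d by (simp add: a_def)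
      then have "f b (e x) = (\<Sum>k. binary_digit k (h (x \<bullet> b)) / 2 ^ Suc k)"
        unfolding f_def e_def by (simp add: schoenberg_bit_ternary_sum[of "a x", OF a01])
      also have "\<dots> = h (x \<bullet> b)"
        using sums_unique[OF binary_digits_sums[OF h]] by simp
      finally show ?thesis by (simp add: h_def)
    qed
  qed
qed

text \<open>Sequential compactness in the one-point compactification, realised by random variables.
  The codes lie in [0,1], so their laws are tight and Helly's and Skorohod's theorems apply. The
  pointwise form, with \<open>A\<close> the event that the limit stays finite, is what Fatou's lemma
  needs later.\<close>

lemma prob_measures_convergent_subsequence:
  fixes \<sigma> :: "nat \<Rightarrow> 'a::euclidean_space measure"
  assumes ps: "\<And>n. prob_space (\<sigma> n)" and sb: "\<And>n. sets (\<sigma> n) = sets borel"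
  obtains r :: "nat \<Rightarrow> nat" and \<Omega> :: "real measure" and X :: "nat \<Rightarrow> real \<Rightarrow> 'a" and Y A where
    "strict_mono r" "prob_space \<Omega>"
    "\<And>n. X n \<in> \<Omega> \<rightarrow>\<^sub>M borel" "\<And>n. distr \<Omega> borel (X n) = \<sigma> (r n)"
    "Y \<in> \<Omega> \<rightarrow>\<^sub>M borel" "A \<in> sets \<Omega>"
    "AE \<omega> in \<Omega>. \<omega> \<in> A \<longrightarrow> (\<lambda>n. X n \<omega>) \<longlonglongrightarrow> Y \<omega>"
    "AE \<omega> in \<Omega>. \<omega> \<notin> A \<longrightarrow> filterlim (\<lambda>n. norm (X n \<omega>)) at_top sequentially"
proof -
  obtain e :: "'a \<Rightarrow> real" and f :: "'a \<Rightarrow> real \<Rightarrow> real" where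
    em [measurable]: "e \<in> borel_measurable borel" and e01: "\<And>x. e x \<in> {0..1}"
    and fc: "\<And>b. continuous_on UNIV (f b)" and f01: "\<And>b t. f b t \<in> {0..1}"
    and fe: "\<And>x b. b \<in> Basis \<Longrightarrow> f b (e x) = 1/2 + arctan (x \<bullet> b) / pi"
    using ex_space_filling_encoding[where 'a = 'a] by blast
  have fm [measurable]: "f b \<in> borel_measurable borel" for b
    by (rule borel_measurable_continuous_onI[OF fc])
  have em' [measurable]: "e \<in> borel_measurable (\<sigma> n)" for n
    using em by (simp add: measurable_cong_sets[OF sb refl])
  \<comment> \<open>Inverts the chart given by the arctangent. Where \<open>f b t\<close> is 0 or 1
    the tangent takes its default value 0, so the decoded limit is meaningful only on
    \<open>A\<close>.\<close>
  define dec where "dec t = (\<Sum>b\<in>Basis. tan (pi * (f b t - 1/2)) *\<^sub>R b)" for t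
  have decm [measurable]: "dec \<in> borel_measurable borel"
    unfolding dec_def tan_def by measurable
  have dec_inner: "dec t \<bullet> b = tan (pi * (f b t - 1/2))" if "b \<in> Basis" for t b
    using that by (simp add: dec_def inner_sum_left inner_Basis if_distrib cong: if_cong)
  have dec_e: "dec (e x) = x" for x
    by (rule euclidean_eqI) (simp add: dec_inner fe tan_arctan)
  define \<mu> where "\<mu> n = distr (\<sigma> n) borel e" for n
  have rd: "real_distribution (\<mu> n)" for n
    unfolding \<mu>_def using ps by (intro prob_space.real_distribution_distr) auto
  have "tight \<mu>"
    unfolding tight_def
  proof (intro conjI allI impI rd, rule exI[of _ "-1"], rule exI[of _ 1], intro conjI allI)
    fix \<epsilon> :: real and n assume "0 < \<epsilon>"
    have "measure (\<mu> n) {-1<..1} = measure (\<sigma> n) (e -` {-1<..1} \<inter> space (\<sigma> n))"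
      unfolding \<mu>_def by (intro measure_distr) auto
    also have "e -` {-1<..1} \<inter> space (\<sigma> n) = space (\<sigma> n)"
      using e01 by (auto simp: less_le_trans[of "-1" 0])
    finally show "measure (\<mu> n) {-1<..1} > 1 - \<epsilon>"
      using \<open>0 < \<epsilon>\<close> prob_space.prob_space[OF ps] by simp
  qed simp
  from tight_imp_convergent_subsubsequence[OF this strict_mono_id]
  obtain r M where r: "strict_mono (r :: nat \<Rightarrow> nat)" "real_distribution M" "weak_conv_m (\<mu> \<circ> id \<circ> r) M"
    by blast
  have "\<And>n. real_distribution ((\<mu> \<circ> id \<circ> r) n)" using rd by simp
  from Skorohod[OF this r(2,3)]
  obtain \<Omega> :: "real measure" and T Z where \<Omega>: "prob_space \<Omega>"
    and T [measurable]: "\<And>n. T n \<in> borel_measurable \<Omega>" and dT: "\<And>n. distr \<Omega> borel (T n) = \<mu> (r n)"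
    and Z [measurable]: "Z \<in> borel_measurable \<Omega>" and lim: "\<And>\<omega>. \<omega> \<in> space \<Omega> \<Longrightarrow> (\<lambda>n. T n \<omega>) \<longlonglongrightarrow> Z \<omega>"
    unfolding comp_def id_def measurable_lborel1 by blast
  have flim: "(\<lambda>n. f b (T n \<omega>)) \<longlonglongrightarrow> f b (Z \<omega>)" if "\<omega> \<in> space \<Omega>" for \<omega> b
    using fc lim[OF that] by (intro isCont_tendsto_compose[of _ "f b"]) (auto simp: continuous_on_eq_continuous_at)
  \<comment> \<open>Skorohod's variables need not take values in the range of \<open>e\<close>. They
    have the law of \<open>e\<close>, though, and so almost surely lie where the chart is
    invertible.\<close>
  have "AE \<omega> in \<Omega>. 0 < f b (T n \<omega>) \<and> f b (T n \<omega>) < 1" if "b \<in> Basis" for n b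
  proof -
    have "AE t in distr (\<sigma> (r n)) borel e. 0 < f b t \<and> f b t < 1"
    proof (subst AE_distr_iff)
      have "0 < f b (e x) \<and> f b (e x) < 1" for x
        using arctan_bounded[of "x \<bullet> b"] that by (auto simp: fe field_simps)
      then show "AE x in \<sigma> (r n). 0 < f b (e x) \<and> f b (e x) < 1" by simp
    qed (measurable)
    then have "AE t in distr \<Omega> borel (T n). 0 < f b t \<and> f b t < 1"
      by (simp only: dT \<mu>_def)
    then show ?thesis by (subst (asm) AE_distr_iff) measurable
  qed
  then have AE: "AE \<omega> in \<Omega>. \<forall>n. \<forall>b\<in>Basis. 0 < f b (T n \<omega>) \<and> f b (T n \<omega>) < 1"
    by (simp add: AE_all_countable AE_finite_all)
  \<comment> \<open>The limit code lies over the open cube. Otherwise some chart coordinate tends to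
    0 or 1, and the corresponding coordinate of the decoded point is unbounded.\<close>
  define A where "A = {\<omega>\<in>space \<Omega>. \<forall>b\<in>Basis. 0 < f b (Z \<omega>) \<and> f b (Z \<omega>) < 1}"
  show ?thesis
  proof (rule that[OF r(1) \<Omega>, where X = "\<lambda>n \<omega>. dec (T n \<omega>)" and Y = "\<lambda>\<omega>. dec (Z \<omega>)" and A = A])
    show "(\<lambda>\<omega>. dec (T n \<omega>)) \<in> \<Omega> \<rightarrow>\<^sub>M borel" for n by measurable
    show "(\<lambda>\<omega>. dec (Z \<omega>)) \<in> \<Omega> \<rightarrow>\<^sub>M borel" by measurable
    show "distr \<Omega> borel (\<lambda>\<omega>. dec (T n \<omega>)) = \<sigma> (r n)" for n
    proof -
      have "distr \<Omega> borel (\<lambda>\<omega>. dec (T n \<omega>)) = distr (distr \<Omega> borel (T n)) borel dec"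
        by (subst distr_distr) (auto simp: comp_def)
      also have "\<dots> = distr (\<sigma> (r n)) borel (\<lambda>x. dec (e x))"
        unfolding dT \<mu>_def by (subst distr_distr) (auto simp: comp_def)
      also have "\<dots> = \<sigma> (r n)"
        unfolding dec_e by (rule distr_id2) (simp add: sb)
      finally show ?thesis .
    qed
    show "A \<in> sets \<Omega>" unfolding A_def by measurable
    show "AE \<omega> in \<Omega>. \<omega> \<in> A \<longrightarrow> (\<lambda>n. dec (T n \<omega>)) \<longlonglongrightarrow> dec (Z \<omega>)"
    proof (intro AE_I2 impI)
      fix \<omega> assume "\<omega> \<in> A"
      then have \<omega>: "\<omega> \<in> space \<Omega>" "\<And>b. b \<in> Basis \<Longrightarrow> 0 < f b (Z \<omega>) \<and> f b (Z \<omega>) < 1"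
        by (auto simp: A_def)
      show "(\<lambda>n. dec (T n \<omega>)) \<longlonglongrightarrow> dec (Z \<omega>)"
        unfolding dec_def
      proof (rule tendsto_sum)
        fix b :: 'a assume "b \<in> Basis"
        then have "0 < f b (Z \<omega>)" "f b (Z \<omega>) < 1" using \<omega>(2) by auto
        then have "0 < cos (pi * (f b (Z \<omega>) - 1/2))"
          using mult_strict_left_mono[of "-1/2" "f b (Z \<omega>) - 1/2" pi]
            mult_strict_left_mono[of "f b (Z \<omega>) - 1/2" "1/2" pi]
          by (intro cos_gt_zero_pi) auto
        then have "cos (pi * (f b (Z \<omega>) - 1/2)) \<noteq> 0" by simp
        moreover have "(\<lambda>n. pi * (f b (T n \<omega>) - 1/2)) \<longlonglongrightarrow> pi * (f b (Z \<omega>) - 1/2)"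
          by (intro tendsto_mult tendsto_diff tendsto_const flim \<omega>(1))
        ultimately have "(\<lambda>n. tan (pi * (f b (T n \<omega>) - 1/2))) \<longlonglongrightarrow> tan (pi * (f b (Z \<omega>) - 1/2))"
          by (intro isCont_tendsto_compose[OF isCont_tan])
        then
        show "(\<lambda>n. tan (pi * (f b (T n \<omega>) - 1/2)) *\<^sub>R b) \<longlonglongrightarrow> tan (pi * (f b (Z \<omega>) - 1/2)) *\<^sub>R b"
          by (intro tendsto_scaleR tendsto_const)
      qed
    qed
    show "AE \<omega> in \<Omega>. \<omega> \<notin> A \<longrightarrow> filterlim (\<lambda>n. norm (dec (T n \<omega>))) at_top sequentially"
      using AE AE_space
    proof eventually_elim
      case (elim \<omega>)
      show ?case
      proof
        assume "\<omega> \<notin> A"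
        then obtain b where b: "b \<in> Basis" "\<not> (0 < f b (Z \<omega>) \<and> f b (Z \<omega>) < 1)"
          using elim by (auto simp: A_def)
        have inv: "1/2 + arctan (dec (T n \<omega>) \<bullet> b) / pi = f b (T n \<omega>)" for n
        proof -
          have "0 < f b (T n \<omega>)" "f b (T n \<omega>) < 1" using elim b(1) by auto
          then have "arctan (tan (pi * (f b (T n \<omega>) - 1/2))) = pi * (f b (T n \<omega>) - 1/2)"
            using mult_strict_left_mono[of "-1/2" "f b (T n \<omega>) - 1/2" pi]
              mult_strict_left_mono[of "f b (T n \<omega>) - 1/2" "1/2" pi]
            by (intro arctan_tan) auto
          then show ?thesis by (simp add: dec_inner b(1))
        qed
        have "\<forall>\<^sub>F n in sequentially. c \<le> \<bar>dec (T n \<omega>) \<bullet> b\<bar>" for c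
        proof (cases "f b (Z \<omega>) = 0")
          case True
          have "0 < 1/2 + arctan (- c) / pi" using arctan_bounded[of "- c"] by (simp add: field_simps)
          then have "\<forall>\<^sub>F n in sequentially. f b (T n \<omega>) < 1/2 + arctan (- c) / pi"
            using flim[OF elim(2), of b] True by (intro order_tendstoD(2)[of _ 0]) auto
          then show ?thesis
          proof eventually_elim
            case (elim n)
            then have "arctan (dec (T n \<omega>) \<bullet> b) < arctan (- c)"
              unfolding inv[of n, symmetric] by (simp add: divide_less_cancel)
            then show ?case by (simp add: arctan_less_iff)
          qed
        next
          case False
          then have 1: "f b (Z \<omega>) = 1" using b(2) f01[of b "Z \<omega>"] by force
          have "1/2 + arctan c / pi < 1" using arctan_bounded[of c] by (simp add: field_simps)
          then have "\<forall>\<^sub>F n in sequentially. 1/2 + arctan c / pi < f b (T n \<omega>)"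
            using flim[OF elim(2), of b] 1 by (intro order_tendstoD(1)[of _ 1]) auto
          then show ?thesis
          proof eventually_elim
            case (elim n)
            then have "arctan c < arctan (dec (T n \<omega>) \<bullet> b)"
              unfolding inv[of n, symmetric] by (simp add: divide_less_cancel)
            then show ?case by (simp add: arctan_less_iff)
          qed
        qed
        then have "filterlim (\<lambda>n. \<bar>dec (T n \<omega>) \<bullet> b\<bar>) at_top sequentially"
          by (simp add: filterlim_at_top)
        then show "filterlim (\<lambda>n. norm (dec (T n \<omega>))) at_top sequentially"
          by (rule filterlim_at_top_mono) (simp add: Basis_le_norm b(1))
      qed
    qed
  qed
qed

section \<open>The maximum principle\<close>

text \<open>The fourth derivative of \<open>u powr (- a)\<close> is positive and the remainder
  carries an even power of \<open>u - r\<close>, so the cubic Taylor polynomial is a lower bound.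
  Going to cubic order leaves only errors of order h^4 once opposite steps are added.\<close>

lemma powr_minus_Taylor_le:
  fixes a r u :: real
  assumes a: "0 < a" and r: "0 < r" and u: "0 < u"
  shows "r powr (- a) - a * r powr (- a - 1) * (u - r) + a * (a + 1) / 2 * r powr (- a - 2) * (u - r)\<^sup>2
    - a * (a + 1) * (a + 2) / 6 * r powr (- a - 3) * (u - r) ^ 3 \<le> u powr (- a)"
proof (cases "u = r")
  case False
  define D where "D m t = (\<Prod>i<m. - a - real i) * t powr (- a - real m)" for m t
  have der: "DERIV (D m) t :> D (Suc m) t" if "0 < t" for m t
    unfolding D_def using that by (auto intro!: derivative_eq_intros simp: field_simps)
  obtain t where t: "if u < r then u < t \<and> t < r else r < t \<and> t < u"
    "u powr (- a) = (\<Sum>m<4. D m r / fact m * (u - r) ^ m) + D 4 t / fact 4 * (u - r) ^ 4"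
  proof -
    have "D 0 = (\<lambda>t. t powr (- a))" by (simp add: D_def fun_eq_iff)
    moreover have "\<forall>m t. m < 4 \<and> min u r \<le> t \<and> t \<le> max u r \<longrightarrow> DERIV (D m) t :> D (Suc m) t"
      using r u by (auto intro!: der)
    ultimately show thesis
      using Taylor[of 4 D "\<lambda>t. t powr (- a)" "min u r" "max u r" r u] False that by force
  qed
  have "0 < t" using t(1) r u by (auto split: if_splits)
  have "(\<Prod>i<4. - a - real i) = a * (a + 1) * (a + 2) * (a + 3)"
    by (simp add: numeral_eq_Suc algebra_simps)
  then have "0 \<le> D 4 t" using a by (simp add: D_def)
  then have "0 \<le> D 4 t / fact 4 * (u - r) ^ 4" by simp
  moreover have "(\<Sum>m<4. D m r / fact m * (u - r) ^ m)
      = r powr (- a) - a * r powr (- a - 1) * (u - r) + a * (a + 1) / 2 * r powr (- a - 2) * (u - r)\<^sup>2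
    - a * (a + 1) * (a + 2) / 6 * r powr (- a - 3) * (u - r) ^ 3"
  proof -
    have "D 0 r = r powr (- a)" "D 1 r = - a * r powr (- a - 1)"
      "D 2 r = a * (a + 1) * r powr (- a - 2)" "D 3 r = - (a * (a + 1) * (a + 2)) * r powr (- a - 3)"
      by (simp_all add: D_def numeral_eq_Suc algebra_simps)
    moreover have "(\<Sum>m<4. D m r / fact m * (u - r) ^ m) = D 0 r + D 1 r * (u - r)
        + D 2 r / 2 * (u - r)\<^sup>2 + D 3 r / 6 * (u - r) ^ 3"
      by (simp add: eval_nat_numeral)
    ultimately show ?thesis by simp
  qed
  ultimately show ?thesis using t(2) by linarith
qed simp

text \<open>The discrete form of the inequality s (s + 2 - d) |z|^(-s-2) >= 0 for the Laplacian of
  |z|^-s, with a fourth-order error that is uniform for |z| >= \<delta>.\<close>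

lemma powr_minus_discrete_laplacian:
  fixes z :: "'a::euclidean_space"
  assumes s: "0 < s" "real DIM('a) - 2 \<le> s" and z: "\<delta> \<le> norm z" and h: "0 < h" "h < \<delta>"
  shows "2 * real DIM('a) * norm z powr (- s)
    \<le> (\<Sum>b\<in>Basis. norm (z + h *\<^sub>R b) powr (- s) + norm (z - h *\<^sub>R b) powr (- s))
      + (s/2) * (s/2 + 1) * (s/2 + 2) * (real DIM('a) / 3 + 4) * \<delta> powr (- s - 4) * h ^ 4"
proof -
  \<comment> \<open>Writing |z|^-s as r^-a with r = |z|^2 makes the increments of \<open>r\<close>
    polynomial in \<open>h\<close>.\<close>
  define a r d where "a = s / 2" and "r = (norm z)\<^sup>2" and "d = real DIM('a)"
  define f1 f2 f3 where "f1 = r powr (- a - 1)" and "f2 = r powr (- a - 2)" and "f3 = r powr (- a - 3)"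
  have \<delta>: "0 < \<delta>" "0 < norm z" using h z by auto
  have r: "0 < r" using \<delta> by (simp add: r_def)
  have a: "0 < a" using s by (simp add: a_def)
  have f12: "f1 = r * f2" unfolding f1_def f2_def using r by (simp add: powr_diff field_simps power2_eq_square)
  have f23: "f2 = r * f3" unfolding f2_def f3_def using r by (simp add: powr_diff field_simps power2_eq_square power3_eq_cube)
  have f: "0 \<le> f1" "0 \<le> f2" "0 \<le> f3" by (auto simp: f1_def f2_def f3_def)
  have sq: "((norm w)\<^sup>2) powr (- a) = norm w powr (- s)" for w :: 'a
  proof (cases "w = 0")
    case False
    then have "(norm w)\<^sup>2 = norm w powr 2" by simp
    then show ?thesis by (simp only: powr_powr) (simp add: a_def)
  qed simp
  have step: "2 * r powr (- a) - 2 * h\<^sup>2 * a * f1 + (4 * h\<^sup>2 * (z \<bullet> b)\<^sup>2 + h ^ 4) * (a * (a + 1)) * f2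
      - (h ^ 6 / 3 + 4 * h ^ 4 * (z \<bullet> b)\<^sup>2) * (a * (a + 1) * (a + 2)) * f3
      \<le> norm (z + h *\<^sub>R b) powr (- s) + norm (z - h *\<^sub>R b) powr (- s)" if b: "b \<in> Basis" for b
  proof -
    define y where "y = z \<bullet> b"
    have hb: "norm (h *\<^sub>R b) = h" using h b by simp
    have up: "(norm (z + h *\<^sub>R b))\<^sup>2 = r + (2 * h * y + h\<^sup>2)" "(norm (z - h *\<^sub>R b))\<^sup>2 = r + (- 2 * h * y + h\<^sup>2)"
      unfolding r_def y_def power2_norm_eq_inner using b
      by (simp_all add: inner_add_left inner_add_right inner_diff_left inner_diff_right
          inner_commute power2_eq_square)
    have "norm (z + h *\<^sub>R b) > 0" "norm (z - h *\<^sub>R b) > 0"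
      using norm_triangle_ineq2[of z "h *\<^sub>R b"] norm_triangle_ineq2[of z "- (h *\<^sub>R b)"] z h hb by auto
    then have pos: "0 < r + (2 * h * y + h\<^sup>2)" "0 < r + (- 2 * h * y + h\<^sup>2)"
      unfolding up[symmetric] by auto
    have "2 * r powr (- a) - 2 * h\<^sup>2 * a * f1 + (4 * h\<^sup>2 * y\<^sup>2 + h ^ 4) * (a * (a + 1)) * f2
      - (h ^ 6 / 3 + 4 * h ^ 4 * y\<^sup>2) * (a * (a + 1) * (a + 2)) * f3
      = (r powr (- a) - a * f1 * (2 * h * y + h\<^sup>2) + a * (a + 1) / 2 * f2 * (2 * h * y + h\<^sup>2)\<^sup>2
          - a * (a + 1) * (a + 2) / 6 * f3 * (2 * h * y + h\<^sup>2) ^ 3)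
      + (r powr (- a) - a * f1 * (- 2 * h * y + h\<^sup>2) + a * (a + 1) / 2 * f2 * (- 2 * h * y + h\<^sup>2)\<^sup>2
          - a * (a + 1) * (a + 2) / 6 * f3 * (- 2 * h * y + h\<^sup>2) ^ 3)"
      by (simp add: field_simps power2_eq_square power3_eq_cube eval_nat_numeral)
    also have "\<dots> \<le> (r + (2 * h * y + h\<^sup>2)) powr (- a) + (r + (- 2 * h * y + h\<^sup>2)) powr (- a)"
      using powr_minus_Taylor_le[OF a r pos(1)] powr_minus_Taylor_le[OF a r pos(2)]
      unfolding f1_def f2_def f3_def by (intro add_mono) simp_all
    finally show ?thesis unfolding sq[symmetric] up y_def .
  qed
  have sy: "(\<Sum>b\<in>Basis. (z \<bullet> b)\<^sup>2) = r"
    unfolding r_def power2_norm_eq_inner by (subst euclidean_inner) (simp add: power2_eq_square)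
  have "(\<Sum>b\<in>(Basis :: 'a set). 2 * r powr (- a) - 2 * h\<^sup>2 * a * f1 + (4 * h\<^sup>2 * (z \<bullet> b)\<^sup>2 + h ^ 4) * (a * (a + 1)) * f2
      - (h ^ 6 / 3 + 4 * h ^ 4 * (z \<bullet> b)\<^sup>2) * (a * (a + 1) * (a + 2)) * f3)
    = 2 * d * r powr (- a) - 2 * d * h\<^sup>2 * a * f1 + (4 * h\<^sup>2 * r + d * h ^ 4) * (a * (a + 1)) * f2
      - (d * h ^ 6 / 3 + 4 * h ^ 4 * r) * (a * (a + 1) * (a + 2)) * f3"
    by (simp add: sum.distrib sum_subtractf distrib_right distrib_left flip: sum_distrib_left sum_distrib_right sy)
      (simp add: d_def field_simps)
  also have "\<dots> \<ge> 2 * d * r powr (- a) - (d / 3 + 4) * (a * (a + 1) * (a + 2)) * (\<delta> powr (- s - 4)) * h ^ 4"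
  proof -
    \<comment> \<open>The sign of the h^2 coefficient. Here 2 (a + 1) - d = s + 2 - d, so this is
      where s >= d - 2 is used.\<close>
    have "0 \<le> 2 * h\<^sup>2 * a * f1 * (2 * (a + 1) - d)"
      using a f s by (intro mult_nonneg_nonneg) (auto simp: a_def d_def)
    then have 1: "2 * d * h\<^sup>2 * a * f1 \<le> 4 * h\<^sup>2 * r * (a * (a + 1)) * f2"
      by (simp add: f12 algebra_simps)
    have 2: "0 \<le> d * h ^ 4 * (a * (a + 1)) * f2" using a f by (simp add: d_def)
    have "h\<^sup>2 \<le> r" unfolding r_def using h z by (intro power_mono) auto
    then have "d / 3 * h ^ 4 * h\<^sup>2 \<le> d / 3 * h ^ 4 * r" by (intro mult_left_mono) (auto simp: d_def)
    then have "d * h ^ 6 / 3 + 4 * h ^ 4 * r \<le> (d / 3 + 4) * h ^ 4 * r"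
      by (simp add: algebra_simps flip: power_add)
    then have "(d * h ^ 6 / 3 + 4 * h ^ 4 * r) * (a * (a + 1) * (a + 2) * f3)
        \<le> (d / 3 + 4) * h ^ 4 * r * (a * (a + 1) * (a + 2) * f3)"
      using a f by (intro mult_right_mono) auto
    also have "\<dots> = (d / 3 + 4) * (a * (a + 1) * (a + 2)) * f2 * h ^ 4" by (simp add: f23)
    also have "f2 \<le> \<delta> powr (- s - 4)"
    proof -
      have "f2 = norm z powr (- s - 4)"
      proof -
        have "r = norm z powr 2" using \<delta> by (simp add: r_def)
        then show ?thesis by (simp only: f2_def powr_powr) (simp add: a_def)
      qed
      also have "\<dots> \<le> \<delta> powr (- s - 4)" using s z \<delta> by (intro powr_mono2') auto
      finally show ?thesis .
    qed
    finally have 3: "(d * h ^ 6 / 3 + 4 * h ^ 4 * r) * (a * (a + 1) * (a + 2) * f3)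
      \<le> (d / 3 + 4) * (a * (a + 1) * (a + 2)) * \<delta> powr (- s - 4) * h ^ 4"
      using a by (simp add: mult_left_mono mult_right_mono d_def)
    show ?thesis using 1 2 3 by (simp add: algebra_simps)
  qed
  finally have "2 * d * r powr (- a) - (d / 3 + 4) * (a * (a + 1) * (a + 2)) * (\<delta> powr (- s - 4)) * h ^ 4
    \<le> (\<Sum>b\<in>Basis. norm (z + h *\<^sub>R b) powr (- s) + norm (z - h *\<^sub>R b) powr (- s))"
    using sum_mono[OF step] by (rule order_trans)
  moreover have "r powr (- a) = norm z powr (- s)" unfolding r_def by (rule sq)
  ultimately show ?thesis
    by (simp add: d_def a_def algebra_simps)
qed

lemma AE_in_support:
  assumes "fin_borel \<nu>" "K \<in> sets borel" "emeasure \<nu> (UNIV - K) = 0"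
  shows "AE x in \<nu>. x \<in> K"
proof -
  have "UNIV - K \<in> null_sets \<nu>" using assms fin_borelD(2)[OF assms(1)] by (auto simp: null_sets_def)
  then show ?thesis by (rule AE_I') auto
qed

lemma potential_le_far:
  assumes s: "0 < s" and \<nu>: "fin_borel \<nu>" "K \<in> sets borel" "emeasure \<nu> (UNIV - K) = 0"
    and d: "0 < \<delta>" "\<And>t. t \<in> K \<Longrightarrow> \<delta> \<le> dist x t"
  shows "potential s \<nu> x \<le> ennreal (\<delta> powr (- s)) * emeasure \<nu> UNIV"
proof -
  have "potential s \<nu> x \<le> (\<integral>\<^sup>+ t. ennreal (\<delta> powr (- s)) \<partial>\<nu>)"
    unfolding potential_def using AE_in_support[OF \<nu>]
    by (intro nn_integral_mono_AE) (auto intro!: riesz_kernel_le s d elim!: eventually_mono)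
  then show ?thesis by (simp add: fin_borelD(3)[OF \<nu>(1)])
qed

text \<open>The kernel inequality integrated over the measure. \<open>C\<close> depends only on
  \<open>s\<close>, \<delta> and the dimension, so that \<open>h\<close> may be chosen after
  it.\<close>

lemma potential_discrete_subharmonic:
  fixes \<nu> :: "'a::euclidean_space measure"
  assumes s: "0 < s" "real DIM('a) - 2 \<le> s" and \<delta>: "0 < \<delta>"
  obtains C where "0 \<le> C"
    "\<And>\<nu> :: 'a measure. \<And>K q h. fin_borel \<nu> \<Longrightarrow> K \<in> sets borel \<Longrightarrow> emeasure \<nu> (UNIV - K) = 0 \<Longrightarrow>
      (\<And>t. t \<in> K \<Longrightarrow> \<delta> \<le> dist q t) \<Longrightarrow> 0 < h \<Longrightarrow> h < \<delta> \<Longrightarrow>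
      ennreal (2 * real DIM('a)) * potential s \<nu> q
      \<le> (\<Sum>b\<in>Basis. potential s \<nu> (q + h *\<^sub>R b) + potential s \<nu> (q - h *\<^sub>R b))
        + ennreal (C * h ^ 4) * emeasure \<nu> UNIV"
proof -
  define C where "C = (s/2) * (s/2 + 1) * (s/2 + 2) * (real DIM('a) / 3 + 4) * \<delta> powr (- s - 4)"
  show ?thesis
  proof (rule that[of C])
    show C: "0 \<le> C" using s by (simp add: C_def)
    fix \<nu> :: "'a measure" and K and q :: 'a and h :: real
    assume \<nu>: "fin_borel \<nu>" "K \<in> sets borel" "emeasure \<nu> (UNIV - K) = 0"
      and q: "\<And>t. t \<in> K \<Longrightarrow> \<delta> \<le> dist q t" and h: "0 < h" "h < \<delta>"
    have [measurable]: "riesz_kernel s x \<in> borel_measurable \<nu>" for x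
      by (simp add: measurable_fin_borel[OF \<nu>(1)])
    have "ennreal (2 * real DIM('a)) * potential s \<nu> q
        = (\<integral>\<^sup>+ t. ennreal (2 * real DIM('a)) * riesz_kernel s q t \<partial>\<nu>)"
      unfolding potential_def by (rule nn_integral_cmult[symmetric]) measurable
    also have "\<dots> \<le> (\<integral>\<^sup>+ t. (\<Sum>b\<in>Basis. riesz_kernel s (q + h *\<^sub>R b) t + riesz_kernel s (q - h *\<^sub>R b) t)
        + ennreal (C * h ^ 4) \<partial>\<nu>)"
    proof (rule nn_integral_mono_AE)
      show "AE t in \<nu>. ennreal (2 * real DIM('a)) * riesz_kernel s q t
        \<le> (\<Sum>b\<in>Basis. riesz_kernel s (q + h *\<^sub>R b) t + riesz_kernel s (q - h *\<^sub>R b) t) + ennreal (C * h ^ 4)"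
        using AE_in_support[OF \<nu>]
      proof eventually_elim
        case (elim t)
        have qt: "\<delta> \<le> norm (q - t)" using q[OF elim] by (simp add: dist_norm)
        then have "q \<noteq> t" using \<delta> by auto
        have ge: "ennreal (norm (x - t) powr (- s)) \<le> riesz_kernel s x t" for x
          by (intro riesz_kernel_ge s) (simp add: dist_norm)
        have "ennreal (2 * real DIM('a)) * riesz_kernel s q t
            = ennreal (2 * real DIM('a) * norm (q - t) powr (- s))"
          using \<open>q \<noteq> t\<close> by (simp add: riesz_kernel_def dist_norm ennreal_mult)
        also have "\<dots> \<le> ennreal ((\<Sum>b\<in>Basis. norm (q - t + h *\<^sub>R b) powr (- s)
            + norm (q - t - h *\<^sub>R b) powr (- s)) + C * h ^ 4)"
          unfolding C_def by (intro ennreal_leI powr_minus_discrete_laplacian s qt h)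
        also have "\<dots> = (\<Sum>b\<in>Basis. ennreal (norm (q + h *\<^sub>R b - t) powr (- s))
            + ennreal (norm (q - h *\<^sub>R b - t) powr (- s))) + ennreal (C * h ^ 4)"
          using C by (simp add: ennreal_plus sum_nonneg algebra_simps flip: sum_ennreal)
        also have "\<dots> \<le> (\<Sum>b\<in>Basis. riesz_kernel s (q + h *\<^sub>R b) t + riesz_kernel s (q - h *\<^sub>R b) t)
            + ennreal (C * h ^ 4)"
          by (intro add_mono sum_mono ge order_refl)
        finally show ?case .
      qed
    qed
    also have "\<dots> = (\<Sum>b\<in>Basis. potential s \<nu> (q + h *\<^sub>R b) + potential s \<nu> (q - h *\<^sub>R b))
        + ennreal (C * h ^ 4) * emeasure \<nu> UNIV"
      unfolding potential_def
      by (simp add: nn_integral_add nn_integral_sum fin_borelD(3)[OF \<nu>(1)])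
    finally show "ennreal (2 * real DIM('a)) * potential s \<nu> q
      \<le> (\<Sum>b\<in>Basis. potential s \<nu> (q + h *\<^sub>R b) + potential s \<nu> (q - h *\<^sub>R b))
        + ennreal (C * h ^ 4) * emeasure \<nu> UNIV" .
  qed
qed

text \<open>A point nearly maximising \<open>potential s \<nu> x + \<kappa> * norm x ^ 2\<close> would lie off the neighbourhood, where
  the potential is discretely subharmonic up to order \<open>h\<^sup>4\<close> while the quadratic term gains order \<open>h\<^sup>2\<close>.\<close>
lemma potential_le_of_le_near_support:
  fixes \<nu> :: "'a::euclidean_space measure"
  assumes s: "0 < s" "real DIM('a) - 2 \<le> s"
    and \<nu>: "fin_borel \<nu>" "emeasure \<nu> (UNIV - K) = 0" and K: "compact K" "K \<noteq> {}"
    and \<delta>: "0 < \<delta>" and M: "0 < M" and le: "\<And>x. infdist x K < \<delta> \<Longrightarrow> potential s \<nu> x \<le> ennreal M"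
  shows "potential s \<nu> p \<le> ennreal M"
proof (rule ccontr)
  assume p: "\<not> potential s \<nu> p \<le> ennreal M"
  have Kb: "K \<in> sets borel" using K by (simp add: compact_imp_closed)
  define d where "d = real DIM('a)"
  have d: "0 < d" by (simp add: d_def)
  obtain m where m: "emeasure \<nu> UNIV = ennreal m" "0 \<le> m"
    using fin_borelD(5)[OF \<nu>(1), of UNIV] by (cases "emeasure \<nu> UNIV") auto
  have far: "\<delta> \<le> dist x t" if "\<not> infdist x K < \<delta>" "t \<in> K" for x t
    using infdist_le[OF that(2), of x] that(1) by simp
  \<comment> \<open>A global bound, from the hypothesis near \<open>K\<close> and from the distance
    \<delta> elsewhere. It makes the real-valued \<open>u\<close> faithful and the supremum below
    finite.\<close>
  define Bd where "Bd = max M (\<delta> powr (- s) * m)"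
  have Bd: "potential s \<nu> x \<le> ennreal Bd" for x
  proof (cases "infdist x K < \<delta>")
    case True
    have "ennreal M \<le> ennreal Bd" by (intro ennreal_leI) (simp add: Bd_def)
    then show ?thesis using le[OF True] by simp
  next
    case False
    have "potential s \<nu> x \<le> ennreal (\<delta> powr (- s)) * ennreal m"
      using potential_le_far[OF s(1) \<nu>(1) Kb \<nu>(2) \<delta> far[OF False]] by (simp add: m)
    also have "\<dots> \<le> ennreal Bd"
      using m by (simp add: Bd_def ennreal_leI flip: ennreal_mult)
    finally show ?thesis .
  qed
  define u where "u x = enn2real (potential s \<nu> x)" for x
  have u: "potential s \<nu> x = ennreal (u x)" "0 \<le> u x" "u x \<le> Bd" for x
  proof -
    show "0 \<le> u x" by (simp add: u_def)
    show "potential s \<nu> x = ennreal (u x)"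
      using Bd[of x] unfolding u_def by (intro ennreal_enn2real[symmetric]) (simp add: le_less_trans)
    then show "u x \<le> Bd" using Bd[of x] M by (simp add: Bd_def)
  qed
  have up: "M < u p" using p M by (simp add: u)
  obtain R0 where R0: "0 < R0" "\<And>t. t \<in> K \<Longrightarrow> norm t \<le> R0"
    using compact_imp_bounded[OF K(1)] by (auto simp: bounded_pos)
  have "((\<lambda>T. T powr (- s) * m) \<longlongrightarrow> 0 * m) at_top"
    by (intro tendsto_mult tendsto_neg_powr tendsto_const filterlim_ident) (use s in simp)
  then have "\<forall>\<^sub>F T in at_top. T powr (- s) * m < M"
    by (rule order_tendstoD(2)) (use M in simp)
  then obtain T0 where T0: "\<And>T. T0 \<le> T \<Longrightarrow> T powr (- s) * m < M"
    by (auto simp: eventually_at_top_linorder)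
  define R where "R = R0 + max 1 (max T0 (norm p))"
  have pR: "norm p \<le> R" using R0(1) by (simp add: R_def)
  have uR: "u x \<le> M" if "R \<le> norm x" for x
  proof -
    have "potential s \<nu> x \<le> ennreal (max 1 T0 powr (- s)) * emeasure \<nu> UNIV"
    proof (rule potential_le_far[OF s(1) \<nu>(1) Kb \<nu>(2)])
      fix t assume "t \<in> K"
      moreover have "max 1 T0 \<le> R - R0" by (simp add: R_def)
      ultimately show "max 1 T0 \<le> dist x t"
        using R0(2)[of t] that norm_triangle_ineq2[of x t] unfolding dist_norm by linarith
    qed simp
    also have "\<dots> \<le> ennreal M"
      using T0[of "max 1 T0"] m by (simp add: ennreal_leI flip: ennreal_mult)
    finally show ?thesis using M by (simp add: u)
  qed
  \<comment> \<open>Spends half of the gap \<open>u p - M\<close> on the quadratic term, whose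
    maximum on the ball is \<open>\<kappa> * (R + 1)\<^sup>2\<close>. The radius is R + 1 so that
    the neighbours \<open>q \<plusminus> h b\<close> with h <= 1 stay inside.\<close>
  define \<kappa> where "\<kappa> = (u p - M) / (2 * (R + 1)\<^sup>2)"
  have R: "0 < R" using R0(1) by (simp add: R_def)
  have \<kappa>: "0 < \<kappa>" "M + \<kappa> * (R + 1)\<^sup>2 < u p"
    using up R by (auto simp: \<kappa>_def field_simps)
  define v where "v x = u x + \<kappa> * (norm x)\<^sup>2" for x
  define S where "S = (SUP x\<in>cball 0 (R + 1). v x)"
  have nb: "\<kappa> * (norm x)\<^sup>2 \<le> \<kappa> * (R + 1)\<^sup>2" if "x \<in> cball 0 (R + 1)" for x
    using that \<kappa> by (intro mult_left_mono power_mono) auto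
  have bdd: "bdd_above (v ` cball 0 (R + 1))"
  proof (rule bdd_aboveI2)
    fix x :: 'a assume "x \<in> cball 0 (R + 1)"
    then show "v x \<le> Bd + \<kappa> * (R + 1)\<^sup>2" unfolding v_def by (intro add_mono u nb)
  qed
  have vS: "v x \<le> S" if "x \<in> cball 0 (R + 1)" for x
    unfolding S_def using that bdd by (intro cSUP_upper)
  have "u p \<le> v p" using \<kappa> by (simp add: v_def)
  also have "v p \<le> S" using pR by (intro vS) simp
  finally have upS: "u p \<le> S" .
  obtain C where C: "0 \<le> C" and sub: "\<And>q h. (\<And>t. t \<in> K \<Longrightarrow> \<delta> \<le> dist q t) \<Longrightarrow> 0 < h \<Longrightarrow> h < \<delta> \<Longrightarrow>
      ennreal (2 * real DIM('a)) * potential s \<nu> q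
      \<le> (\<Sum>b\<in>Basis. potential s \<nu> (q + h *\<^sub>R b) + potential s \<nu> (q - h *\<^sub>R b))
        + ennreal (C * h ^ 4) * emeasure \<nu> UNIV"
  proof (rule potential_discrete_subharmonic[OF s \<delta>])
    fix C
    assume C: "0 \<le> C" and sub: "\<And>\<nu> :: 'a measure. \<And>K q h. fin_borel \<nu> \<Longrightarrow> K \<in> sets borel \<Longrightarrow>
      emeasure \<nu> (UNIV - K) = 0 \<Longrightarrow> (\<And>t. t \<in> K \<Longrightarrow> \<delta> \<le> dist q t) \<Longrightarrow> 0 < h \<Longrightarrow> h < \<delta> \<Longrightarrow>
      ennreal (2 * real DIM('a)) * potential s \<nu> q
      \<le> (\<Sum>b\<in>Basis. potential s \<nu> (q + h *\<^sub>R b) + potential s \<nu> (q - h *\<^sub>R b))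
        + ennreal (C * h ^ 4) * emeasure \<nu> UNIV"
    show thesis by (rule that[OF C sub[OF \<nu>(1) Kb \<nu>(2)]])
  qed
  \<comment> \<open>Small enough for the quadratic gain, of size \<kappa> d h^2, to beat the error C
    m h^4.\<close>
  define h where "h = min (min (\<delta> / 2) 1) (\<kappa> * d / (C * m + 1))"
  have h: "0 < h" "h < \<delta>" "h \<le> 1" "C * m * h\<^sup>2 < \<kappa> * d"
  proof -
    have Cm: "0 \<le> C * m" using C m by simp
    then have pos: "0 < \<kappa> * d / (C * m + 1)" using \<kappa> d by (intro divide_pos_pos) auto
    show h: "0 < h" "h < \<delta>" "h \<le> 1" using pos \<delta> by (auto simp: h_def)
    have "C * m * h\<^sup>2 \<le> C * m * h"
      using h Cm by (intro mult_left_mono) (auto simp: power2_eq_square mult_left_le)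
    also have "\<dots> < (C * m + 1) * h" using h by (simp add: algebra_simps)
    also have "\<dots> \<le> (C * m + 1) * (\<kappa> * d / (C * m + 1))"
      using Cm by (intro mult_left_mono) (auto simp: h_def)
    finally show "C * m * h\<^sup>2 < \<kappa> * d" using Cm by (simp add: add_nonneg_eq_0_iff)
  qed
  \<comment> \<open>A near-maximiser replaces a maximum point. The second bound forces
    \<open>u q\<close> above \<open>M\<close>, so that \<open>q\<close> lies off the neighbourhood
    of \<open>K\<close> and within radius \<open>R\<close>.\<close>
  have "max (S - \<kappa> * h\<^sup>2 / 2) (M + \<kappa> * (R + 1)\<^sup>2) < S" using upS \<kappa> h by simp
  then obtain q where q: "q \<in> cball 0 (R + 1)" "S - \<kappa> * h\<^sup>2 / 2 < v q" "M + \<kappa> * (R + 1)\<^sup>2 < v q"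
    using less_cSUP_iff[OF _ bdd, of "max (S - \<kappa> * h\<^sup>2 / 2) (M + \<kappa> * (R + 1)\<^sup>2)"] R
    unfolding S_def[symmetric] by (auto simp del: mem_cball_0)
  have "M < u q" using q(3) nb[OF q(1)] by (simp add: v_def)
  then have "\<not> infdist q K < \<delta>" "norm q < R" using le[of q] uR[of q] M by (auto simp: u not_le[symmetric])
  have lap: "ennreal (2 * real DIM('a)) * potential s \<nu> q
      \<le> (\<Sum>b\<in>Basis. potential s \<nu> (q + h *\<^sub>R b) + potential s \<nu> (q - h *\<^sub>R b))
        + ennreal (C * h ^ 4) * emeasure \<nu> UNIV"
    by (rule sub[OF _ h(1,2)]) (rule far[OF \<open>\<not> infdist q K < \<delta>\<close>])
  have nbr: "q + h *\<^sub>R b \<in> cball 0 (R + 1)" "q - h *\<^sub>R b \<in> cball 0 (R + 1)" if "b \<in> Basis" for b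
    using that h \<open>norm q < R\<close> norm_triangle_ineq[of q "h *\<^sub>R b"] norm_triangle_ineq4[of q "h *\<^sub>R b"]
    by auto
  have "ennreal (2 * d * u q) = ennreal (2 * real DIM('a)) * potential s \<nu> q"
    using u(2)[of q] by (simp add: u(1) d_def ennreal_mult)
  also note lap
  also have "(\<Sum>b\<in>Basis. potential s \<nu> (q + h *\<^sub>R b) + potential s \<nu> (q - h *\<^sub>R b))
        + ennreal (C * h ^ 4) * emeasure \<nu> UNIV
      = ennreal ((\<Sum>b\<in>Basis. u (q + h *\<^sub>R b) + u (q - h *\<^sub>R b)) + C * h ^ 4 * m)"
    using C h m u(2) by (simp add: u(1) ennreal_plus sum_nonneg ennreal_mult flip: sum_ennreal)
  finally have "2 * d * u q \<le> (\<Sum>b\<in>Basis. u (q + h *\<^sub>R b) + u (q - h *\<^sub>R b)) + C * h ^ 4 * m"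
    using C h m u(2) by (subst (asm) ennreal_le_iff) (auto intro!: add_nonneg_nonneg sum_nonneg)
  also have "(\<Sum>b\<in>Basis. u (q + h *\<^sub>R b) + u (q - h *\<^sub>R b))
      \<le> (\<Sum>b\<in>(Basis::'a set). 2 * S - 2 * \<kappa> * (norm q)\<^sup>2 - 2 * \<kappa> * h\<^sup>2)"
  proof (rule sum_mono)
    fix b :: 'a assume b: "b \<in> Basis"
    have "(norm (q + h *\<^sub>R b))\<^sup>2 + (norm (q - h *\<^sub>R b))\<^sup>2 = 2 * (norm q)\<^sup>2 + 2 * h\<^sup>2"
      unfolding power2_norm_eq_inner using b
      by (simp add: inner_add_left inner_add_right inner_diff_left inner_diff_right inner_commute power2_eq_square)
    then have "\<kappa> * (norm (q + h *\<^sub>R b))\<^sup>2 + \<kappa> * (norm (q - h *\<^sub>R b))\<^sup>2 = 2 * \<kappa> * (norm q)\<^sup>2 + 2 * \<kappa> * h\<^sup>2"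
      by (simp only: distrib_left[symmetric] mult.assoc mult.left_commute)
    then show "u (q + h *\<^sub>R b) + u (q - h *\<^sub>R b) \<le> 2 * S - 2 * \<kappa> * (norm q)\<^sup>2 - 2 * \<kappa> * h\<^sup>2"
      using vS[OF nbr(1)[OF b]] vS[OF nbr(2)[OF b]] by (simp add: v_def)
  qed
  also have "\<dots> = 2 * d * S - 2 * d * \<kappa> * (norm q)\<^sup>2 - 2 * d * \<kappa> * h\<^sup>2"
    by (simp add: d_def algebra_simps)
  finally have "2 * d * v q \<le> 2 * d * S - 2 * d * \<kappa> * h\<^sup>2 + C * h ^ 4 * m"
    by (simp add: v_def algebra_simps)
  moreover have "2 * d * (S - \<kappa> * h\<^sup>2 / 2) < 2 * d * v q" using q(2) d by simp
  ultimately have "\<kappa> * d * h\<^sup>2 < C * m * h\<^sup>2 * h\<^sup>2"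
    by (simp add: algebra_simps flip: power_add)
  then have "\<kappa> * d < C * m * h\<^sup>2" using h(1) by (simp add: mult_less_cancel_right)
  then show False using h(4) by simp
qed

section \<open>Potentials near the set that carries the measure\<close>

definition local_potential :: "real \<Rightarrow> real \<Rightarrow> 'a::euclidean_space measure \<Rightarrow> 'a \<Rightarrow> ennreal" where
  "local_potential s \<rho> M x = (\<integral>\<^sup>+ t. riesz_kernel s x t * indicator (ball x \<rho>) t \<partial>M)"

lemma local_potential_measurable [measurable]:
  fixes M :: "'a::euclidean_space measure"
  assumes "fin_borel M" shows "local_potential s \<rho> M \<in> borel_measurable borel"
proof -
  interpret sigma_finite_measure M using fin_borelD[OF assms] by simp
  have *: "sets (borel \<Otimes>\<^sub>M M) = sets (borel \<Otimes>\<^sub>M borel)"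
    by (intro sets_pair_measure_cong) (auto simp: fin_borelD[OF assms])
  have "{p::'a \<times> 'a. dist (fst p) (snd p) < \<rho>} \<in> sets (borel \<Otimes>\<^sub>M borel)"
    unfolding borel_prod by (intro borel_open open_Collect_less continuous_intros)
  then have "(\<lambda>p::'a \<times> 'a. indicator {p. dist (fst p) (snd p) < \<rho>} p :: ennreal) \<in> borel_measurable (borel \<Otimes>\<^sub>M borel)"
    by simp
  moreover have "(\<lambda>(x, t::'a). riesz_kernel s x t * indicator (ball x \<rho>) t)
      = (\<lambda>p. riesz_kernel s (fst p) (snd p) * indicator {p. dist (fst p) (snd p) < \<rho>} p)"
    by (auto simp: indicator_def)
  ultimately have "(\<lambda>(x, t::'a). riesz_kernel s x t * indicator (ball x \<rho>) t) \<in> borel_measurable (borel \<Otimes>\<^sub>M M)"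
    by (simp add: measurable_cong_sets[OF * refl])
  from borel_measurable_nn_integral[OF this] show ?thesis
    unfolding local_potential_def by simp
qed

text \<open>A finite potential excludes an atom at \<open>x\<close>, so the kernel cut off to
  shrinking balls tends to 0 almost everywhere, dominated by the integrable kernel itself.\<close>

lemma local_potential_tendsto_0:
  assumes M: "fin_borel M" and fin: "potential s M x < \<infinity>"
  shows "(\<lambda>n. local_potential s (1 / real (Suc n)) M x) \<longlonglongrightarrow> 0"
proof -
  have [measurable]: "riesz_kernel s x \<in> borel_measurable M" "ball x r \<in> sets M" for r
    by (auto simp: measurable_fin_borel[OF M] fin_borelD(2)[OF M])
  have "AE t in M. riesz_kernel s x t \<noteq> \<infinity>"
    using fin by (intro nn_integral_PInf_AE) (auto simp: potential_def)
  then have AE: "AE t in M. t \<noteq> x" by eventually_elim (auto simp: riesz_kernel_def)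
  have "(\<lambda>n. \<integral>\<^sup>+ t. riesz_kernel s x t * indicator (ball x (1 / real (Suc n))) t \<partial>M)
      \<longlonglongrightarrow> (\<integral>\<^sup>+ t. 0 \<partial>M)"
  proof (rule nn_integral_dominated_convergence[where w = "riesz_kernel s x"])
    show "(\<integral>\<^sup>+ t. riesz_kernel s x t \<partial>M) < \<infinity>" using fin by (simp add: potential_def)
    show "AE t in M. (\<lambda>n. riesz_kernel s x t * indicator (ball x (1 / real (Suc n))) t) \<longlonglongrightarrow> 0"
      using AE
    proof eventually_elim
      case (elim t)
      then obtain N where N: "inverse (real (Suc N)) < dist x t"
        using reals_Archimedean[of "dist x t"] by auto
      have "riesz_kernel s x t * indicator (ball x (1 / real (Suc n))) t = 0" if "N \<le> n" for n
      proof -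
        have "1 / real (Suc n) \<le> inverse (real (Suc N))"
          using that by (simp add: divide_simps)
        then show ?thesis using N by simp
      qed
      then show ?case by (intro tendsto_eventually) (auto simp: eventually_sequentially)
    qed
    show "AE t in M. riesz_kernel s x t * indicator (ball x (1 / real (Suc n))) t \<le> riesz_kernel s x t" for n
      by (simp add: indicator_def)
  qed measurable
  then show ?thesis by (simp add: local_potential_def)
qed

text \<open>Moving from \<open>x\<close> to its nearest point \<open>x'\<close> in \<open>K\<close>,
  a distance below \<theta> \<rho>, changes distances to mass beyond \<rho> by a factor of at most 1
  + \<theta>. Closer mass lies in \<open>ball x' (2 * \<rho>)\<close>. There the factor is only
  \<open>2 powr s\<close>, but the contribution is at most \<eta>.\<close>

lemma potential_le_near_compact:
  assumes s: "0 < s" and \<nu>: "fin_borel \<nu>" "emeasure \<nu> (UNIV - K) = 0" and K: "compact K" "K \<noteq> {}"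
    and \<rho>: "0 < \<rho>" and \<theta>: "0 < \<theta>"
    and le: "\<And>x. x \<in> K \<Longrightarrow> potential s \<nu> x \<le> c"
    and loc: "\<And>x. x \<in> K \<Longrightarrow> local_potential s (2 * \<rho>) \<nu> x \<le> \<eta>"
    and x: "infdist x K < \<theta> * \<rho>"
  shows "potential s \<nu> x \<le> ennreal ((1 + \<theta>) powr s) * c + ennreal (2 powr s) * \<eta>"
proof -
  have Kb: "K \<in> sets borel" using K by (simp add: compact_imp_closed)
  obtain x' where x': "x' \<in> K" "infdist x K = dist x x'"
    using infdist_attains_inf[OF compact_imp_closed[OF K(1)] K(2)] by metis
  have [measurable]: "riesz_kernel s x \<in> borel_measurable \<nu>" "ball x r \<in> sets \<nu>" for r x
    by (auto simp: measurable_fin_borel[OF \<nu>(1)] fin_borelD(2)[OF \<nu>(1)])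
  have "potential s \<nu> x \<le> (\<integral>\<^sup>+ t. ennreal ((1 + \<theta>) powr s) * riesz_kernel s x' t
      + ennreal (2 powr s) * (riesz_kernel s x' t * indicator (ball x' (2 * \<rho>)) t) \<partial>\<nu>)"
    unfolding potential_def
  proof (rule nn_integral_mono_AE)
    show "AE t in \<nu>. riesz_kernel s x t \<le> ennreal ((1 + \<theta>) powr s) * riesz_kernel s x' t
      + ennreal (2 powr s) * (riesz_kernel s x' t * indicator (ball x' (2 * \<rho>)) t)"
      using AE_in_support[OF \<nu>(1) Kb \<nu>(2)]
    proof eventually_elim
      case (elim t)
      have d: "dist x x' \<le> dist x t" using infdist_le[OF elim, of x] x'(2) by simp
      have tri: "dist x' t \<le> dist x x' + dist x t" using dist_triangle[of x' t x] by (simp add: dist_commute)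
      show ?case
      proof (cases "dist x t < \<rho>")
        case True
        then have "t \<in> ball x' (2 * \<rho>)" using tri d by simp
        moreover have "riesz_kernel s x t \<le> ennreal (2 powr s) * riesz_kernel s x' t"
          using tri d by (intro riesz_kernel_le_mult s) auto
        ultimately show ?thesis by (simp add: add_increasing)
      next
        case False
        have "\<theta> * \<rho> \<le> \<theta> * dist x t" using False \<theta> by (intro mult_left_mono) auto
        then have "dist x' t \<le> (1 + \<theta>) * dist x t" using tri x x'(2) by (simp add: algebra_simps)
        then have "riesz_kernel s x t \<le> ennreal ((1 + \<theta>) powr s) * riesz_kernel s x' t"
          using \<theta> by (intro riesz_kernel_le_mult s) auto
        then show ?thesis by (simp add: add_increasing2)
      qed
    qed
  qed
  also have "\<dots> = ennreal ((1 + \<theta>) powr s) * potential s \<nu> x' + ennreal (2 powr s) * local_potential s (2 * \<rho>) \<nu> x'"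
    by (simp add: nn_integral_add nn_integral_cmult potential_def local_potential_def)
  also have "\<dots> \<le> ennreal ((1 + \<theta>) powr s) * c + ennreal (2 powr s) * \<eta>"
    using le[OF x'(1)] loc[OF x'(1)] by (intro add_mono mult_left_mono) auto
  finally show ?thesis .
qed

text \<open>Restricting \<open>\<nu>\<close> to a compact set on which the contribution of nearby mass is uniformly small, as in
  Egorov's theorem, replaces the continuity principle for potentials.\<close>
lemma potential_maximum_principle:
  fixes \<nu> :: "'a::euclidean_space measure"
  assumes s: "0 < s" "real DIM('a) - 2 \<le> s"
    and \<nu>: "fin_borel \<nu>" "emeasure \<nu> (UNIV - K) = 0" and K: "compact K"
    and c: "0 \<le> c" and le: "AE x in \<nu>. potential s \<nu> x \<le> ennreal c"
    and \<delta>: "0 < \<delta>" "\<And>t. t \<in> K \<Longrightarrow> \<delta> \<le> dist p t"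
  shows "potential s \<nu> p \<le> ennreal c"
proof -
  have Kb: "K \<in> sets borel" using K by (simp add: compact_imp_closed)
  interpret finite_measure \<nu> using \<nu>(1) by (rule fin_borelD)
  note sb = fin_borelD(2)[OF \<nu>(1)]
  note [measurable] = potential_measurable[OF \<nu>(1)] local_potential_measurable[OF \<nu>(1)]
  have main: "potential s \<nu> p \<le> ennreal ((1 + \<epsilon>) powr s * (c + \<epsilon>) + 2 powr s * \<epsilon> + \<delta> powr (- s) * \<epsilon>)"
    if \<epsilon>: "0 < \<epsilon>" for \<epsilon>
  proof -
    define G where "G = {x\<in>K. potential s \<nu> x \<le> ennreal c}"
    \<comment> \<open>Asking for the bound at all \<open>m \<ge> n\<close> makes these sets
      increase. By \<open>local_potential_tendsto_0\<close> their union is \<open>G\<close>, which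
      carries the full mass.\<close>
    define E where "E n = {x\<in>G. \<forall>m\<ge>n. local_potential s (1 / real (Suc m)) \<nu> x \<le> ennreal \<epsilon>}" for n
    have Gb: "G \<in> sets borel"
    proof -
      have "G = K \<inter> {x. potential s \<nu> x \<le> ennreal c}" by (auto simp: G_def)
      then show ?thesis using Kb by simp
    qed
    have Eb: "E n \<in> sets borel" for n
    proof -
      have "E n = G \<inter> (\<Inter>m\<in>{n..}. {x. local_potential s (1 / real (Suc m)) \<nu> x \<le> ennreal \<epsilon>})"
        by (auto simp: E_def)
      moreover have "{x. local_potential s (1 / real (Suc m)) \<nu> x \<le> ennreal \<epsilon>} \<in> sets borel" for m
        by measurable
      ultimately show ?thesis using Gb by (auto intro!: sets.Int sets.countable_INT')
    qed
    have "(\<lambda>n. measure \<nu> (E n)) \<longlonglongrightarrow> measure \<nu> (\<Union>n. E n)"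
    proof (rule finite_Lim_measure_incseq)
      show "range E \<subseteq> sets \<nu>" using Eb by (auto simp: sb)
      show "incseq E" by (auto simp: incseq_def E_def)
    qed
    moreover have "(\<Union>n. E n) = G"
    proof (intro equalityI subsetI)
      fix x assume x: "x \<in> G"
      then have "potential s \<nu> x < \<infinity>" by (auto simp: G_def intro: le_less_trans)
      then have "(\<lambda>n. local_potential s (1 / real (Suc n)) \<nu> x) \<longlonglongrightarrow> 0"
        by (intro local_potential_tendsto_0 \<nu>)
      then have "\<forall>\<^sub>F n in sequentially. local_potential s (1 / real (Suc n)) \<nu> x < ennreal \<epsilon>"
        by (rule order_tendstoD(2)) (use \<epsilon> in simp)
      then show "x \<in> (\<Union>n. E n)"
        using x by (auto simp: eventually_sequentially E_def intro: less_imp_le)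
    qed (auto simp: E_def)
    moreover have "measure \<nu> G = measure \<nu> UNIV"
      using AE_in_support[OF \<nu>(1) Kb \<nu>(2)] le Gb
      by (intro measure_eq_AE) (auto simp: sb G_def)
    ultimately have "(\<lambda>n. measure \<nu> (E n)) \<longlonglongrightarrow> measure \<nu> UNIV" by simp
    then have "\<forall>\<^sub>F n in sequentially. measure \<nu> UNIV - \<epsilon> / 2 < measure \<nu> (E n)"
      by (rule order_tendstoD(1)) (use \<epsilon> in simp)
    then obtain n where n: "measure \<nu> UNIV - \<epsilon> / 2 < measure \<nu> (E n)"
      by (auto simp: eventually_sequentially)
    \<comment> \<open>If the bound on the mass is negative, \<open>ennreal\<close> clips it to 0 and
      strict inner approximation may fail. The empty set serves in that case.\<close>
    obtain L where L: "compact L" "L \<subseteq> E n" "measure \<nu> UNIV - \<epsilon> < measure \<nu> L"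
    proof (cases "measure \<nu> UNIV - \<epsilon> < 0")
      case True
      then show ?thesis by (intro that[of "{}"]) auto
    next
      case False
      have "emeasure \<nu> (E n) = (SUP L\<in>{L. L \<subseteq> E n \<and> compact L}. emeasure \<nu> L)"
        using emeasure_finite by (intro inner_regular) (auto simp: sb Eb)
      moreover have "ennreal (measure \<nu> UNIV - \<epsilon>) < emeasure \<nu> (E n)"
        unfolding emeasure_eq_measure using n \<epsilon> False by (intro ennreal_lessI) auto
      ultimately obtain L where "L \<subseteq> E n" "compact L" "ennreal (measure \<nu> UNIV - \<epsilon>) < emeasure \<nu> L"
        by (auto simp: less_SUP_iff)
      then show ?thesis using False by (intro that[of L]) (auto simp: emeasure_eq_measure ennreal_less_iff)
    qed
    have Lb: "L \<in> sets borel" using L by (simp add: compact_imp_closed)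
    have LK: "x \<in> K" "potential s \<nu> x \<le> ennreal c"
      "local_potential s (1 / real (Suc n)) \<nu> x \<le> ennreal \<epsilon>" if "x \<in> L" for x
      using that L(2) by (auto simp: E_def G_def)
    have cL: "emeasure \<nu> (UNIV - L) \<le> ennreal \<epsilon>"
      using L(3) finite_measure_compl[of L] Lb
      by (auto simp: emeasure_eq_measure sb fin_borelD(3)[OF \<nu>(1)] intro!: ennreal_leI)
    define \<tau> where "\<tau> = restr \<nu> L"
    define M where "M = (1 + \<epsilon>) powr s * (c + \<epsilon>) + 2 powr s * \<epsilon>"
    have M: "0 < M" using \<epsilon> c by (auto simp: M_def intro!: add_nonneg_pos)
    have \<tau>: "fin_borel \<tau>" "emeasure \<tau> (UNIV - L) = 0"
      unfolding \<tau>_def using Lb emeasure_restr[OF \<nu>(1) Lb, of "UNIV - L"]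
      by (auto intro!: fin_borel_restr \<nu>)
    have "potential s \<tau> p \<le> ennreal M"
    proof (cases "L = {}")
      case True
      then show ?thesis by (simp add: potential_def \<tau>_def nn_integral_restr[OF \<nu>(1)])
    next
      case False
      show ?thesis
      proof (rule potential_le_of_le_near_support[OF s \<tau> L(1) False _ M])
        define \<rho> where "\<rho> = 1 / (2 * real (Suc n))"
        have \<rho>: "0 < \<rho>" "2 * \<rho> = 1 / real (Suc n)" by (simp_all add: \<rho>_def field_simps)
        show "0 < \<epsilon> * \<rho>" using \<epsilon> \<rho> by simp
        fix x assume x: "infdist x L < \<epsilon> * \<rho>"
        have "potential s \<tau> x \<le> ennreal ((1 + \<epsilon>) powr s) * ennreal (c + \<epsilon>) + ennreal (2 powr s) * ennreal \<epsilon>"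
        proof (rule potential_le_near_compact[OF s(1) \<tau> L(1) False \<rho>(1) \<epsilon> _ _ x])
          fix y assume y: "y \<in> L"
          have "potential s \<tau> y \<le> potential s \<nu> y" unfolding \<tau>_def by (intro potential_restr_le \<nu> Lb)
          also have "\<dots> \<le> ennreal c" using LK[OF y] by simp
          also have "\<dots> \<le> ennreal (c + \<epsilon>)" using \<epsilon> by (intro ennreal_leI) simp
          finally show "potential s \<tau> y \<le> ennreal (c + \<epsilon>)" .
          have "local_potential s (2 * \<rho>) \<tau> y \<le> local_potential s (2 * \<rho>) \<nu> y"
            unfolding local_potential_def \<tau>_def 
            by (intro nn_integral_restr_le \<nu> Lb borel_measurable_times_ennreal borel_measurable_indicator) auto
          also have "\<dots> \<le> ennreal \<epsilon>" using LK[OF y] \<rho>(2) by simp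
          finally show "local_potential s (2 * \<rho>) \<tau> y \<le> ennreal \<epsilon>" .
        qed
        also have "\<dots> = ennreal M" using \<epsilon> c by (simp add: M_def ennreal_plus ennreal_mult)
        finally show "potential s \<tau> x \<le> ennreal M" .
      qed
    qed
    \<comment> \<open>The mass discarded with the complement of \<open>L\<close> is at most
      \<epsilon> and stays at distance \<delta> from \<open>p\<close>, so it contributes a term that
      vanishes with \<epsilon>.\<close>
    moreover have "potential s (restr \<nu> (UNIV - L)) p \<le> ennreal (\<delta> powr (- s)) * ennreal \<epsilon>"
    proof -
      have Lc: "UNIV - L \<in> sets borel" using Lb by auto
      have "emeasure (restr \<nu> (UNIV - L)) (UNIV - K) \<le> emeasure \<nu> (UNIV - K)"
        using Kb Lc by (subst emeasure_restr[OF \<nu>(1)]) (auto intro!: emeasure_mono simp: sb)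
      then have "potential s (restr \<nu> (UNIV - L)) p \<le> ennreal (\<delta> powr (- s)) * emeasure (restr \<nu> (UNIV - L)) UNIV"
        using \<nu>(2) by (intro potential_le_far[OF s(1) fin_borel_restr[OF \<nu>(1) Lc] Kb _ \<delta>]) simp_all
      also have "\<dots> \<le> ennreal (\<delta> powr (- s)) * ennreal \<epsilon>"
        using cL by (intro mult_left_mono) (simp_all add: emeasure_restr[OF \<nu>(1) Lc])
      finally show ?thesis .
    qed
    moreover have "potential s \<nu> p = potential s \<tau> p + potential s (restr \<nu> (UNIV - L)) p"
    proof -
      have [measurable]: "riesz_kernel s p \<in> borel_measurable \<nu>" "L \<in> sets \<nu>"
        using Lb by (auto simp: measurable_fin_borel[OF \<nu>(1)] sb)
      have "potential s \<nu> p = (\<integral>\<^sup>+ t. riesz_kernel s p t * indicator L t + riesz_kernel s p t * indicator (UNIV - L) t \<partial>\<nu>)"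
        unfolding potential_def by (intro nn_integral_cong) (auto simp: indicator_def)
      also have "\<dots> = potential s \<tau> p + potential s (restr \<nu> (UNIV - L)) p"
        unfolding potential_def \<tau>_def using Lb
        by (subst nn_integral_add) (auto simp: nn_integral_restr[OF \<nu>(1)] sb intro!: borel_measurable_times_ennreal borel_measurable_indicator)
      finally show ?thesis .
    qed
    ultimately have "potential s \<nu> p \<le> ennreal M + ennreal (\<delta> powr (- s)) * ennreal \<epsilon>"
      by (simp add: add_mono)
    also have "\<dots> = ennreal (M + \<delta> powr (- s) * \<epsilon>)" using M \<epsilon> by (simp add: ennreal_plus ennreal_mult)
    finally show ?thesis by (simp add: M_def)
  qed
  have "((\<lambda>\<epsilon>. (1 + \<epsilon>) powr s * (c + \<epsilon>) + 2 powr s * \<epsilon> + \<delta> powr (- s) * \<epsilon>)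
      \<longlongrightarrow> (1 + 0) powr s * (c + 0) + 2 powr s * 0 + \<delta> powr (- s) * 0) (at_right 0)"
    by (intro tendsto_intros) simp
  then have "((\<lambda>\<epsilon>. ennreal ((1 + \<epsilon>) powr s * (c + \<epsilon>) + 2 powr s * \<epsilon> + \<delta> powr (- s) * \<epsilon>)) \<longlongrightarrow> ennreal c) (at_right 0)"
    by (intro tendsto_ennrealI) simp
  then show ?thesis
    by (rule tendsto_lowerbound) (use main in \<open>auto simp: eventually_at_right_less eventually_at intro!: exI[of _ 1]\<close>)
qed

section \<open>Inversion in the unit sphere\<close>

definition kelvin :: "'a::euclidean_space \<Rightarrow> 'a" where
  "kelvin x = x /\<^sub>R (norm x)\<^sup>2"

lemma dist_kelvin:
  assumes "x \<noteq> 0" "y \<noteq> 0"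
  shows "dist (kelvin x) (kelvin y) = dist x y / (norm x * norm y)"
proof -
  have "(dist (kelvin x) (kelvin y))\<^sup>2 = (dist x y / (norm x * norm y))\<^sup>2"
    using assms
    by (simp add: dist_norm kelvin_def power2_norm_eq_inner power_divide power_mult_distrib inner_diff_left inner_diff_right
        inner_commute) (simp add: field_simps power2_norm_eq_inner[symmetric] power2_eq_square flip: power2_norm_eq_inner)
  then show ?thesis by (simp add: power2_eq_iff_nonneg)
qed

text \<open>The measure is truncated to an annulus before the inversion, since its full Kelvin transform
  may have infinite mass.\<close>
lemma potential_le_point_mass_imp_mass_le:
  fixes \<mu> :: "'a::euclidean_space measure"
  assumes s: "0 < s" "real DIM('a) - 2 \<le> s" and \<mu>: "fin_borel \<mu>" "emeasure \<mu> {0} = 0"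
    and c: "0 \<le> c" and le: "AE x in \<mu>. x \<noteq> 0 \<longrightarrow> potential s \<mu> x \<le> ennreal (c * norm x powr (- s))"
  shows "emeasure \<mu> UNIV \<le> ennreal c"
proof -
  note sb = fin_borelD(2)[OF \<mu>(1)]
  define A where "A n = {x::'a. 1 / real (Suc n) \<le> norm x \<and> norm x \<le> real (Suc n)}" for n
  have Ab: "A n \<in> sets borel" for n unfolding A_def by measurable
  have mA: "emeasure \<mu> (A n) \<le> ennreal c" for n
  proof -
    define N where "N = real (Suc n)"
    have N: "0 < N" "1 \<le> N" by (auto simp: N_def)
    have A_pos: "0 < norm x" "1 / N \<le> norm x" "norm x \<le> N" if "x \<in> A n" for x
    proof -
      show 1: "1 / N \<le> norm x" "norm x \<le> N" using that by (auto simp: A_def N_def)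
      show "0 < norm x" using 1(1) N by (meson divide_pos_pos less_le_trans zero_less_one)
    qed
    \<comment> \<open>This weight makes potentials correspond: by \<open>dist_kelvin\<close>, the
      image measure has at \<open>kelvin x\<close> a potential of at most |x|^s times that of \<mu>
      at \<open>x\<close>, with inequality because of the truncation. The hypothesis becomes the
      constant bound \<open>c\<close>.\<close>
    define D where "D = density (restr \<mu> (A n)) (\<lambda>x. ennreal (norm x powr (- s)))"
    have [measurable]: "kelvin \<in> borel_measurable (borel :: 'a measure)" unfolding kelvin_def by measurable
    have Dsets [simp]: "sets D = sets borel" and Dspace [simp]: "space D = UNIV"
      using fin_borelD[OF fin_borel_restr[OF \<mu>(1) Ab]] by (auto simp: D_def)
    have [measurable_cong]: "sets D = sets borel" by simp
    define \<nu> where "\<nu> = distr D borel kelvin"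
    have int: "(\<integral>\<^sup>+ t. f t \<partial>\<nu>) = (\<integral>\<^sup>+ x. ennreal (norm x powr (- s)) * f (kelvin x) * indicator (A n) x \<partial>\<mu>)"
      if [measurable]: "f \<in> borel_measurable borel" for f
    proof -
      have "(\<integral>\<^sup>+ t. f t \<partial>\<nu>) = (\<integral>\<^sup>+ x. f (kelvin x) \<partial>D)"
        unfolding \<nu>_def by (rule nn_integral_distr) measurable
      also have "\<dots> = (\<integral>\<^sup>+ x. ennreal (norm x powr (- s)) * f (kelvin x) \<partial>restr \<mu> (A n))"
        unfolding D_def
        by (rule nn_integral_density) (auto simp: measurable_fin_borel[OF fin_borel_restr[OF \<mu>(1) Ab]])
      also have "\<dots> = (\<integral>\<^sup>+ x. ennreal (norm x powr (- s)) * f (kelvin x) * indicator (A n) x \<partial>\<mu>)"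
        by (intro nn_integral_restr \<mu> Ab) measurable
      finally show ?thesis .
    qed
    have \<nu>: "fin_borel \<nu>"
    proof -
      have "emeasure \<nu> UNIV = (\<integral>\<^sup>+ t. 1 \<partial>\<nu>)" by (simp add: \<nu>_def)
      also have "\<dots> \<le> (\<integral>\<^sup>+ x. ennreal ((1 / N) powr (- s)) \<partial>\<mu>)"
      proof (subst int)
        have "norm x powr (- s) \<le> (1 / N) powr (- s)" if "x \<in> A n" for x
          using A_pos[OF that] N s by (intro powr_mono2') auto
        then show "(\<integral>\<^sup>+ x. ennreal (norm x powr (- s)) * 1 * indicator (A n) x \<partial>\<mu>)
            \<le> (\<integral>\<^sup>+ x. ennreal ((1 / N) powr (- s)) \<partial>\<mu>)"
          by (intro nn_integral_mono) (simp add: indicator_def ennreal_leI)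
      qed simp
      also have "\<dots> < \<infinity>" by (simp add: ennreal_mult_less_top fin_borelD[OF \<mu>(1)] fin_borelD(5)[OF \<mu>(1), simplified])
      finally show ?thesis unfolding fin_borel_def by (auto intro!: finite_measureI simp: \<nu>_def)
    qed
    have nk: "norm (kelvin x) = 1 / norm x" for x :: 'a by (simp add: kelvin_def power2_eq_square field_simps)
    have pot: "potential s \<nu> (kelvin x) \<le> ennreal (norm x powr s) * potential s \<mu> x" if x: "x \<noteq> 0" for x
    proof -
      have "potential s \<nu> (kelvin x)
          = (\<integral>\<^sup>+ y. ennreal (norm y powr (- s)) * riesz_kernel s (kelvin x) (kelvin y) * indicator (A n) y \<partial>\<mu>)"
        unfolding potential_def by (intro int) measurable
      also have "\<dots> \<le> (\<integral>\<^sup>+ y. ennreal (norm x powr s) * riesz_kernel s x y \<partial>\<mu>)"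
      proof (rule nn_integral_mono)
        fix y
        show "ennreal (norm y powr (- s)) * riesz_kernel s (kelvin x) (kelvin y) * indicator (A n) y
          \<le> ennreal (norm x powr s) * riesz_kernel s x y"
        proof (cases "y \<in> A n")
          case True
          then have y: "y \<noteq> 0" using A_pos by force
          show ?thesis
          proof (cases "x = y")
            case True
            then show ?thesis using x by (simp add: riesz_kernel_def ennreal_mult_top)
          next
            case False
            then have kxy: "dist (kelvin x) (kelvin y) > 0" using dist_kelvin[OF x y] x y by simp
            then have "riesz_kernel s (kelvin x) (kelvin y) = ennreal ((dist x y / (norm x * norm y)) powr (- s))"
              unfolding dist_kelvin[OF x y, symmetric] by (auto simp: riesz_kernel_def)
            also have "(dist x y / (norm x * norm y)) powr (- s) = norm x powr s * norm y powr s * dist x y powr (- s)"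
              by (simp add: powr_divide powr_mult powr_minus field_simps)
            finally have "ennreal (norm y powr (- s)) * riesz_kernel s (kelvin x) (kelvin y)
                = ennreal (norm y powr (- s) * (norm x powr s * norm y powr s * dist x y powr (- s)))"
              by (simp add: ennreal_mult)
            also have "norm y powr (- s) * (norm x powr s * norm y powr s * dist x y powr (- s))
                = norm x powr s * dist x y powr (- s)"
              using y by (simp add: powr_minus field_simps)
            finally show ?thesis using False by (simp add: riesz_kernel_def ennreal_mult indicator_def)
          qed
        qed simp
      qed
      also have "\<dots> = ennreal (norm x powr s) * potential s \<mu> x"
        unfolding potential_def by (intro nn_integral_cmult) (simp add: measurable_fin_borel[OF \<mu>(1)])
      finally show ?thesis .
    qed
    \<comment> \<open>The annulus is invariant under inversion, so it carries the image measure as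
      well. It is compact and keeps distance 1/N from the origin, where the maximum principle is
      applied.\<close>
    define L where "L = {x::'a. 1 / N \<le> norm x \<and> norm x \<le> N}"
    have L: "compact L"
    proof -
      have "L = cball 0 N - ball 0 (1 / N)" by (auto simp: L_def)
      then show ?thesis by (simp add: compact_diff)
    qed
    have Lb: "L \<in> sets borel" using L by (simp add: compact_imp_closed)
    have kL: "kelvin x \<in> L" if "x \<in> A n" for x
      using A_pos[OF that] N by (simp add: L_def nk field_simps)
    have \<nu>L: "emeasure \<nu> (UNIV - L) = 0"
    proof -
      have "emeasure \<nu> (UNIV - L) = (\<integral>\<^sup>+ t. indicator (UNIV - L) t \<partial>\<nu>)" using Lb by (simp add: \<nu>_def)
      also have "\<dots> = (\<integral>\<^sup>+ x. 0 \<partial>\<mu>)"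
        using Lb by (subst int, simp, intro nn_integral_cong) (auto simp: indicator_def dest: kL)
      finally show ?thesis by simp
    qed
    have "potential s \<nu> 0 \<le> ennreal c"
    proof (rule potential_maximum_principle[OF s \<nu> \<nu>L L c])
      show "0 < 1 / N" "\<And>t. t \<in> L \<Longrightarrow> 1 / N \<le> dist 0 t" using N by (auto simp: L_def)
      define B where "B = {t. \<not> potential s \<nu> t \<le> ennreal c}"
      note [measurable] = potential_measurable[OF \<nu>]
      have Bb: "B \<in> sets borel" unfolding B_def by measurable
      have "emeasure \<nu> B = (\<integral>\<^sup>+ t. indicator B t \<partial>\<nu>)" using Bb by (simp add: \<nu>_def)
      also have "\<dots> = (\<integral>\<^sup>+ x. ennreal (norm x powr (- s)) * indicator B (kelvin x) * indicator (A n) x \<partial>\<mu>)"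
        by (intro int borel_measurable_indicator Bb)
      also have "\<dots> = (\<integral>\<^sup>+ x. 0 \<partial>\<mu>)"
      proof (rule nn_integral_cong_AE)
        show "AE x in \<mu>. ennreal (norm x powr (- s)) * indicator B (kelvin x) * indicator (A n) x = 0"
          using le
        proof eventually_elim
          case (elim x)
          show ?case
          proof (cases "x \<in> A n")
            case True
            then have x: "x \<noteq> 0" using A_pos by force
            have "potential s \<nu> (kelvin x) \<le> ennreal (norm x powr s) * ennreal (c * norm x powr (- s))"
              using elim x by (intro order_trans[OF pot] mult_left_mono) auto
            also have "\<dots> = ennreal c"
              using x c by (simp add: powr_minus flip: ennreal_mult)
            finally show ?thesis by (simp add: B_def)
          qed simp
        qed
      qed
      finally have "B \<in> null_sets \<nu>" using Bb by (auto simp: null_sets_def \<nu>_def)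
      then show "AE x in \<nu>. potential s \<nu> x \<le> ennreal c" by (rule AE_I') (auto simp: B_def)
    qed
    \<comment> \<open>At the origin the kernel is |kelvin x|^-s = |x|^s, which cancels the
      weight.\<close>
    moreover have "emeasure \<mu> (A n) \<le> potential s \<nu> 0"
    proof -
      have "emeasure \<mu> (A n) = (\<integral>\<^sup>+ x. indicator (A n) x \<partial>\<mu>)" using Ab by (simp add: sb)
      also have "\<dots> \<le> (\<integral>\<^sup>+ x. ennreal (norm x powr (- s)) * riesz_kernel s 0 (kelvin x) * indicator (A n) x \<partial>\<mu>)"
      proof (rule nn_integral_mono)
        fix x
        show "indicator (A n) x \<le> ennreal (norm x powr (- s)) * riesz_kernel s 0 (kelvin x) * indicator (A n) x"
        proof (cases "x \<in> A n")
          case True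
          then have x: "x \<noteq> 0" using A_pos by force
          have "ennreal (norm x powr s) \<le> riesz_kernel s 0 (kelvin x)"
            using riesz_kernel_ge[OF s(1), of 0 "kelvin x" "1 / norm x"] x
            by (simp add: nk powr_divide powr_minus field_simps)
          then have "ennreal (norm x powr (- s)) * ennreal (norm x powr s)
              \<le> ennreal (norm x powr (- s)) * riesz_kernel s 0 (kelvin x)"
            by (rule mult_left_mono) simp
          moreover have "ennreal (norm x powr (- s)) * ennreal (norm x powr s) = 1"
            using x by (simp add: powr_minus flip: ennreal_mult)
          ultimately show ?thesis using True by simp
        qed simp
      qed
      also have "\<dots> = potential s \<nu> 0"
        unfolding potential_def by (intro int[symmetric]) measurable
      finally show ?thesis .
    qed
    ultimately show ?thesis by simp
  qed
  have "(\<lambda>n. emeasure \<mu> (A n)) \<longlonglongrightarrow> emeasure \<mu> (\<Union>n. A n)"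
  proof (rule Lim_emeasure_incseq)
    show "incseq A"
      unfolding incseq_def A_def
    proof (intro allI impI subsetI CollectI)
      fix m n and x :: 'a
      assume "m \<le> n" and x: "x \<in> {x. 1 / real (Suc m) \<le> norm x \<and> norm x \<le> real (Suc m)}"
      then have "1 / real (Suc n) \<le> 1 / real (Suc m)" "real (Suc m) \<le> real (Suc n)"
        by (auto intro!: divide_left_mono)
      then show "1 / real (Suc n) \<le> norm x \<and> norm x \<le> real (Suc n)"
        using x by auto
    qed
  qed (auto simp: sb Ab)
  then have U: "emeasure \<mu> (\<Union>n. A n) \<le> ennreal c"
    using mA by (intro LIMSEQ_le_const2) auto
  have "(UNIV :: 'a set) \<subseteq> (\<Union>n. A n) \<union> {0}"
  proof
    fix x :: 'a
    show "x \<in> (\<Union>n. A n) \<union> {0}"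
    proof (cases "x = 0")
      case False
      obtain n1 where n1: "norm x \<le> real n1" using real_arch_simple by blast
      obtain n2 where n2: "1 / norm x \<le> real n2" using real_arch_simple by blast
      have "1 / norm x \<le> real (Suc (max n1 n2))" "norm x \<le> real (Suc (max n1 n2))"
        using n1 n2 by (auto simp: max_def)
      then have "x \<in> A (max n1 n2)" using False by (auto simp: A_def field_simps)
      then show ?thesis by auto
    qed simp
  qed
  then have "emeasure \<mu> UNIV \<le> emeasure \<mu> ((\<Union>n. A n) \<union> {0})"
    using Ab by (intro emeasure_mono) (auto simp: sb)
  also have "\<dots> \<le> emeasure \<mu> (\<Union>n. A n) + emeasure \<mu> {0}"
    using Ab by (intro emeasure_subadditive) (auto simp: sb)
  finally show ?thesis using U \<mu>(2) by simp
qed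

section \<open>The energy problem with an external field\<close>

lemma ennreal_liminf_add_le:
  fixes f h :: "nat \<Rightarrow> ennreal"
  shows "liminf f + liminf h \<le> liminf (\<lambda>n. f n + h n)"
proof -
  have i: "incseq (\<lambda>n. INF m\<in>{n..}. F m)" for F :: "nat \<Rightarrow> ennreal"
    by (intro incseq_SucI INF_superset_mono) auto
  have "liminf f + liminf h = (SUP n. (INF m\<in>{n..}. f m) + (INF m\<in>{n..}. h m))"
    unfolding liminf_SUP_INF by (rule ennreal_SUP_add[symmetric, OF i i])
  also have "\<dots> \<le> liminf (\<lambda>n. f n + h n)"
    unfolding liminf_SUP_INF by (intro SUP_mono) (auto intro!: INF_greatest add_mono INF_lower)
  finally show ?thesis .
qed

lemma riesz_kernel_le_liminf:
  assumes s: "0 < s" and x: "X \<longlonglongrightarrow> x" and y: "Y \<longlonglongrightarrow> y"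
  shows "riesz_kernel s x y \<le> liminf (\<lambda>n. riesz_kernel s (X n) (Y n))"
proof -
  let ?L = "liminf (\<lambda>n. riesz_kernel s (X n) (Y n))"
  have L: "ennreal ((dist x y + \<epsilon>) powr (- s)) \<le> ?L" if \<epsilon>: "0 < \<epsilon>" for \<epsilon>
  proof (rule Liminf_bounded)
    have "\<forall>\<^sub>F n in sequentially. dist (X n) (Y n) < dist x y + \<epsilon>"
      using \<epsilon> by (intro order_tendstoD(2)[OF tendsto_dist[OF x y]]) simp
    then show "\<forall>\<^sub>F n in sequentially. ennreal ((dist x y + \<epsilon>) powr (- s)) \<le> riesz_kernel s (X n) (Y n)"
      by eventually_elim (intro riesz_kernel_ge s, simp)
  qed
  show ?thesis
  proof (cases "x = y")
    case True
    \<comment> \<open>On the diagonal the choice \<epsilon> = r^(-1/s) turns the lower bound into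
      \<open>r\<close>.\<close>
    have "ennreal r \<le> ?L" if "0 < r" for r
      using L[of "r powr (- (1 / s))"] that s True by (simp add: powr_powr)
    note unb = this
    have "?L = \<infinity>"
    proof (cases ?L)
      case (real l)
      then show ?thesis using unb[of "l + 1"] by simp
    qed simp
    then show ?thesis by simp
  next
    case False
    have "((\<lambda>\<epsilon>. (dist x y + \<epsilon>) powr (- s)) \<longlongrightarrow> (dist x y + 0) powr (- s)) (at_right 0)"
      using False by (intro tendsto_powr tendsto_add tendsto_const tendsto_ident_at) simp
    then have "((\<lambda>\<epsilon>. ennreal ((dist x y + \<epsilon>) powr (- s))) \<longlongrightarrow> riesz_kernel s x y) (at_right 0)"
      using False by (simp add: riesz_kernel_def tendsto_ennrealI)
    then show ?thesis
      by (rule tendsto_upperbound) (use L in \<open>auto simp: eventually_at intro!: exI[of _ 1]\<close>)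
  qed
qed

lemma nn_integral_le_of_prob_on:
  assumes "prob_on K \<nu>" "K \<in> sets borel" "\<And>x. x \<in> K \<Longrightarrow> f x \<le> c"
  shows "(\<integral>\<^sup>+ x. f x \<partial>\<nu>) \<le> c"
proof -
  note fb = prob_onD(1)[OF assms(1)]
  have "(\<integral>\<^sup>+ x. f x \<partial>\<nu>) \<le> (\<integral>\<^sup>+ x. c \<partial>\<nu>)"
    using AE_in_support[OF fb assms(2) prob_onD(4)[OF assms(1)]] assms(3)
    by (intro nn_integral_mono_AE) (auto elim!: eventually_mono)
  then show ?thesis using prob_onD(2)[OF assms(1)] by (simp add: fin_borelD(3)[OF fb])
qed

lemma prob_on_subset:
  assumes "prob_on K \<nu>" "K \<subseteq> S" "K \<in> sets borel"
  shows "prob_on S \<nu>"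
proof -
  have "emeasure \<nu> (UNIV - S) \<le> emeasure \<nu> (UNIV - K)"
    using assms fin_borelD(2)[OF prob_onD(1)[OF assms(1)]] by (intro emeasure_mono) auto
  then show ?thesis using assms(1) by (simp add: prob_on_def)
qed

lemma ex_powr_minus_le:
  assumes "0 < s" "0 < e" shows "\<exists>R>0::real. \<forall>r\<ge>R. c * r powr (- s) \<le> e"
proof -
  have "((\<lambda>r. c * r powr (- s)) \<longlongrightarrow> c * 0) at_top"
    by (intro tendsto_mult tendsto_neg_powr tendsto_const filterlim_ident) (use assms in simp)
  then have "\<forall>\<^sub>F r in at_top. c * r powr (- s) < e"
    by (rule order_tendstoD(2)) (use assms in simp)
  then obtain R where "\<And>r. R \<le> r \<Longrightarrow> c * r powr (- s) < e" by (auto simp: eventually_at_top_linorder)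
  then show ?thesis by (intro exI[of _ "max R 1"]) (auto intro: less_imp_le)
qed

text \<open>\<open>G\<close> is the external field, shifted by a constant to be nonnegative and set to \<open>0\<close> off \<open>\<Sigma>\<close>.\<close>
locale riesz_field =
  fixes s g :: real and \<Sigma> :: "'a::euclidean_space set" and G :: "'a \<Rightarrow> ennreal"
  assumes s: "0 < s" and closed: "closed \<Sigma>" and not_thin: "\<not> thin_at_infinity s \<Sigma>"
    and g: "0 \<le> g" and G_outside: "\<And>x. x \<notin> \<Sigma> \<Longrightarrow> G x = 0"
    and G_lsc: "\<And>x y. x \<in> \<Sigma> \<Longrightarrow> y < G x \<Longrightarrow> \<exists>e>0. \<forall>z\<in>\<Sigma>. dist z x < e \<longrightarrow> y < G z"
    and G_infinity: "\<And>\<epsilon>. 0 < \<epsilon> \<Longrightarrow>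
      \<exists>R. \<forall>x\<in>\<Sigma>. R \<le> norm x \<longrightarrow> ennreal (g - \<epsilon>) \<le> G x \<and> G x \<le> ennreal (g + \<epsilon>)"
begin

definition J :: "'a measure \<Rightarrow> ennreal" where
  "J \<sigma> = riesz_energy s \<sigma> + 2 * (\<integral>\<^sup>+ x. G x \<partial>\<sigma>)"

definition minimizer :: "'a measure \<Rightarrow> bool" where
  "minimizer \<mu> \<longleftrightarrow> prob_on \<Sigma> \<mu> \<and> (\<forall>\<sigma>. prob_on \<Sigma> \<sigma> \<longrightarrow> J \<mu> \<le> J \<sigma>)"

lemma \<Sigma>_borel [measurable]: "\<Sigma> \<in> sets borel"
  using closed by simp

text \<open>Strict superlevel sets lie in \<Sigma>, since \<open>G\<close> is 0 elsewhere, and by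
  lower semicontinuity they are relatively open in this closed set.\<close>

lemma G_measurable [measurable]: "G \<in> borel_measurable borel"
proof (rule borel_measurableI_greater)
  fix y
  define U where "U = (\<Union>(x, e)\<in>{(x, e). \<forall>z\<in>\<Sigma>. dist z x < e \<longrightarrow> y < G z}. ball x e)"
  have "{x \<in> space borel. y < G x} = \<Sigma> \<inter> U"
  proof (intro equalityI subsetI)
    fix x assume "x \<in> {x \<in> space borel. y < G x}"
    then have y: "y < G x" by simp
    then have x: "x \<in> \<Sigma>" using G_outside[of x] by (cases "x \<in> \<Sigma>") auto
    from G_lsc[OF x y] obtain e where "0 < e" "\<forall>z\<in>\<Sigma>. dist z x < e \<longrightarrow> y < G z" by blast
    then show "x \<in> \<Sigma> \<inter> U" using x unfolding U_def by (intro IntI UN_I[of "(x, e)"]) auto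
  next
    fix x assume "x \<in> \<Sigma> \<inter> U"
    then show "x \<in> {x \<in> space borel. y < G x}" unfolding U_def by (auto simp: dist_commute)
  qed
  moreover have "open U" unfolding U_def by auto
  ultimately show "{x \<in> space borel. y < G x} \<in> sets borel" by simp
qed

lemma G_le_liminf:
  assumes "\<And>n. X n \<in> \<Sigma>" "X \<longlonglongrightarrow> x"
  shows "G x \<le> liminf (\<lambda>n. G (X n))"
proof (rule le_Liminf_iff[THEN iffD2, rule_format])
  fix y assume y: "y < G x"
  have "x \<in> \<Sigma>" using closed_sequentially[OF closed] assms by blast
  from G_lsc[OF this y] obtain e where "0 < e" "\<forall>z\<in>\<Sigma>. dist z x < e \<longrightarrow> y < G z" by blast
  then show "\<forall>\<^sub>F n in sequentially. y < G (X n)"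
    using assms(1) tendstoD[OF assms(2), of e] by (auto elim!: eventually_mono)
qed

lemma J_mix:
  assumes "fin_borel \<mu>" "fin_borel \<nu>"
  shows "J (mix a \<mu> b \<nu>) = a * a * riesz_energy s \<mu> + 2 * a * b * mutual s \<mu> \<nu> + b * b * riesz_energy s \<nu>
    + 2 * (a * (\<integral>\<^sup>+ x. G x \<partial>\<mu>) + b * (\<integral>\<^sup>+ x. G x \<partial>\<nu>))"
  unfolding J_def energy_mix[OF assms] nn_integral_mix[OF assms G_measurable] ..

lemma ex_test_measure:
  assumes P: "P \<in> sets borel" "thin_at_infinity s P"
    and \<mu>: "fin_borel \<mu>" and pos: "0 < \<epsilon>" "0 < \<eta>"
  obtains K \<nu> where "compact K" "K \<subseteq> \<Sigma> - P" "prob_on K \<nu>" "prob_on \<Sigma> \<nu>" "riesz_energy s \<nu> \<le> ennreal \<eta>"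
    "\<And>x. x \<in> K \<Longrightarrow> R \<le> norm x" "\<And>x. x \<in> K \<Longrightarrow> G x \<le> ennreal (g + \<eta>)"
    "\<And>x. x \<in> K \<Longrightarrow> potential s \<mu> x \<le> (emeasure \<mu> UNIV + ennreal \<epsilon>) * ennreal (norm x powr (- s))"
proof -
  obtain R1 where R1: "\<forall>x\<in>\<Sigma>. R1 \<le> norm x \<longrightarrow> ennreal (g - \<eta>) \<le> G x \<and> G x \<le> ennreal (g + \<eta>)"
    using G_infinity[OF pos(2)] by blast
  from not_thin_imp_test_measure[OF s \<Sigma>_borel not_thin P \<mu> pos, of "max R R1"]
  obtain K \<nu> where K: "compact K" "K \<subseteq> \<Sigma> - P" "prob_on K \<nu>" "riesz_energy s \<nu> \<le> ennreal \<eta>"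
    "\<And>x. x \<in> K \<Longrightarrow> max R R1 \<le> norm x"
    "\<And>x. x \<in> K \<Longrightarrow> potential s \<mu> x \<le> (emeasure \<mu> UNIV + ennreal \<epsilon>) * ennreal (norm x powr (- s))"
    by blast
  show ?thesis
  proof (rule that[OF K(1-3) _ K(4)])
    show "prob_on \<Sigma> \<nu>" using K by (intro prob_on_subset[OF K(3)]) (auto simp: compact_imp_closed)
    show "R \<le> norm x" if "x \<in> K" for x using K(5)[OF that] by simp
    show "G x \<le> ennreal (g + \<eta>)" if "x \<in> K" for x using K(2) K(5)[OF that] R1 that by auto
  qed (rule K(6))
qed

lemma thin_empty: "thin_at_infinity s ({} :: 'a set)"
  using thin_potential_superlevel[OF s, of "null_measure borel" 1]
  by (rule thin_at_infinity_subset) (auto simp: fin_borel_def intro!: finite_measureI)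

text \<open>Mass can be placed near infinity at the price \<open>2 * g\<close> per unit: self-energy
  and interaction with a given measure are negligible there, and the field is close to
  \<open>g\<close>.\<close>

lemma ex_cheap_measure:
  assumes \<mu>: "fin_borel \<mu>" and e: "0 < e"
  obtains \<nu> where "prob_on \<Sigma> \<nu>" "riesz_energy s \<nu> \<le> ennreal e"
    "mutual s \<mu> \<nu> \<le> ennreal e" "(\<integral>\<^sup>+ x. G x \<partial>\<nu>) \<le> ennreal (g + e)"
proof -
  obtain m where m: "emeasure \<mu> UNIV = ennreal m" "0 \<le> m"
    using fin_borelD(5)[OF \<mu>, of UNIV] by (cases "emeasure \<mu> UNIV") auto
  obtain R where R: "0 < R" "\<And>r. R \<le> r \<Longrightarrow> (m + 1) * r powr (- s) \<le> e"
    using ex_powr_minus_le[OF s e] by blast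
  obtain K \<nu> where K: "compact K" "prob_on K \<nu>" "prob_on \<Sigma> \<nu>" "riesz_energy s \<nu> \<le> ennreal e"
    "\<And>x. x \<in> K \<Longrightarrow> R \<le> norm x" "\<And>x. x \<in> K \<Longrightarrow> G x \<le> ennreal (g + e)"
    "\<And>x. x \<in> K \<Longrightarrow> potential s \<mu> x \<le> (emeasure \<mu> UNIV + ennreal 1) * ennreal (norm x powr (- s))"
    by (rule ex_test_measure[OF sets.empty_sets thin_empty \<mu> zero_less_one e, of R]) (rule that)
  have Kb: "K \<in> sets borel" using K by (simp add: compact_imp_closed)
  show ?thesis
  proof (rule that[OF K(3,4)])
    show "mutual s \<mu> \<nu> \<le> ennreal e"
      unfolding mutual_def
    proof (rule nn_integral_le_of_prob_on[OF K(2) Kb])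
      fix x assume x: "x \<in> K"
      have "potential s \<mu> x \<le> ennreal ((m + 1) * norm x powr (- s))"
        using K(7)[OF x] m by (simp add: ennreal_mult ennreal_plus)
      also have "\<dots> \<le> ennreal e" by (intro ennreal_leI R K x)
      finally show "potential s \<mu> x \<le> ennreal e" .
    qed
    show "(\<integral>\<^sup>+ x. G x \<partial>\<nu>) \<le> ennreal (g + e)"
      by (rule nn_integral_le_of_prob_on[OF K(2) Kb K(6)])
  qed
qed

text \<open>The missing mass 1 - m goes to a cheap measure far out. The price matches the loss in
  \<open>ex_vague_minimizer\<close>.\<close>

lemma ex_prob_on_J_le:
  assumes \<mu>: "fin_borel \<mu>" "emeasure \<mu> (UNIV - \<Sigma>) = 0" and m: "emeasure \<mu> UNIV = ennreal m" "0 \<le> m" "m \<le> 1"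
    and \<eta>: "0 < \<eta>"
  shows "\<exists>\<sigma>. prob_on \<Sigma> \<sigma> \<and> J \<sigma> \<le> J \<mu> + ennreal (2 * (1 - m) * g) + ennreal \<eta>"
proof -
  \<comment> \<open>The errors 2 t e, t^2 e and 2 t e from mutual energy, self-energy and field add
    up to at most 5 e, as t <= 1.\<close>
  define t e where "t = 1 - m" and "e = \<eta> / 5"
  have t: "0 \<le> t" "t \<le> 1" and e: "0 < e" using m \<eta> by (auto simp: t_def e_def)
  obtain \<nu> where \<nu>: "prob_on \<Sigma> \<nu>" "riesz_energy s \<nu> \<le> ennreal e"
    "mutual s \<mu> \<nu> \<le> ennreal e" "(\<integral>\<^sup>+ x. G x \<partial>\<nu>) \<le> ennreal (g + e)"
    using ex_cheap_measure[OF \<mu>(1) e] by blast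
  note fb = prob_onD(1)[OF \<nu>(1)]
  define \<sigma> where "\<sigma> = mix 1 \<mu> (ennreal t) \<nu>"
  have "prob_on \<Sigma> \<sigma>"
  proof (rule prob_onI)
    show "fin_borel \<sigma>" unfolding \<sigma>_def by (intro fin_borel_mix \<mu> fb) auto
    show "emeasure \<sigma> UNIV = 1"
      using m t prob_onD(2)[OF \<nu>(1)] by (simp add: \<sigma>_def emeasure_mix[OF \<mu>(1) fb] t_def flip: ennreal_plus)
    show "emeasure \<sigma> (UNIV - \<Sigma>) = 0"
      using \<mu>(2) prob_onD(4)[OF \<nu>(1)] by (simp add: \<sigma>_def emeasure_mix[OF \<mu>(1) fb])
  qed
  moreover have "J \<sigma> \<le> J \<mu> + ennreal (2 * t * g) + ennreal \<eta>"
  proof -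
    have "J \<sigma> = J \<mu> + (2 * ennreal t * mutual s \<mu> \<nu> + ennreal t * ennreal t * riesz_energy s \<nu>
        + 2 * ennreal t * (\<integral>\<^sup>+ x. G x \<partial>\<nu>))"
      unfolding \<sigma>_def J_mix[OF \<mu>(1) fb] by (simp add: J_def algebra_simps)
    also have "\<dots> \<le> J \<mu> + (2 * ennreal t * ennreal e + ennreal t * ennreal t * ennreal e
        + 2 * ennreal t * ennreal (g + e))"
      by (intro add_mono mult_left_mono \<nu> order_refl) auto
    also have "2 * ennreal t * ennreal e + ennreal t * ennreal t * ennreal e + 2 * ennreal t * ennreal (g + e)
        = ennreal (2 * t * e + t * t * e + 2 * t * (g + e))"
      using t e g by (simp add: ennreal_plus ennreal_mult)
    also have "\<dots> \<le> ennreal (2 * t * g + \<eta>)"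
    proof (rule ennreal_leI)
      have "t * e \<le> e" "t * t * e \<le> e" using t e by (auto simp: mult_le_one intro!: mult_left_le_one_le)
      then show "2 * t * e + t * t * e + 2 * t * (g + e) \<le> 2 * t * g + \<eta>"
        unfolding e_def by (simp add: algebra_simps)
    qed
    finally show ?thesis using t g \<eta> by (simp add: ennreal_plus add.assoc)
  qed
  ultimately show ?thesis unfolding t_def by blast
qed

text \<open>A limit of a minimising sequence may lose the mass \<open>1 - m\<close> to infinity, which contributes
  \<open>2 * (1 - m) * g\<close> to the limit energy.\<close>
lemma ex_vague_minimizer:
  obtains \<mu> m where "fin_borel \<mu>" "emeasure \<mu> (UNIV - \<Sigma>) = 0" "emeasure \<mu> UNIV = ennreal m" "0 \<le> m" "m \<le> 1"
    "J \<mu> + ennreal (2 * (1 - m) * g) \<le> (INF \<sigma>\<in>{\<sigma>. prob_on \<Sigma> \<sigma>}. J \<sigma>)"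
    "(INF \<sigma>\<in>{\<sigma>. prob_on \<Sigma> \<sigma>}. J \<sigma>) < \<infinity>"
proof -
  define w where "w = (INF \<sigma>\<in>{\<sigma>. prob_on \<Sigma> \<sigma>}. J \<sigma>)"
  have w: "w < \<infinity>"
  proof -
    have "fin_borel (null_measure borel :: 'a measure)" by (auto simp: fin_borel_def intro!: finite_measureI)
    from ex_cheap_measure[OF this zero_less_one] obtain \<nu> where \<nu>: "prob_on \<Sigma> \<nu>"
      "riesz_energy s \<nu> \<le> ennreal 1" "(\<integral>\<^sup>+ x. G x \<partial>\<nu>) \<le> ennreal (g + 1)" by blast
    have "w \<le> J \<nu>" unfolding w_def using \<nu> by (intro INF_lower) auto
    also have "\<dots> \<le> ennreal 1 + 2 * ennreal (g + 1)"
      unfolding J_def by (intro add_mono mult_left_mono \<nu>) auto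
    also have "\<dots> < \<infinity>" by (simp add: ennreal_mult_less_top)
    finally show ?thesis .
  qed
  have "\<exists>\<sigma>. prob_on \<Sigma> \<sigma> \<and> J \<sigma> < w + ennreal (1 / real (Suc n))" for n
  proof -
    have "w < w + ennreal (1 / real (Suc n))" using w by simp
    then show ?thesis unfolding w_def by (auto simp: INF_less_iff)
  qed
  then obtain \<sigma> where \<sigma>: "\<And>n. prob_on \<Sigma> (\<sigma> n)" "\<And>n. J (\<sigma> n) < w + ennreal (1 / real (Suc n))" by metis
  note fb = prob_onD(1)[OF \<sigma>(1)]
  obtain r :: "nat \<Rightarrow> nat" and \<Omega> :: "real measure" and X :: "nat \<Rightarrow> real \<Rightarrow> 'a" and Y A where
    r: "strict_mono r" and \<Omega>: "prob_space \<Omega>"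
    and X [measurable]: "\<And>n. X n \<in> \<Omega> \<rightarrow>\<^sub>M borel" and dX: "\<And>n. distr \<Omega> borel (X n) = \<sigma> (r n)"
    and Y [measurable]: "Y \<in> \<Omega> \<rightarrow>\<^sub>M borel" and A [measurable]: "A \<in> sets \<Omega>"
    and lim: "AE \<omega> in \<Omega>. \<omega> \<in> A \<longrightarrow> (\<lambda>n. X n \<omega>) \<longlonglongrightarrow> Y \<omega>"
    and esc: "AE \<omega> in \<Omega>. \<omega> \<notin> A \<longrightarrow> filterlim (\<lambda>n. norm (X n \<omega>)) at_top sequentially"
    by (rule prob_measures_convergent_subsequence[OF prob_onD(3)[OF \<sigma>(1)] fin_borelD(2)[OF fb]]) (rule that)
  interpret \<Omega>: prob_space \<Omega> by fact
  have "AE \<omega> in \<Omega>. X n \<omega> \<in> \<Sigma>" for n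
  proof -
    have "AE x in distr \<Omega> borel (X n). x \<in> \<Sigma>"
      unfolding dX using AE_in_support[OF fb \<Sigma>_borel prob_onD(4)[OF \<sigma>(1)]] .
    then show ?thesis by (subst (asm) AE_distr_iff) auto
  qed
  then have X\<Sigma>: "AE \<omega> in \<Omega>. \<forall>n. X n \<omega> \<in> \<Sigma>" by (simp add: AE_all_countable)
  \<comment> \<open>The law of the limit on the event \<open>A\<close>. Its total mass is the
    probability of \<open>A\<close>, and the rest has escaped to infinity.\<close>
  define \<mu> where "\<mu> = distr (density \<Omega> (indicator A)) borel Y"
  have int: "(\<integral>\<^sup>+ x. f x \<partial>\<mu>) = (\<integral>\<^sup>+ \<omega>. f (Y \<omega>) * indicator A \<omega> \<partial>\<Omega>)"
    if [measurable]: "f \<in> borel_measurable borel" for f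
    unfolding \<mu>_def by (subst nn_integral_distr) (auto simp: nn_integral_density mult.commute)
  define m where "m = measure \<Omega> A"
  have m: "0 \<le> m" "m \<le> 1" by (auto simp: m_def)
  have mU: "emeasure \<mu> UNIV = ennreal m"
  proof -
    have "emeasure \<mu> UNIV = (\<integral>\<^sup>+ x. 1 \<partial>\<mu>)" by (simp add: \<mu>_def)
    also have "\<dots> = emeasure \<Omega> A" by (subst int) auto
    finally show ?thesis by (simp add: m_def \<Omega>.emeasure_eq_measure)
  qed
  have fb\<mu>: "fin_borel \<mu>"
    using mU unfolding fin_borel_def by (auto intro!: finite_measureI simp: \<mu>_def)
  note [measurable] = potential_measurable[OF fb\<mu>] potential_measurable[OF fb]
  have \<mu>\<Sigma>: "emeasure \<mu> (UNIV - \<Sigma>) = 0"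
  proof -
    have "emeasure \<mu> (UNIV - \<Sigma>) = (\<integral>\<^sup>+ x. indicator (UNIV - \<Sigma>) x \<partial>\<mu>)" by (simp add: \<mu>_def)
    also have "\<dots> = (\<integral>\<^sup>+ \<omega>. indicator (UNIV - \<Sigma>) (Y \<omega>) * indicator A \<omega> \<partial>\<Omega>)"
      by (rule int) (auto intro!: borel_measurable_indicator)
    also have "\<dots> = (\<integral>\<^sup>+ \<omega>. 0 \<partial>\<Omega>)"
    proof (rule nn_integral_cong_AE)
      show "AE \<omega> in \<Omega>. indicator (UNIV - \<Sigma>) (Y \<omega>) * indicator A \<omega> = (0::ennreal)"
        using lim X\<Sigma>
      proof eventually_elim
        case (elim \<omega>)
        then show ?case using closed_sequentially[OF closed, of "\<lambda>n. X n \<omega>" "Y \<omega>"]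
          by (auto simp: indicator_def)
      qed
    qed
    finally show ?thesis by simp
  qed
  \<comment> \<open>\<open>Hn n\<close> integrates to the energy of the n-th measure and
    \<open>H\<close> to the claimed lower bound, so it suffices to compare them pointwise. Off
    \<open>A\<close> the points escape, and the field alone contributes
    \<open>2 * g\<close>.\<close>
  define H where "H \<omega> = (potential s \<mu> (Y \<omega>) + 2 * G (Y \<omega>)) * indicator A \<omega>
      + ennreal (2 * g) * indicator (space \<Omega> - A) \<omega>" for \<omega>
  define Hn where "Hn n \<omega> = potential s (\<sigma> (r n)) (X n \<omega>) + 2 * G (X n \<omega>)" for n \<omega>
  have HnJ: "(\<integral>\<^sup>+ \<omega>. Hn n \<omega> \<partial>\<Omega>) = J (\<sigma> (r n))" for n
  proof -
    have "J (\<sigma> (r n)) = (\<integral>\<^sup>+ x. potential s (\<sigma> (r n)) x + 2 * G x \<partial>\<sigma> (r n))"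
      unfolding J_def riesz_energy_mutual mutual_def
      by (subst nn_integral_add) (auto simp: measurable_fin_borel[OF fb] nn_integral_cmult potential_measurable[OF fb])
    also have "\<dots> = (\<integral>\<^sup>+ x. potential s (\<sigma> (r n)) x + 2 * G x \<partial>distr \<Omega> borel (X n))"
      by (simp only: dX)
    also have "\<dots> = (\<integral>\<^sup>+ \<omega>. Hn n \<omega> \<partial>\<Omega>)"
      unfolding Hn_def by (rule nn_integral_distr) measurable
    finally show ?thesis ..
  qed
  have HJ: "(\<integral>\<^sup>+ \<omega>. H \<omega> \<partial>\<Omega>) = J \<mu> + ennreal (2 * (1 - m) * g)"
  proof -
    have "(\<integral>\<^sup>+ \<omega>. H \<omega> \<partial>\<Omega>) = (\<integral>\<^sup>+ \<omega>. (potential s \<mu> (Y \<omega>) + 2 * G (Y \<omega>)) * indicator A \<omega> \<partial>\<Omega>)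
        + ennreal (2 * g) * emeasure \<Omega> (space \<Omega> - A)"
      unfolding H_def by (subst nn_integral_add) (auto simp: nn_integral_cmult_indicator)
    also have "emeasure \<Omega> (space \<Omega> - A) = ennreal (1 - m)"
      by (simp add: \<Omega>.emeasure_eq_measure \<Omega>.prob_compl m_def)
    also have "(\<integral>\<^sup>+ \<omega>. (potential s \<mu> (Y \<omega>) + 2 * G (Y \<omega>)) * indicator A \<omega> \<partial>\<Omega>)
        = (\<integral>\<^sup>+ x. potential s \<mu> x + 2 * G x \<partial>\<mu>)"
      by (rule int[symmetric]) measurable
    also have "\<dots> = J \<mu>"
      unfolding J_def riesz_energy_mutual mutual_def
      by (subst nn_integral_add) (auto simp: measurable_fin_borel[OF fb\<mu>] nn_integral_cmult potential_measurable[OF fb\<mu>])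
    finally show ?thesis using g m by (simp add: algebra_simps flip: ennreal_mult)
  qed
  have "AE \<omega> in \<Omega>. H \<omega> \<le> liminf (\<lambda>n. Hn n \<omega>)"
    using lim esc X\<Sigma> AE_space
  proof eventually_elim
    case (elim \<omega>)
    show ?case
    proof (cases "\<omega> \<in> A")
      case True
      then have \<omega>: "(\<lambda>n. X n \<omega>) \<longlonglongrightarrow> Y \<omega>" using elim by simp
      \<comment> \<open>The inner use of Fatou's lemma: \<omega> is fixed and \<omega>' is the
        integration variable of the potential.\<close>
      have "potential s \<mu> (Y \<omega>) = (\<integral>\<^sup>+ \<omega>'. riesz_kernel s (Y \<omega>) (Y \<omega>') * indicator A \<omega>' \<partial>\<Omega>)"
        unfolding potential_def by (intro int) measurable
      also have "\<dots> \<le> (\<integral>\<^sup>+ \<omega>'. liminf (\<lambda>n. riesz_kernel s (X n \<omega>) (X n \<omega>')) \<partial>\<Omega>)"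
      proof (rule nn_integral_mono_AE)
        show "AE \<omega>' in \<Omega>. riesz_kernel s (Y \<omega>) (Y \<omega>') * indicator A \<omega>'
          \<le> liminf (\<lambda>n. riesz_kernel s (X n \<omega>) (X n \<omega>'))"
          using lim by eventually_elim (auto simp: indicator_def intro!: riesz_kernel_le_liminf s \<omega>)
      qed
      also have "\<dots> \<le> liminf (\<lambda>n. \<integral>\<^sup>+ \<omega>'. riesz_kernel s (X n \<omega>) (X n \<omega>') \<partial>\<Omega>)"
        by (rule nn_integral_liminf) measurable
      also have "(\<lambda>n. \<integral>\<^sup>+ \<omega>'. riesz_kernel s (X n \<omega>) (X n \<omega>') \<partial>\<Omega>) = (\<lambda>n. potential s (\<sigma> (r n)) (X n \<omega>))"
        unfolding potential_def dX[symmetric] by (subst nn_integral_distr) auto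
      finally have 1: "potential s \<mu> (Y \<omega>) \<le> liminf (\<lambda>n. potential s (\<sigma> (r n)) (X n \<omega>))" .
      have 2: "G (Y \<omega>) \<le> liminf (\<lambda>n. G (X n \<omega>))"
        using elim \<omega> by (intro G_le_liminf) auto
      have "H \<omega> = potential s \<mu> (Y \<omega>) + (G (Y \<omega>) + G (Y \<omega>))"
        unfolding mult_2[symmetric] using True by (simp add: H_def)
      also have "\<dots> \<le> liminf (\<lambda>n. potential s (\<sigma> (r n)) (X n \<omega>)) + (liminf (\<lambda>n. G (X n \<omega>)) + liminf (\<lambda>n. G (X n \<omega>)))"
        by (intro add_mono 1 2)
      also have "\<dots> \<le> liminf (\<lambda>n. potential s (\<sigma> (r n)) (X n \<omega>) + (G (X n \<omega>) + G (X n \<omega>)))"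
        by (rule order_trans[OF add_left_mono[OF ennreal_liminf_add_le] ennreal_liminf_add_le])
      finally show ?thesis unfolding mult_2[symmetric] Hn_def .
    next
      case False
      have "H \<omega> = ennreal (2 * g)" using False elim(4) by (simp add: H_def)
      also have "\<dots> \<le> liminf (\<lambda>n. Hn n \<omega>)"
      proof (rule ennreal_le_epsilon)
        fix e :: real assume e: "0 < e"
        obtain R where R: "\<forall>x\<in>\<Sigma>. R \<le> norm x \<longrightarrow> ennreal (g - e / 2) \<le> G x \<and> G x \<le> ennreal (g + e / 2)"
          using G_infinity[of "e / 2"] e by auto
        have "\<forall>\<^sub>F n in sequentially. R \<le> norm (X n \<omega>)"
          using elim(2) False by (simp add: filterlim_at_top)
        then have "\<forall>\<^sub>F n in sequentially. ennreal (2 * g - e) \<le> Hn n \<omega>"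
        proof eventually_elim
          case (elim n)
          then have "ennreal (g - e / 2) \<le> G (X n \<omega>)" using R \<open>\<forall>n. X n \<omega> \<in> \<Sigma>\<close> by auto
          then have "2 * ennreal (g - e / 2) \<le> Hn n \<omega>"
            unfolding Hn_def by (intro add_increasing mult_left_mono) auto
          moreover have "2 * ennreal (g - e / 2) = ennreal (2 * g - e)"
            using ennreal_mult'[of 2 "g - e / 2"] by (simp add: algebra_simps)
          ultimately show ?case by simp
        qed
        then have "ennreal (2 * g - e) \<le> liminf (\<lambda>n. Hn n \<omega>)" by (rule Liminf_bounded)
        moreover have "ennreal (2 * g) \<le> ennreal (2 * g - e) + ennreal e"
          using e by (cases "0 \<le> 2 * g - e") (auto simp: ennreal_neg intro: ennreal_leI simp flip: ennreal_plus)
        ultimately show "ennreal (2 * g) \<le> liminf (\<lambda>n. Hn n \<omega>) + ennreal e"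
          by (meson add_right_mono order_trans)
      qed
      finally show ?thesis .
    qed
  qed
  then have "(\<integral>\<^sup>+ \<omega>. H \<omega> \<partial>\<Omega>) \<le> (\<integral>\<^sup>+ \<omega>. liminf (\<lambda>n. Hn n \<omega>) \<partial>\<Omega>)"
    by (rule nn_integral_mono_AE)
  also have "\<dots> \<le> liminf (\<lambda>n. \<integral>\<^sup>+ \<omega>. Hn n \<omega> \<partial>\<Omega>)"
    unfolding Hn_def by (rule nn_integral_liminf) measurable
  also have "\<dots> \<le> liminf (\<lambda>n. w + ennreal (1 / real (Suc n)))"
    unfolding HnJ
  proof (intro Liminf_mono always_eventually allI)
    fix n
    have "n \<le> r n" using r by (rule seq_suble)
    then have "ennreal (1 / real (Suc (r n))) \<le> ennreal (1 / real (Suc n))"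
      by (intro ennreal_leI divide_left_mono) auto
    then show "J (\<sigma> (r n)) \<le> w + ennreal (1 / real (Suc n))"
      using \<sigma>(2)[of "r n"] by (meson add_left_mono less_imp_le order_trans)
  qed
  also have "\<dots> = w"
  proof (rule lim_imp_Liminf)
    have "(\<lambda>n. 1 / real (Suc n)) \<longlonglongrightarrow> 0" using LIMSEQ_inverse_real_of_nat by (simp add: inverse_eq_divide)
    then have "(\<lambda>n. w + ennreal (1 / real (Suc n))) \<longlonglongrightarrow> w + ennreal 0"
      by (intro tendsto_add tendsto_const tendsto_ennrealI)
    then show "(\<lambda>n. w + ennreal (1 / real (Suc n))) \<longlonglongrightarrow> w" by simp
  qed simp
  finally have "J \<mu> + ennreal (2 * (1 - m) * g) \<le> w" unfolding HJ .
  then show ?thesis using that[OF fb\<mu> \<mu>\<Sigma> mU m] w unfolding w_def by blast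
qed

end

text \<open>Test measures live on compact sets, so a pointwise gain proportional to
  \<open>norm x powr (- s)\<close> becomes a fixed positive amount.\<close>

lemma compact_imp_norm_powr_minus_ge:
  assumes "0 < s" "compact K" "\<And>x. x \<in> K \<Longrightarrow> 1 \<le> norm x"
  obtains \<kappa> where "0 < \<kappa>" "\<And>x. x \<in> K \<Longrightarrow> \<kappa> \<le> norm x powr (- s)"
proof -
  obtain T where T: "0 < T" "\<And>x. x \<in> K \<Longrightarrow> norm x \<le> T"
    using compact_imp_bounded[OF assms(2)] by (auto simp: bounded_pos)
  show ?thesis
  proof (rule that[of "T powr (- s)"])
    show "T powr (- s) \<le> norm x powr (- s)" if "x \<in> K" for x
      using assms(1) assms(3)[OF that] T(2)[OF that] by (intro powr_mono2') auto
  qed (use T in simp)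
qed

text \<open>Most of the mass lies in a fixed ball, and from a sufficiently distant \<open>x\<close>
  all points of that ball are at distance at most (1 + \<theta>) |x|.\<close>

lemma potential_ge_at_infinity:
  fixes \<mu> :: "'a::euclidean_space measure"
  assumes s: "0 < s" and \<mu>: "fin_borel \<mu>" "emeasure \<mu> UNIV = 1" and \<delta>: "0 < \<delta>" "\<delta> < 1"
  obtains R where "0 < R" "\<And>x. R \<le> norm x \<Longrightarrow> ennreal ((1 - \<delta>) * norm x powr (- s)) \<le> potential s \<mu> x"
proof -
  interpret finite_measure \<mu> using \<mu>(1) by (rule fin_borelD)
  note sb = fin_borelD(2)[OF \<mu>(1)]
  have "(\<lambda>n. measure \<mu> (cball (0::'a) (real n))) \<longlonglongrightarrow> measure \<mu> (\<Union>n. cball 0 (real n))"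
    by (rule finite_Lim_measure_incseq) (auto simp: sb incseq_def)
  moreover have "(\<Union>n. cball (0::'a) (real n)) = UNIV" by (auto intro: real_arch_simple)
  moreover have "measure \<mu> UNIV = 1" using \<mu>(2) by (simp add: measure_def)
  ultimately have "(\<lambda>n. measure \<mu> (cball (0::'a) (real n))) \<longlonglongrightarrow> 1" by simp
  then have "\<forall>\<^sub>F n in sequentially. 1 - \<delta> / 2 < measure \<mu> (cball (0::'a) (real n))"
    by (rule order_tendstoD(1)) (use \<delta> in simp)
  then obtain n where n: "1 - \<delta> / 2 < measure \<mu> (cball (0::'a) (real n))"
    by (auto simp: eventually_sequentially)
  have "((\<lambda>\<theta>. (1 + \<theta>) powr (- s)) \<longlongrightarrow> (1 + 0) powr (- s)) (at_right 0)"
    by (intro tendsto_powr tendsto_add tendsto_const tendsto_ident_at) simp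
  then have "\<forall>\<^sub>F \<theta> in at_right 0. 1 - \<delta> / 2 < (1 + \<theta>) powr (- s)"
    by (rule order_tendstoD(1)) (use \<delta> in simp)
  moreover have "\<forall>\<^sub>F \<theta> in at_right 0. (0::real) < \<theta>" by (simp add: eventually_at_right_less)
  ultimately have "\<forall>\<^sub>F \<theta> in at_right 0. 0 < \<theta> \<and> 1 - \<delta> / 2 < (1 + \<theta>) powr (- s)"
    by eventually_elim simp
  from eventually_happens[OF this] obtain \<theta> :: real where \<theta>: "0 < \<theta>" "1 - \<delta> / 2 < (1 + \<theta>) powr (- s)"
    by auto
  show ?thesis
  proof (rule that[of "(real n + 1) / \<theta>"])
    show "0 < (real n + 1) / \<theta>" using \<theta> by simp
    fix x :: 'a assume x: "(real n + 1) / \<theta> \<le> norm x"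
    then have nx: "real n \<le> \<theta> * norm x" using \<theta> by (simp add: field_simps)
    \<comment> \<open>One factor 1 - \<delta>/2 pays for the mass outside the ball, the other for
      the distortion of distances.\<close>
    have "(1 - \<delta>) * norm x powr (- s) \<le> (1 - \<delta> / 2) * (1 - \<delta> / 2) * norm x powr (- s)"
      by (intro mult_right_mono) (simp_all add: field_simps)
    also have "\<dots> \<le> ((1 + \<theta>) powr (- s) * measure \<mu> (cball (0::'a) (real n))) * norm x powr (- s)"
      using \<theta> n \<delta> by (intro mult_right_mono mult_mono) auto
    also have "\<dots> = ((1 + \<theta>) * norm x) powr (- s) * measure \<mu> (cball (0::'a) (real n))"
      using \<theta> by (simp add: powr_mult)
    finally have "ennreal ((1 - \<delta>) * norm x powr (- s))
        \<le> ennreal (((1 + \<theta>) * norm x) powr (- s)) * emeasure \<mu> (cball (0::'a) (real n))"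
      by (simp add: emeasure_eq_measure ennreal_leI flip: ennreal_mult)
    also have "\<dots> = (\<integral>\<^sup>+ t. ennreal (((1 + \<theta>) * norm x) powr (- s)) * indicator (cball 0 (real n)) t \<partial>\<mu>)"
      by (simp add: nn_integral_cmult_indicator sb)
    also have "\<dots> \<le> potential s \<mu> x"
      unfolding potential_def
    proof (rule nn_integral_mono)
      fix t
      show "ennreal (((1 + \<theta>) * norm x) powr (- s)) * indicator (cball 0 (real n)) t \<le> riesz_kernel s x t"
      proof (cases "t \<in> cball 0 (real n)")
        case True
        then have "dist x t \<le> (1 + \<theta>) * norm x"
          using nx norm_triangle_ineq4[of x t] by (simp add: dist_norm algebra_simps)
        then show ?thesis using True by (simp add: riesz_kernel_ge[OF s])
      qed simp
    qed
    finally show "ennreal ((1 - \<delta>) * norm x powr (- s)) \<le> potential s \<mu> x" .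
  qed
qed

context riesz_field
begin

lemma nn_integral_potential_field:
  assumes \<mu>: "fin_borel \<mu>" and \<nu>: "prob_on A \<nu>"
  shows "(\<integral>\<^sup>+ x. potential s \<mu> x + G x + c \<partial>\<nu>) = mutual s \<mu> \<nu> + (\<integral>\<^sup>+ x. G x \<partial>\<nu>) + c"
proof -
  note fb = prob_onD(1)[OF \<nu>]
  have [measurable]: "potential s \<mu> \<in> borel_measurable \<nu>" "G \<in> borel_measurable \<nu>"
    by (simp_all add: measurable_fin_borel[OF fb] potential_measurable[OF \<mu>])
  have "(\<integral>\<^sup>+ x. potential s \<mu> x + G x + c \<partial>\<nu>) = (\<integral>\<^sup>+ x. potential s \<mu> x + G x \<partial>\<nu>) + (\<integral>\<^sup>+ x. c \<partial>\<nu>)"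
    by (rule nn_integral_add) measurable
  also have "(\<integral>\<^sup>+ x. potential s \<mu> x + G x \<partial>\<nu>) = mutual s \<mu> \<nu> + (\<integral>\<^sup>+ x. G x \<partial>\<nu>)"
    unfolding mutual_def by (rule nn_integral_add) measurable
  finally show ?thesis using prob_onD(2)[OF \<nu>] by (simp add: fin_borelD(3)[OF fb])
qed

lemma ex_minimizer:
  assumes P: "P \<in> sets borel" "thin_at_infinity s P"
    and le: "\<And>\<delta>. 0 < \<delta> \<Longrightarrow> \<exists>R. \<forall>x\<in>\<Sigma> - P. R \<le> norm x \<longrightarrow>
      G x + ennreal ((1 - \<delta>) * norm x powr (- s)) \<le> ennreal g"
  shows "\<exists>\<mu>. minimizer \<mu>"
proof -
  define w where "w = (INF \<sigma>\<in>{\<sigma>. prob_on \<Sigma> \<sigma>}. J \<sigma>)"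
  obtain \<mu> m where \<mu>: "fin_borel \<mu>" "emeasure \<mu> (UNIV - \<Sigma>) = 0" and m: "emeasure \<mu> UNIV = ennreal m" "0 \<le> m" "m \<le> 1"
    and Jw: "J \<mu> + ennreal (2 * (1 - m) * g) \<le> w" and w: "w < \<infinity>"
    unfolding w_def by (rule ex_vague_minimizer)
  have wle: "w \<le> J \<sigma>" if "prob_on \<Sigma> \<sigma>" for \<sigma> unfolding w_def using that by (intro INF_lower) auto
  show ?thesis
  proof (cases "m = 1")
    case True
    then have "J \<mu> \<le> w" using Jw by simp
    then have "minimizer \<mu>"
      unfolding minimizer_def using \<mu> m True by (auto intro!: prob_onI intro: order_trans wle)
    then show ?thesis by blast
  next
    case False
    \<comment> \<open>The deficit 1 - m is split into four parts: one for the estimate of the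
      potential on the test set, one for the hypothesis at \<delta> = \<epsilon>, and two left as
      gain.\<close>
    define \<epsilon> where "\<epsilon> = (1 - m) / 4"
    have \<epsilon>: "0 < \<epsilon>" "m = 1 - 4 * \<epsilon>" using False m by (auto simp: \<epsilon>_def field_simps)
    obtain R where R: "\<forall>x\<in>\<Sigma> - P. R \<le> norm x \<longrightarrow> G x + ennreal ((1 - \<epsilon>) * norm x powr (- s)) \<le> ennreal g"
      using le[OF \<epsilon>(1)] by blast
    obtain K \<nu> where K: "compact K" "K \<subseteq> \<Sigma> - P" "prob_on K \<nu>" "prob_on \<Sigma> \<nu>" "riesz_energy s \<nu> \<le> ennreal 1"
      "\<And>x. x \<in> K \<Longrightarrow> max R 1 \<le> norm x"
      "\<And>x. x \<in> K \<Longrightarrow> potential s \<mu> x \<le> (emeasure \<mu> UNIV + ennreal \<epsilon>) * ennreal (norm x powr (- s))"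
      by (rule ex_test_measure[OF P \<mu>(1) \<epsilon>(1) zero_less_one]) (rule that)
    have Kb: "K \<in> sets borel" using K by (simp add: compact_imp_closed)
    note fb = prob_onD(1)[OF K(4)]
    have "1 \<le> norm x" if "x \<in> K" for x using K(6)[OF that] by simp
    then obtain \<kappa> where \<kappa>: "0 < \<kappa>" "\<And>x. x \<in> K \<Longrightarrow> \<kappa> \<le> norm x powr (- s)"
      using compact_imp_norm_powr_minus_ge[OF s K(1)] by metis
    have "(\<integral>\<^sup>+ x. potential s \<mu> x + G x + ennreal (2 * \<epsilon> * \<kappa>) \<partial>\<nu>) \<le> ennreal g"
    proof (rule nn_integral_le_of_prob_on[OF K(3) Kb])
      fix x assume x: "x \<in> K"
      let ?p = "norm x powr (- s)"
      have "2 * \<epsilon> * \<kappa> \<le> 2 * \<epsilon> * ?p" using \<kappa>(2)[OF x] \<epsilon> by (intro mult_left_mono) auto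
      then have "potential s \<mu> x + G x + ennreal (2 * \<epsilon> * \<kappa>)
          \<le> ennreal ((m + \<epsilon>) * ?p) + G x + ennreal (2 * \<epsilon> * ?p)"
        using K(7)[OF x] m(1,2) \<epsilon>(1) by (intro add_mono ennreal_leI) (simp_all add: ennreal_mult ennreal_plus)
      also have "\<dots> = G x + ennreal ((m + \<epsilon>) * ?p + 2 * \<epsilon> * ?p)"
        using m \<epsilon> by (simp add: ennreal_plus ac_simps)
      also have "(m + \<epsilon>) * ?p + 2 * \<epsilon> * ?p = (1 - \<epsilon>) * ?p"
        unfolding distrib_right[symmetric] using \<epsilon>(2) by simp
      also have "G x + ennreal ((1 - \<epsilon>) * ?p) \<le> ennreal g" using R K(2) K(6)[OF x] x by auto
      finally show "potential s \<mu> x + G x + ennreal (2 * \<epsilon> * \<kappa>) \<le> ennreal g" .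
    qed
    then have a: "mutual s \<mu> \<nu> + (\<integral>\<^sup>+ x. G x \<partial>\<nu>) + ennreal (2 * \<epsilon> * \<kappa>) \<le> ennreal g"
      by (simp only: nn_integral_potential_field[OF \<mu>(1) K(4)])
    have fin: "mutual s \<mu> \<nu> < \<infinity>" "(\<integral>\<^sup>+ x. G x \<partial>\<nu>) < \<infinity>" "riesz_energy s \<nu> < \<infinity>"
      "riesz_energy s \<mu> < \<infinity>" "(\<integral>\<^sup>+ x. G x \<partial>\<mu>) < \<infinity>"
    proof -
      have "mutual s \<mu> \<nu> + (\<integral>\<^sup>+ x. G x \<partial>\<nu>) + ennreal (2 * \<epsilon> * \<kappa>) < \<infinity>" using a by (rule le_less_trans) simp
      then show "mutual s \<mu> \<nu> < \<infinity>" "(\<integral>\<^sup>+ x. G x \<partial>\<nu>) < \<infinity>" by simp_all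
      show "riesz_energy s \<nu> < \<infinity>" using K(5) by (rule le_less_trans) simp
      have "J \<mu> + ennreal (2 * (1 - m) * g) < \<infinity>" using Jw w by (rule le_less_trans)
      then show "riesz_energy s \<mu> < \<infinity>" "(\<integral>\<^sup>+ x. G x \<partial>\<mu>) < \<infinity>"
        by (auto simp: J_def ennreal_mult_less_top)
    qed
    obtain e where e: "mutual s \<mu> \<nu> = ennreal e" "0 \<le> e" using fin(1) by (cases "mutual s \<mu> \<nu>") auto
    obtain \<gamma>' where \<gamma>': "(\<integral>\<^sup>+ x. G x \<partial>\<nu>) = ennreal \<gamma>'" "0 \<le> \<gamma>'" using fin(2) by (cases "\<integral>\<^sup>+ x. G x \<partial>\<nu>") auto
    obtain i' where i': "riesz_energy s \<nu> = ennreal i'" "0 \<le> i'" using fin(3) by (cases "riesz_energy s \<nu>") auto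
    obtain i where i: "riesz_energy s \<mu> = ennreal i" "0 \<le> i" using fin(4) by (cases "riesz_energy s \<mu>") auto
    obtain \<gamma> where \<gamma>: "(\<integral>\<^sup>+ x. G x \<partial>\<mu>) = ennreal \<gamma>" "0 \<le> \<gamma>" using fin(5) by (cases "\<integral>\<^sup>+ x. G x \<partial>\<mu>") auto
    obtain w' where w': "w = ennreal w'" "0 \<le> w'" using w by (cases w) auto
    have i1: "i' \<le> 1" using K(5) i' by simp
    have a': "e + \<gamma>' + 2 * \<epsilon> * \<kappa> \<le> g"
      using a e \<gamma>' \<epsilon> \<kappa> g by (simp flip: ennreal_plus)
    have Jw': "i + 2 * \<gamma> + 2 * (1 - m) * g \<le> w'"
      using Jw i \<gamma> g m w' unfolding J_def
      by (simp flip: ennreal_plus ennreal_mult' ennreal_numeral)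
    \<comment> \<open>The first bound keeps the total mass at most 1. The second keeps the quadratic
      term below 2 \<epsilon> \<kappa> t, half of the linear gain 4 \<epsilon> \<kappa> t.\<close>
    define t where "t = min ((1 - m) / 2) (2 * \<epsilon> * \<kappa>)"
    have t: "0 < t" "m + t \<le> 1" "t \<le> 2 * \<epsilon> * \<kappa>"
      using \<epsilon> \<kappa> False m by (auto simp: t_def min_def field_simps)
    define \<sigma> where "\<sigma> = mix 1 \<mu> (ennreal t) \<nu>"
    have \<sigma>: "fin_borel \<sigma>" unfolding \<sigma>_def by (intro fin_borel_mix \<mu> fb) auto
    have \<sigma>2: "emeasure \<sigma> (UNIV - \<Sigma>) = 0"
      using \<mu>(2) prob_onD(4)[OF K(4)] by (simp add: \<sigma>_def emeasure_mix[OF \<mu>(1) fb])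
    have \<sigma>3: "emeasure \<sigma> UNIV = ennreal (m + t)"
      using m t prob_onD(2)[OF K(4)] by (simp add: \<sigma>_def emeasure_mix[OF \<mu>(1) fb] ennreal_plus)
    have J\<sigma>: "J \<sigma> = ennreal (i + 2 * t * e + t * t * i' + 2 * (\<gamma> + t * \<gamma>'))"
      unfolding \<sigma>_def J_mix[OF \<mu>(1) fb] using i e i' \<gamma> \<gamma>' t
      by (simp add: ennreal_plus ennreal_mult)
    \<comment> \<open>The perturbed measure has mass \<open>m + t\<close>, possibly still less than
      1, so it is completed to a competitor. The extra error uses up another quarter of the
      gain.\<close>
    obtain \<tau> where \<tau>: "prob_on \<Sigma> \<tau>" "J \<tau> \<le> J \<sigma> + ennreal (2 * (1 - (m + t)) * g) + ennreal (\<epsilon> * \<kappa> * t)"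
      using ex_prob_on_J_le[OF \<sigma> \<sigma>2 \<sigma>3, of "\<epsilon> * \<kappa> * t"] m t \<epsilon> \<kappa> by auto
    have "ennreal w' \<le> ennreal (i + 2 * t * e + t * t * i' + 2 * (\<gamma> + t * \<gamma>') + 2 * (1 - (m + t)) * g + \<epsilon> * \<kappa> * t)"
      using wle[OF \<tau>(1)] \<tau>(2) w' i e i' \<gamma> \<gamma>' t g m \<epsilon> \<kappa> unfolding J\<sigma> by (simp add: ennreal_plus)
    then have "w' \<le> i + 2 * t * e + t * t * i' + 2 * (\<gamma> + t * \<gamma>') + 2 * (1 - (m + t)) * g + \<epsilon> * \<kappa> * t"
      using i e i' \<gamma> \<gamma>' t g m \<epsilon> \<kappa> by (subst (asm) ennreal_le_iff) auto
    also have "\<dots> \<le> w' + 2 * (t * (e + \<gamma>' - g)) + t * t * i' + \<epsilon> * \<kappa> * t"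
      using Jw' by (simp add: algebra_simps)
    also have "\<dots> \<le> w' + 2 * (t * (- 2 * \<epsilon> * \<kappa>)) + t * (2 * \<epsilon> * \<kappa>) + \<epsilon> * \<kappa> * t"
    proof -
      have "t * (e + \<gamma>' - g) \<le> t * (- 2 * \<epsilon> * \<kappa>)" using a' t by (intro mult_left_mono) auto
      moreover have "t * t * i' \<le> t * (2 * \<epsilon> * \<kappa>) * 1" using t i1 i' by (intro mult_mono) auto
      ultimately show ?thesis by linarith
    qed
    also have "\<dots> < w'" using t \<epsilon> \<kappa> by (simp add: algebra_simps)
    finally show ?thesis by simp
  qed
qed

section \<open>Variational inequalities for a minimiser\<close>

lemma minimizerD:
  assumes "minimizer \<mu>"
  shows "prob_on \<Sigma> \<mu>" "fin_borel \<mu>" "emeasure \<mu> UNIV = 1" "riesz_energy s \<mu> < \<infinity>" "(\<integral>\<^sup>+ x. G x \<partial>\<mu>) < \<infinity>"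
proof -
  show p: "prob_on \<Sigma> \<mu>" using assms by (simp add: minimizer_def)
  then show f: "fin_borel \<mu>" and "emeasure \<mu> UNIV = 1" by (rule prob_onD)+
  obtain \<nu> where \<nu>: "prob_on \<Sigma> \<nu>" "riesz_energy s \<nu> \<le> ennreal 1" "(\<integral>\<^sup>+ x. G x \<partial>\<nu>) \<le> ennreal (g + 1)"
    using ex_cheap_measure[OF f zero_less_one] by blast
  have "J \<mu> \<le> J \<nu>" using assms \<nu>(1) by (simp add: minimizer_def)
  also have "\<dots> \<le> ennreal 1 + 2 * ennreal (g + 1)"
    unfolding J_def by (intro add_mono mult_left_mono \<nu>) auto
  also have "\<dots> < \<infinity>" by (simp add: ennreal_mult_less_top)
  finally show "riesz_energy s \<mu> < \<infinity>" "(\<integral>\<^sup>+ x. G x \<partial>\<mu>) < \<infinity>"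
    by (auto simp: J_def ennreal_mult_less_top)
qed

text \<open>The modified Robin constant, that is, the mean of \<open>potential s \<mu> + G\<close>
  under \<mu>. It is the constant F of the overview, up to the shift of the field.\<close>

definition robin :: "'a measure \<Rightarrow> ennreal" where
  "robin \<mu> = riesz_energy s \<mu> + (\<integral>\<^sup>+ x. G x \<partial>\<mu>)"

text \<open>The energy of (1 - t) \<mu> + t \<nu> cannot decrease at t = 0, and its derivative there
  is twice the right side minus twice \<open>robin \<mu>\<close>. An infinite mutual energy makes
  the claim trivial.\<close>

lemma minimizer_variation:
  assumes min: "minimizer \<mu>" and \<nu>: "prob_on \<Sigma> \<nu>" and fin: "riesz_energy s \<nu> < \<infinity>" "(\<integral>\<^sup>+ x. G x \<partial>\<nu>) < \<infinity>"
  shows "robin \<mu> \<le> mutual s \<mu> \<nu> + (\<integral>\<^sup>+ x. G x \<partial>\<nu>)"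
proof (cases "mutual s \<mu> \<nu>")
  case (real e)
  note \<mu> = minimizerD[OF min]
  note fb = prob_onD(1)[OF \<nu>]
  obtain \<gamma>' where \<gamma>': "(\<integral>\<^sup>+ x. G x \<partial>\<nu>) = ennreal \<gamma>'" "0 \<le> \<gamma>'" using fin(2) by (cases "\<integral>\<^sup>+ x. G x \<partial>\<nu>") auto
  obtain i' where i': "riesz_energy s \<nu> = ennreal i'" "0 \<le> i'" using fin(1) by (cases "riesz_energy s \<nu>") auto
  obtain i where i: "riesz_energy s \<mu> = ennreal i" "0 \<le> i" using \<mu>(4) by (cases "riesz_energy s \<mu>") auto
  obtain \<gamma> where \<gamma>: "(\<integral>\<^sup>+ x. G x \<partial>\<mu>) = ennreal \<gamma>" "0 \<le> \<gamma>" using \<mu>(5) by (cases "\<integral>\<^sup>+ x. G x \<partial>\<mu>") auto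
  have var: "i + 2 * \<gamma> \<le> (1 - t) * (1 - t) * i + 2 * (1 - t) * t * e + t * t * i' + 2 * ((1 - t) * \<gamma> + t * \<gamma>')"
    if t: "0 < t" "t < 1" for t
  proof -
    define a where "a = 1 - t"
    have a: "0 \<le> a" "a + t = 1" using t by (auto simp: a_def)
    define \<sigma> where "\<sigma> = mix (ennreal a) \<mu> (ennreal t) \<nu>"
    have "prob_on \<Sigma> \<sigma>"
    proof (rule prob_onI)
      show "fin_borel \<sigma>" unfolding \<sigma>_def by (intro fin_borel_mix \<mu> fb) auto
      show "emeasure \<sigma> UNIV = 1"
        using t a \<mu>(3) prob_onD(2)[OF \<nu>] by (simp add: \<sigma>_def emeasure_mix[OF \<mu>(2) fb] flip: ennreal_plus)
      show "emeasure \<sigma> (UNIV - \<Sigma>) = 0"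
        using prob_onD(4)[OF \<mu>(1)] prob_onD(4)[OF \<nu>] by (simp add: \<sigma>_def emeasure_mix[OF \<mu>(2) fb])
    qed
    then have "J \<mu> \<le> J \<sigma>" using min by (simp add: minimizer_def)
    moreover have "J \<sigma> = ennreal (a * a * i + 2 * a * t * e + t * t * i' + 2 * (a * \<gamma> + t * \<gamma>'))"
      unfolding \<sigma>_def J_mix[OF \<mu>(2) fb] using t a(1) i real i' \<gamma> \<gamma>' by (simp add: ennreal_plus ennreal_mult)
    moreover have "J \<mu> = ennreal (i + 2 * \<gamma>)"
      unfolding J_def using i \<gamma> by (simp add: ennreal_plus ennreal_mult)
    ultimately have "ennreal (i + 2 * \<gamma>)
        \<le> ennreal (a * a * i + 2 * a * t * e + t * t * i' + 2 * (a * \<gamma> + t * \<gamma>'))"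
      by (simp only:)
    then have "i + 2 * \<gamma> \<le> a * a * i + 2 * a * t * e + t * t * i' + 2 * (a * \<gamma> + t * \<gamma>')"
      using t a(1) i real i' \<gamma> \<gamma>' by (subst (asm) ennreal_le_iff) auto
    then show ?thesis by (simp add: a_def)
  qed
  have "i + \<gamma> \<le> e + \<gamma>'"
  proof (rule ccontr)
    \<comment> \<open>\<open>c\<close> bounds the coefficient of t^2, and \<open>t\<close> is then
      chosen so that the quadratic term cannot compensate the linear loss 2 D t.\<close>
    define D c where "D = i + \<gamma> - (e + \<gamma>')" and "c = \<bar>i - 2 * e + i'\<bar>"
    assume "\<not> ?thesis"
    then have D: "0 < D" by (simp add: D_def)
    define t where "t = min (1/2) (D / (c + 1))"
    have c: "0 \<le> c" by (simp add: c_def)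
    have t: "0 < t" "t < 1" using D c by (auto simp: t_def)
    have "i + 2 * \<gamma> \<le> i + 2 * \<gamma> + t * (t * (i - 2 * e + i') - 2 * D)"
      using var[OF t] by (simp add: D_def algebra_simps)
    then have "2 * D \<le> t * (i - 2 * e + i')" using t by (simp add: zero_le_mult_iff)
    also have "\<dots> \<le> t * (c + 1)" using t by (intro mult_left_mono) (auto simp: c_def)
    also have "\<dots> \<le> D / (c + 1) * (c + 1)" using c by (intro mult_right_mono) (auto simp: t_def)
    also have "\<dots> = D" using c by simp
    finally show False using D by simp
  qed
  then show ?thesis
    unfolding robin_def using i \<gamma> real \<gamma>' by (simp add: ennreal_leI flip: ennreal_plus)
qed simp

lemma robin_less_top: "minimizer \<mu> \<Longrightarrow> robin \<mu> < \<infinity>"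
  using minimizerD[of \<mu>] by (simp add: robin_def)

text \<open>Cheap measures near infinity bring the right side of \<open>minimizer_variation\<close>
  arbitrarily close to \<open>g\<close>.\<close>

lemma robin_le:
  assumes min: "minimizer \<mu>" shows "robin \<mu> \<le> ennreal g"
proof (rule ennreal_le_epsilon)
  fix e :: real assume e: "0 < e"
  then have e2: "0 < e / 2" by simp
  obtain \<nu> where \<nu>: "prob_on \<Sigma> \<nu>" "riesz_energy s \<nu> \<le> ennreal (e / 2)"
    "mutual s \<mu> \<nu> \<le> ennreal (e / 2)" "(\<integral>\<^sup>+ x. G x \<partial>\<nu>) \<le> ennreal (g + e / 2)"
    using ex_cheap_measure[OF minimizerD(2)[OF min] e2] by blast
  have "robin \<mu> \<le> mutual s \<mu> \<nu> + (\<integral>\<^sup>+ x. G x \<partial>\<nu>)"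
    using \<nu>(2,4) by (intro minimizer_variation min \<nu>(1)) (auto intro: le_less_trans)
  also have "\<dots> \<le> ennreal (e / 2) + ennreal (g + e / 2)" by (intro add_mono \<nu>)
  also have "\<dots> = ennreal g + ennreal e" using e g by (simp flip: ennreal_plus)
  finally show "robin \<mu> \<le> ennreal g + ennreal e" .
qed

text \<open>If the sum were at most some \<open>c < robin \<mu>\<close> on a set of positive mass,
  the normalised restriction of \<mu> to this set would violate \<open>minimizer_variation\<close>.
  So the sum is at least its own mean almost everywhere, and hence equal to it.\<close>

lemma minimizer_AE_le_robin:
  assumes min: "minimizer \<mu>"
  shows "AE x in \<mu>. potential s \<mu> x + G x \<le> robin \<mu>"
proof -
  note \<mu> = minimizerD[OF min]
  note sb = fin_borelD(2)[OF \<mu>(2)]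
  note [measurable] = potential_measurable[OF \<mu>(2)]
  have meas [measurable]: "(\<lambda>x. potential s \<mu> x + G x) \<in> borel_measurable \<mu>"
    by (simp add: measurable_fin_borel[OF \<mu>(2)])
  define f where "f = enn2real (robin \<mu>)"
  have f: "robin \<mu> = ennreal f" "0 \<le> f" using robin_less_top[OF min] by (auto simp: f_def)
  have null: "emeasure \<mu> {x. potential s \<mu> x + G x \<le> c} = 0" if c: "c < robin \<mu>" for c
  proof (rule ccontr)
    define A where "A = {x. potential s \<mu> x + G x \<le> c}"
    have Ab: "A \<in> sets borel" unfolding A_def by measurable
    assume "emeasure \<mu> {x. potential s \<mu> x + G x \<le> c} \<noteq> 0"
    then obtain a where a: "emeasure \<mu> A = ennreal a" "0 < a"
      using fin_borelD(5)[OF \<mu>(2), of A] by (cases "emeasure \<mu> A") (auto simp: A_def)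
    have rb: "fin_borel (restr \<mu> A)" by (intro fin_borel_restr \<mu> Ab)
    define \<nu> where "\<nu> = scale_measure (ennreal (1 / a)) (restr \<mu> A)"
    have fb: "fin_borel \<nu>" unfolding \<nu>_def by (intro fin_borel_scale rb) simp
    have \<nu>U: "emeasure \<nu> UNIV = 1"
      using a by (simp add: \<nu>_def emeasure_restr[OF \<mu>(2) Ab] flip: ennreal_mult)
    have \<nu>\<Sigma>: "prob_on \<Sigma> \<nu>"
    proof (rule prob_onI[OF fb \<nu>U])
      have "emeasure \<mu> (A \<inter> (UNIV - \<Sigma>)) \<le> emeasure \<mu> (UNIV - \<Sigma>)"
        by (intro emeasure_mono) (auto simp: sb)
      then show "emeasure \<nu> (UNIV - \<Sigma>) = 0"
        using prob_onD(4)[OF \<mu>(1)] by (simp add: \<nu>_def emeasure_restr[OF \<mu>(2) Ab])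
    qed
    have \<nu>A: "prob_on A \<nu>"
      by (rule prob_onI[OF fb \<nu>U]) (use Ab in \<open>simp add: \<nu>_def emeasure_restr[OF \<mu>(2) Ab, of "UNIV - A"]\<close>)
    have int: "(\<integral>\<^sup>+ x. h x \<partial>\<nu>) = ennreal (1 / a) * (\<integral>\<^sup>+ x. h x \<partial>restr \<mu> A)"
      if "h \<in> borel_measurable borel" for h
      unfolding \<nu>_def by (rule nn_integral_scale_measure) (use that in \<open>simp add: measurable_fin_borel[OF rb]\<close>)
    have "riesz_energy s \<nu> \<le> ennreal (1 / a) * ennreal (1 / a) * riesz_energy s \<mu>"
      unfolding \<nu>_def energy_scale[OF rb] by (intro mult_left_mono energy_restr_le \<mu> Ab) simp
    also have "\<dots> < \<infinity>" using \<mu>(4) by (simp add: ennreal_mult_less_top)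
    finally have e: "riesz_energy s \<nu> < \<infinity>" .
    have "(\<integral>\<^sup>+ x. G x \<partial>\<nu>) \<le> ennreal (1 / a) * (\<integral>\<^sup>+ x. G x \<partial>\<mu>)"
      by (subst int) (auto intro!: mult_left_mono nn_integral_restr_le \<mu> Ab)
    also have "\<dots> < \<infinity>" using \<mu>(5) by (simp add: ennreal_mult_less_top)
    finally have "robin \<mu> \<le> mutual s \<mu> \<nu> + (\<integral>\<^sup>+ x. G x \<partial>\<nu>)"
      by (intro minimizer_variation min \<nu>\<Sigma> e)
    also have "\<dots> = (\<integral>\<^sup>+ x. potential s \<mu> x + G x \<partial>\<nu>)"
      unfolding mutual_def by (rule nn_integral_add[symmetric]) (simp_all add: measurable_fin_borel[OF fb])
    also have "\<dots> \<le> c" by (rule nn_integral_le_of_prob_on[OF \<nu>A Ab]) (simp add: A_def)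
    finally show False using c by simp
  qed
  \<comment> \<open>Countably many levels exhaust the values below \<open>robin \<mu>\<close>. The
    guard covers f = 0, where \<open>ennreal\<close> sends every negative level to 0.\<close>
  have "AE x in \<mu>. \<forall>n. \<not> (ennreal (f - 1 / real (Suc n)) < robin \<mu> \<and> potential s \<mu> x + G x \<le> ennreal (f - 1 / real (Suc n)))"
    unfolding AE_all_countable
  proof
    fix n
    show "AE x in \<mu>. \<not> (ennreal (f - 1 / real (Suc n)) < robin \<mu> \<and> potential s \<mu> x + G x \<le> ennreal (f - 1 / real (Suc n)))"
    proof (cases "ennreal (f - 1 / real (Suc n)) < robin \<mu>")
      case True
      have "{x. potential s \<mu> x + G x \<le> ennreal (f - 1 / real (Suc n))} \<in> null_sets \<mu>"
        using null[OF True] by (auto simp: null_sets_def sb)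
      then show ?thesis by (rule AE_I') auto
    qed simp
  qed
  then have ge: "AE x in \<mu>. robin \<mu> \<le> potential s \<mu> x + G x"
  proof eventually_elim
    case (elim x)
    show ?case
    proof (rule ccontr)
      assume n: "\<not> ?thesis"
      then obtain u where u: "potential s \<mu> x + G x = ennreal u" "0 \<le> u" "u < f"
        using f by (cases "potential s \<mu> x + G x") (auto simp: not_le ennreal_less_iff)
      then obtain k where "inverse (real (Suc k)) < f - u" using reals_Archimedean[of "f - u"] by auto
      then have k: "1 / real (Suc k) < f - u" by (simp add: inverse_eq_divide)
      have "f - 1 / real (Suc k) < f" by simp
      then have "ennreal (f - 1 / real (Suc k)) < robin \<mu>" using u f by (subst f(1), intro ennreal_lessI) auto
      moreover have "potential s \<mu> x + G x \<le> ennreal (f - 1 / real (Suc k))"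
        unfolding u(1) using k by (intro ennreal_leI) simp
      ultimately show False using elim by blast
    qed
  qed
  have "(\<integral>\<^sup>+ x. potential s \<mu> x + G x - robin \<mu> \<partial>\<mu>)
      = (\<integral>\<^sup>+ x. potential s \<mu> x + G x \<partial>\<mu>) - (\<integral>\<^sup>+ x. robin \<mu> \<partial>\<mu>)"
    by (rule nn_integral_diff) (use ge meas \<mu>(3) robin_less_top[OF min] in \<open>auto simp: fin_borelD(3)[OF \<mu>(2)]\<close>)
  also have "(\<integral>\<^sup>+ x. potential s \<mu> x + G x \<partial>\<mu>) = robin \<mu>"
    unfolding robin_def riesz_energy_mutual mutual_def
    by (rule nn_integral_add) (simp_all add: measurable_fin_borel[OF \<mu>(2)])
  also have "(\<integral>\<^sup>+ x. robin \<mu> \<partial>\<mu>) = robin \<mu>" using \<mu>(3) by (simp add: fin_borelD(3)[OF \<mu>(2)])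
  also have "robin \<mu> - robin \<mu> = 0" using robin_less_top[OF min] by simp
  finally have "AE x in \<mu>. potential s \<mu> x + G x - robin \<mu> = 0"
    by (subst (asm) nn_integral_0_iff_AE) auto
  then show ?thesis by eventually_elim (rule ennreal_minus_eq_0)
qed

lemma minimizer_AE_in: "minimizer \<mu> \<Longrightarrow> AE x in \<mu>. x \<in> \<Sigma>"
  using minimizerD[of \<mu>] by (intro AE_in_support \<Sigma>_borel prob_onD(4)) auto

lemma AE_norm_less_imp_bounded_msupport:
  assumes \<mu>: "fin_borel \<mu>" and AE: "AE x in \<mu>. norm x < R"
  shows "bounded (msupport \<mu>)"
proof (rule boundedI[of _ R])
  fix x assume x: "x \<in> msupport \<mu>"
  show "norm x \<le> R"
  proof (rule ccontr)
    assume n: "\<not> norm x \<le> R"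
    have "emeasure \<mu> (ball x (norm x - R)) = (\<integral>\<^sup>+ t. indicator (ball x (norm x - R)) t \<partial>\<mu>)"
      by (simp add: fin_borelD(2)[OF \<mu>])
    also have "\<dots> = (\<integral>\<^sup>+ t. 0 \<partial>\<mu>)"
    proof (rule nn_integral_cong_AE)
      show "AE t in \<mu>. indicator (ball x (norm x - R)) t = (0::ennreal)"
        using AE
      proof eventually_elim
        case (elim t)
        then show ?case using norm_triangle_ineq2[of x t] by (auto simp: indicator_def dist_norm)
      qed
    qed
    finally have "emeasure \<mu> (ball x (norm x - R)) = 0" by simp
    moreover have "emeasure \<mu> (ball x (norm x - R)) > 0"
      using x n unfolding msupport_def by (simp only: mem_Collect_eq)
    ultimately show False by simp
  qed
qed

text \<open>Excludes a limit above -1 when the support is unbounded. Far out the potential is at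
  least (1 - \<delta>/2) |x|^-s, which lifts its sum with \<open>G\<close> strictly above
  \<open>g\<close>, whereas almost everywhere the sum is at most \<open>robin \<mu>\<close>, hence
  at most \<open>g\<close>.\<close>

lemma bounded_msupport_minimizer:
  assumes min: "minimizer \<mu>" and \<delta>: "0 < \<delta>" "\<delta> < 1"
    and ge: "\<And>x. x \<in> \<Sigma> \<Longrightarrow> R \<le> norm x \<Longrightarrow> ennreal g \<le> G x + ennreal ((1 - \<delta>) * norm x powr (- s))"
  shows "bounded (msupport \<mu>)"
proof -
  note \<mu> = minimizerD[OF min]
  have d: "0 < \<delta> / 2" "\<delta> / 2 < 1" using \<delta> by auto
  obtain R' where R': "0 < R'" "\<And>x. R' \<le> norm x \<Longrightarrow> ennreal ((1 - \<delta> / 2) * norm x powr (- s)) \<le> potential s \<mu> x"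
    using potential_ge_at_infinity[OF s \<mu>(2,3) d] by metis
  have "AE x in \<mu>. norm x < max R R'"
    using minimizer_AE_le_robin[OF min] minimizer_AE_in[OF min]
  proof eventually_elim
    case (elim x)
    show ?case
    proof (rule ccontr)
      let ?p = "norm x powr (- s)"
      assume "\<not> ?thesis"
      then have x: "R \<le> norm x" "R' \<le> norm x" by auto
      then have p: "0 < ?p" using R' by auto
      have "potential s \<mu> x + G x \<le> ennreal g" using elim(1) robin_le[OF min] by (rule order_trans)
      then obtain y where y: "G x = ennreal y" "0 \<le> y" by (cases "G x") (auto simp: top_unique)
      have "G x + ennreal ((1 - \<delta> / 2) * ?p) \<le> potential s \<mu> x + G x"
        using R'(2)[OF x(2)] by (subst add.commute) (rule add_right_mono)
      also have "\<dots> \<le> ennreal g" by fact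
      also have "\<dots> \<le> G x + ennreal ((1 - \<delta>) * ?p)" by (rule ge[OF elim(2) x(1)])
      finally have "y + (1 - \<delta> / 2) * ?p \<le> y + (1 - \<delta>) * ?p"
        using y \<delta> by (simp flip: ennreal_plus)
      then have "\<delta> * ?p \<le> 0" by (simp add: algebra_simps)
      then show False using \<delta> p by (simp add: mult_le_0_iff)
    qed
  qed
  then show ?thesis by (rule AE_norm_less_imp_bounded_msupport[OF \<mu>(2)])
qed

text \<open>An unbounded support leaves positive mass where \<open>G\<close> is at least g - e, and
  almost everywhere \<open>G\<close> is at most \<open>robin \<mu>\<close>.\<close>

lemma robin_ge:
  assumes min: "minimizer \<mu>" and un: "\<not> bounded (msupport \<mu>)"
  shows "ennreal g \<le> robin \<mu>"
proof (rule ennreal_le_epsilon)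
  fix e :: real assume e: "0 < e"
  note \<mu> = minimizerD[OF min]
  obtain R where R: "\<forall>x\<in>\<Sigma>. R \<le> norm x \<longrightarrow> ennreal (g - e) \<le> G x \<and> G x \<le> ennreal (g + e)"
    using G_infinity[OF e] by blast
  have "\<not> (AE x in \<mu>. norm x < R)"
    using AE_norm_less_imp_bounded_msupport[OF \<mu>(2)] un by blast
  moreover have "AE x in \<mu>. norm x < R" if "\<not> (ennreal (g - e) \<le> robin \<mu>)"
    using minimizer_AE_le_robin[OF min] minimizer_AE_in[OF min]
  proof eventually_elim
    case (elim x)
    show ?case
    proof (rule ccontr)
      assume "\<not> ?thesis"
      then have "ennreal (g - e) \<le> G x" using R elim(2) by auto
      also have "\<dots> \<le> potential s \<mu> x + G x" by simp
      also have "\<dots> \<le> robin \<mu>" by (rule elim(1))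
      finally show False using that by simp
    qed
  qed
  ultimately have "ennreal (g - e) \<le> robin \<mu>" by blast
  moreover have "ennreal g \<le> ennreal (g - e) + ennreal e"
    using e by (cases "0 \<le> g - e") (auto simp: ennreal_neg intro: ennreal_leI simp flip: ennreal_plus)
  ultimately show "ennreal g \<le> robin \<mu> + ennreal e" by (meson add_right_mono order_trans)
qed

text \<open>Excludes a limit below -1. Of the surplus 2 \<eta>, one part pays for the potential of a
  test measure far out; the other makes the mean of potential plus field smaller than
  \<open>g\<close>, against \<open>robin_ge\<close>.\<close>

lemma unbounded_msupport_minimizer_contradiction:
  assumes min: "minimizer \<mu>" and un: "\<not> bounded (msupport \<mu>)" and \<eta>: "0 < \<eta>"
    and le: "\<And>x. x \<in> \<Sigma> \<Longrightarrow> R \<le> norm x \<Longrightarrow> G x + ennreal ((1 + 2 * \<eta>) * norm x powr (- s)) \<le> ennreal g"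
  shows False
proof -
  note \<mu> = minimizerD[OF min]
  obtain K \<nu> where K: "compact K" "K \<subseteq> \<Sigma> - {}" "prob_on K \<nu>" "prob_on \<Sigma> \<nu>" "riesz_energy s \<nu> \<le> ennreal \<eta>"
    "\<And>x. x \<in> K \<Longrightarrow> max R 1 \<le> norm x"
    "\<And>x. x \<in> K \<Longrightarrow> potential s \<mu> x \<le> (emeasure \<mu> UNIV + ennreal \<eta>) * ennreal (norm x powr (- s))"
    by (rule ex_test_measure[OF sets.empty_sets thin_empty \<mu>(2) \<eta> \<eta>]) (rule that)
  have Kb: "K \<in> sets borel" using K by (simp add: compact_imp_closed)
  note fb = prob_onD(1)[OF K(4)]
  have "1 \<le> norm x" if "x \<in> K" for x using K(6)[OF that] by simp
  then obtain \<kappa> where \<kappa>: "0 < \<kappa>" "\<And>x. x \<in> K \<Longrightarrow> \<kappa> \<le> norm x powr (- s)"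
    using compact_imp_norm_powr_minus_ge[OF s K(1)] by metis
  have "(\<integral>\<^sup>+ x. potential s \<mu> x + G x + ennreal (\<eta> * \<kappa>) \<partial>\<nu>) \<le> ennreal g"
  proof (rule nn_integral_le_of_prob_on[OF K(3) Kb])
    fix x assume x: "x \<in> K"
    let ?p = "norm x powr (- s)"
    have "\<eta> * \<kappa> \<le> \<eta> * ?p" using \<kappa>(2)[OF x] \<eta> by (intro mult_left_mono) auto
    then have "potential s \<mu> x + G x + ennreal (\<eta> * \<kappa>)
        \<le> ennreal ((1 + \<eta>) * ?p) + G x + ennreal (\<eta> * ?p)"
      using K(7)[OF x] \<mu>(3) \<eta> by (intro add_mono ennreal_leI) (simp_all add: ennreal_mult ennreal_plus)
    also have "\<dots> = G x + ennreal ((1 + \<eta>) * ?p + \<eta> * ?p)"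
      using \<eta> by (simp add: ennreal_plus ac_simps)
    also have "(1 + \<eta>) * ?p + \<eta> * ?p = (1 + 2 * \<eta>) * ?p" by (simp add: algebra_simps)
    also have "G x + ennreal ((1 + 2 * \<eta>) * ?p) \<le> ennreal g" using le[of x] K(2) K(6)[OF x] x by auto
    finally show "potential s \<mu> x + G x + ennreal (\<eta> * \<kappa>) \<le> ennreal g" .
  qed
  then have a: "mutual s \<mu> \<nu> + (\<integral>\<^sup>+ x. G x \<partial>\<nu>) + ennreal (\<eta> * \<kappa>) \<le> ennreal g"
    by (simp only: nn_integral_potential_field[OF \<mu>(2) K(4)])
  have "(\<integral>\<^sup>+ x. G x \<partial>\<nu>) < \<infinity>" using a by (cases "\<integral>\<^sup>+ x. G x \<partial>\<nu>") (auto simp: top_unique)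
  then have "robin \<mu> \<le> mutual s \<mu> \<nu> + (\<integral>\<^sup>+ x. G x \<partial>\<nu>)"
    using K(5) by (intro minimizer_variation min K(4)) (auto intro: le_less_trans)
  then have "ennreal g + ennreal (\<eta> * \<kappa>) \<le> ennreal g"
    using robin_ge[OF min un] a by (meson add_right_mono order_trans)
  then have "g + \<eta> * \<kappa> \<le> g" using g \<eta> \<kappa> by (simp flip: ennreal_plus)
  then show False using \<eta> \<kappa> by (simp add: mult_le_0_iff)
qed

lemma no_minimizer:
  assumes s2: "real DIM('a) - 2 \<le> s" and c: "0 \<le> c" "c < 1"
    and ge: "\<And>x. x \<in> \<Sigma> \<Longrightarrow> x \<noteq> 0 \<Longrightarrow> ennreal g \<le> G x + ennreal (c * norm x powr (- s))"
  shows "\<not> minimizer \<mu>"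
proof
  assume min: "minimizer \<mu>"
  note \<mu> = minimizerD[OF min]
  have "AE x in \<mu>. x \<noteq> 0 \<longrightarrow> potential s \<mu> x \<le> ennreal (c * norm x powr (- s))"
    using minimizer_AE_le_robin[OF min] minimizer_AE_in[OF min]
  proof eventually_elim
    case (elim x)
    show ?case
    proof
      assume "x \<noteq> 0"
      have "potential s \<mu> x + G x \<le> ennreal g" using elim(1) robin_le[OF min] by (rule order_trans)
      moreover from this have "G x \<noteq> \<infinity>" by (auto simp: top_unique)
      moreover have "ennreal g \<le> ennreal (c * norm x powr (- s)) + G x"
        using ge[OF elim(2) \<open>x \<noteq> 0\<close>] by (simp add: add.commute)
      ultimately have "G x + potential s \<mu> x \<le> G x + ennreal (c * norm x powr (- s))"
        by (simp only: add.commute[of "G x"])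
      then show "potential s \<mu> x \<le> ennreal (c * norm x powr (- s))"
        using \<open>G x \<noteq> \<infinity>\<close> by (simp add: ennreal_add_left_cancel_le)
    qed
  qed
  \<comment> \<open>The inversion does not see the origin, but an atom there would have infinite
    energy.\<close>
  moreover have "emeasure \<mu> {0} = 0"
  proof (rule ccontr)
    assume n: "emeasure \<mu> {0} \<noteq> 0"
    have sb: "{0::'a} \<in> sets \<mu>" by (simp add: fin_borelD(2)[OF \<mu>(2)])
    have "\<infinity> * emeasure \<mu> {0} * emeasure \<mu> {0}
        = (\<integral>\<^sup>+ x. \<infinity> * emeasure \<mu> {0} * indicator {0} x \<partial>\<mu>)"
      using sb by (simp add: nn_integral_cmult_indicator)
    also have "\<dots> \<le> (\<integral>\<^sup>+ x. potential s \<mu> x \<partial>\<mu>)"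
    proof (rule nn_integral_mono)
      fix x :: 'a
      have "\<infinity> * emeasure \<mu> {0} = (\<integral>\<^sup>+ t. \<infinity> * indicator {0} t \<partial>\<mu>)"
        using sb by (simp add: nn_integral_cmult_indicator)
      also have "\<dots> \<le> potential s \<mu> 0"
        unfolding potential_def by (intro nn_integral_mono) (auto simp: riesz_kernel_def indicator_def)
      finally show "\<infinity> * emeasure \<mu> {0} * indicator {0} x \<le> potential s \<mu> x"
        by (auto simp: indicator_def)
    qed
    also have "\<dots> = riesz_energy s \<mu>" by (simp add: riesz_energy_mutual mutual_def)
    finally show False using n \<mu>(4) by (simp add: ennreal_top_mult top_unique)
  qed
  ultimately have "emeasure \<mu> UNIV \<le> ennreal c"
    by (rule potential_le_point_mass_imp_mass_le[OF s s2 \<mu>(2) _ c(1), rotated])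
  then show False using \<mu>(3) c by (simp add: ennreal_le_1 flip: ennreal_1)
qed

end

section \<open>Translation between the shifted field and the original one\<close>

lemma eventually_at_inf_within:
  "eventually P (at_inf_within S) \<longleftrightarrow> (\<exists>R. \<forall>x\<in>S. R \<le> norm x \<longrightarrow> P x)"
  unfolding eventually_inf_principal eventually_at_infinity by blast

text \<open>\<open>e2ennreal\<close> sends negative values to 0 and subtraction in
  \<open>ennreal\<close> is truncated, so both sides are the positive, respectively negative, part
  of \<open>q\<close>, also for infinite \<open>q\<close>.\<close>

lemma e2ennreal_shift_parts:
  assumes "0 \<le> B" "ereal (- B) \<le> q"
  shows "e2ennreal q = e2ennreal (q + ereal B) - ennreal B"
    "e2ennreal (- q) = ennreal B - e2ennreal (q + ereal B)"
proof -
  show "e2ennreal q = e2ennreal (q + ereal B) - ennreal B"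
    using assms by (cases q) (simp_all add: ennreal_minus e2ennreal_neg)
  show "e2ennreal (- q) = ennreal B - e2ennreal (q + ereal B)"
    using assms by (cases q) (simp_all add: ennreal_minus e2ennreal_neg)
qed

text \<open>Under a probability measure the shift changes the field integral by \<open>B\<close> and
  the energy by \<open>2 * B\<close>. The negative part of \<open>Q\<close> is at most
  \<open>B\<close>, so \<open>field_integral\<close> never subtracts infinity from infinity.\<close>

lemma weighted_energy_eq_J:
  assumes "riesz_field s g \<Sigma> G" and G: "\<And>x. G x = (if x \<in> \<Sigma> then e2ennreal (Q x + ereal B) else 0)"
    and B: "0 \<le> B" "\<And>x. x \<in> \<Sigma> \<Longrightarrow> ereal (- B) \<le> Q x" and \<sigma>: "prob_on \<Sigma> \<sigma>"
  shows "weighted_energy s \<Sigma> Q \<sigma> = enn2ereal (riesz_field.J s G \<sigma>) + ereal (- 2 * B)"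
proof -
  interpret riesz_field s g \<Sigma> G by fact
  note fb = prob_onD(1)[OF \<sigma>]
  note sb = fin_borelD(2)[OF fb]
  have [measurable]: "G \<in> borel_measurable \<sigma>" "\<Sigma> \<in> sets \<sigma>"
    by (simp_all add: measurable_fin_borel[OF fb] sb)
  define p n where "p x = G x - ennreal B" and "n x = (ennreal B - G x) * indicator \<Sigma> x" for x
  have pn: "e2ennreal (if x \<in> \<Sigma> then Q x else 0) = p x" "e2ennreal (if x \<in> \<Sigma> then - Q x else 0) = n x" for x
    using e2ennreal_shift_parts[OF B, of x] by (auto simp: p_def n_def G indicator_def)
  have [measurable]: "p \<in> borel_measurable \<sigma>" "n \<in> borel_measurable \<sigma>"
    unfolding p_def n_def by measurable
  have const: "(\<integral>\<^sup>+ x. ennreal B \<partial>\<sigma>) = ennreal B"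
    using prob_onD(2)[OF \<sigma>] by (simp add: fin_borelD(3)[OF fb])
  have "(\<integral>\<^sup>+ x. n x \<partial>\<sigma>) \<le> (\<integral>\<^sup>+ x. ennreal B \<partial>\<sigma>)"
    by (intro nn_integral_mono) (auto simp: n_def indicator_def)
  then have "(\<integral>\<^sup>+ x. n x \<partial>\<sigma>) < \<infinity>" unfolding const by (rule le_less_trans) simp
  then obtain N where N: "(\<integral>\<^sup>+ x. n x \<partial>\<sigma>) = ennreal N" "0 \<le> N" by (cases "\<integral>\<^sup>+ x. n x \<partial>\<sigma>") auto
  have eq: "(\<integral>\<^sup>+ x. p x \<partial>\<sigma>) + ennreal B = (\<integral>\<^sup>+ x. G x \<partial>\<sigma>) + ennreal N"
  proof -
    \<comment> \<open>Since subtraction is truncated, both sides are the maximum of \<open>u\<close>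
      and \<open>ennreal B\<close>.\<close>
    have pt: "u - ennreal B + ennreal B = u + (ennreal B - u)" for u
    proof (cases u)
      case (real y)
      then show ?thesis
        using B(1) by (cases "y \<le> B") (auto simp: ennreal_minus ennreal_neg simp flip: ennreal_plus)
    qed simp
    have "(\<integral>\<^sup>+ x. p x + ennreal B \<partial>\<sigma>) = (\<integral>\<^sup>+ x. G x + n x \<partial>\<sigma>)"
      using AE_in_support[OF fb \<Sigma>_borel prob_onD(4)[OF \<sigma>]]
      by (intro nn_integral_cong_AE) (auto simp: p_def n_def pt elim!: eventually_mono)
    then show ?thesis using const by (simp add: nn_integral_add N)
  qed
  have FI: "field_integral \<Sigma> Q \<sigma> = enn2ereal (\<integral>\<^sup>+ x. G x \<partial>\<sigma>) - ereal B"
  proof (cases "\<integral>\<^sup>+ x. G x \<partial>\<sigma>")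
    case (real \<gamma>)
    have "(\<integral>\<^sup>+ x. p x \<partial>\<sigma>) + ennreal B < \<infinity>" unfolding eq real(2) by simp
    then obtain p' where p': "(\<integral>\<^sup>+ x. p x \<partial>\<sigma>) = ennreal p'" "0 \<le> p'" by (cases "\<integral>\<^sup>+ x. p x \<partial>\<sigma>") auto
    have "p' + B = \<gamma> + N" using eq real p' N B by (simp flip: ennreal_plus)
    then show ?thesis unfolding field_integral_def pn using real p' N by (simp add: enn2ereal_ennreal)
  next
    case top
    then have "(\<integral>\<^sup>+ x. p x \<partial>\<sigma>) = \<infinity>" using eq by (cases "\<integral>\<^sup>+ x. p x \<partial>\<sigma>") (auto simp flip: ennreal_plus)
    then show ?thesis unfolding field_integral_def pn using top N by (simp add: enn2ereal_ennreal)
  qed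
  show ?thesis
  proof (cases "\<integral>\<^sup>+ x. G x \<partial>\<sigma>"; cases "riesz_energy s \<sigma>")
    fix \<gamma> i assume *: "0 \<le> \<gamma>" "(\<integral>\<^sup>+ x. G x \<partial>\<sigma>) = ennreal \<gamma>" "0 \<le> i" "riesz_energy s \<sigma> = ennreal i"
    then have "J \<sigma> = ennreal (i + 2 * \<gamma>)" by (simp add: J_def ennreal_plus ennreal_mult)
    then have "enn2ereal (J \<sigma>) = ereal (i + 2 * \<gamma>)" using * by (simp add: enn2ereal_ennreal del: ennreal_plus)
    then show ?thesis using * by (simp add: weighted_energy_def FI enn2ereal_ennreal)
  qed (simp_all add: weighted_energy_def FI J_def enn2ereal_ennreal ennreal_top_mult ennreal_mult_top)
qed

theorem theorem2p4:
  fixes \<Sigma> :: "'a::euclidean_space set" and Q :: "'a \<Rightarrow> ereal" and s Qinf :: real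
  assumes d2: "DIM('a) \<ge> 2"
    and s_pos: "0 < s" and s_lt: "s < real DIM('a)"
    and closed: "closed \<Sigma>" and unbdd: "\<not> bounded \<Sigma>"
    and field: "external_field s \<Sigma> Q"
    and A1: "\<not> thin_at_infinity s \<Sigma>"
    and A2: "(Q \<longlongrightarrow> ereal Qinf) (at_inf_within \<Sigma>)"
  shows
    "(((\<forall>\<^sub>F x in at_inf_within \<Sigma>. ereal (norm x powr s) * (Q x - ereal Qinf) \<le> -1)
      \<or> (\<exists>P L. P \<in> sets borel \<and> thin_at_infinity s P \<and> L \<le> -1 \<and>
            ((\<lambda>x. ereal (norm x powr s) * (Q x - ereal Qinf)) \<longlongrightarrow> L) (at_inf_within (\<Sigma> - P))))
     \<longrightarrow> (\<exists>\<mu>. is_solution s \<Sigma> Q \<mu>))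
    \<and> (\<forall>L \<mu>. ((\<lambda>x. ereal (norm x powr s) * (Q x - ereal Qinf)) \<longlongrightarrow> L) (at_inf_within \<Sigma>)
      \<longrightarrow> is_solution s \<Sigma> Q \<mu> \<longrightarrow> \<not> bounded (msupport \<mu>) \<longrightarrow> L = -1)
    \<and> (real DIM('a) - 2 \<le> s \<longrightarrow>
      (\<exists>c<1. \<forall>x\<in>\<Sigma>. - ereal c \<le> ereal (norm x powr s) * (Q x - ereal Qinf))
      \<longrightarrow> \<not> (\<exists>\<mu>. is_solution s \<Sigma> Q \<mu>))"
proof -
  obtain b where b: "\<And>x. x \<in> \<Sigma> \<Longrightarrow> ereal b \<le> Q x" and lsc: "lsc_on \<Sigma> Q"
    using field by (auto simp: external_field_def)
  \<comment> \<open>Makes \<open>Q + B\<close> nonnegative on \<Sigma>. The maximum with 0 keeps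
    \<open>ennreal B\<close> from clipping.\<close>
  define B where "B = max 0 (- b)"
  have B: "0 \<le> B" by (simp add: B_def)
  have QB: "ereal (- B) \<le> Q x" if "x \<in> \<Sigma>" for x
    using b[OF that] by (rule order_trans[rotated]) (simp add: B_def)
  define g where "g = Qinf + B"
  define G where "G x = (if x \<in> \<Sigma> then e2ennreal (Q x + ereal B) else 0)" for x
  have near: "\<exists>R. \<forall>x\<in>\<Sigma>. R \<le> norm x \<longrightarrow> (\<exists>y. Q x = ereal y \<and> \<bar>y - Qinf\<bar> < \<epsilon>)" if \<epsilon>: "0 < \<epsilon>" for \<epsilon>
  proof -
    have "\<forall>\<^sub>F x in at_inf_within \<Sigma>. ereal (Qinf - \<epsilon>) < Q x" "\<forall>\<^sub>F x in at_inf_within \<Sigma>. Q x < ereal (Qinf + \<epsilon>)"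
      using A2 \<epsilon> by (auto intro: order_tendstoD)
    then have "\<forall>\<^sub>F x in at_inf_within \<Sigma>. \<exists>y. Q x = ereal y \<and> \<bar>y - Qinf\<bar> < \<epsilon>"
    proof eventually_elim
      case (elim x)
      then show ?case by (cases "Q x") auto
    qed
    then show ?thesis by (simp add: eventually_at_inf_within)
  qed
  \<comment> \<open>\<Sigma> is unbounded, so values of \<open>Q\<close> near \<open>Qinf\<close>
    occur, and they are at least \<open>- B\<close>.\<close>
  have g: "0 \<le> g"
  proof (rule field_le_epsilon)
    fix \<epsilon> :: real assume "0 < \<epsilon>"
    from near[OF this] obtain R where R: "\<forall>x\<in>\<Sigma>. R \<le> norm x \<longrightarrow> (\<exists>y. Q x = ereal y \<and> \<bar>y - Qinf\<bar> < \<epsilon>)" by blast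
    obtain x where "x \<in> \<Sigma>" "R \<le> norm x" using unbdd by (auto simp: bounded_iff not_le intro: less_imp_le)
    then show "0 \<le> g + \<epsilon>" using R QB[of x] by (force simp: g_def)
  qed
  have rf: "riesz_field s g \<Sigma> G"
  proof
    show "\<exists>e>0. \<forall>z\<in>\<Sigma>. dist z x < e \<longrightarrow> y < G z" if x: "x \<in> \<Sigma>" and y: "y < G x" for x y
    proof -
      obtain r where r: "y = ennreal r" "0 \<le> r" using y by (cases y) auto
      have iff: "y < G z \<longleftrightarrow> ereal (r - B) < Q z" if "z \<in> \<Sigma>" for z
        using that QB[OF that] r by (cases "Q z") (auto simp: G_def ennreal_less_iff)
      obtain e where "e > 0" "\<forall>z\<in>\<Sigma>. dist z x < e \<longrightarrow> ereal (r - B) < Q z"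
        using lsc x y unfolding lsc_on_def iff[OF x] by blast
      then show ?thesis using iff by blast
    qed
    show "\<exists>R. \<forall>x\<in>\<Sigma>. R \<le> norm x \<longrightarrow> ennreal (g - \<epsilon>) \<le> G x \<and> G x \<le> ennreal (g + \<epsilon>)" if "0 < \<epsilon>" for \<epsilon>
    proof -
      from near[OF that] obtain R where R: "\<forall>x\<in>\<Sigma>. R \<le> norm x \<longrightarrow> (\<exists>y. Q x = ereal y \<and> \<bar>y - Qinf\<bar> < \<epsilon>)" by blast
      show ?thesis
      proof (intro exI[of _ R] ballI impI)
        fix x assume x: "x \<in> \<Sigma>" "R \<le> norm x"
        with R obtain y where y: "Q x = ereal y" "\<bar>y - Qinf\<bar> < \<epsilon>" by blast
        then show "ennreal (g - \<epsilon>) \<le> G x \<and> G x \<le> ennreal (g + \<epsilon>)"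
          using x by (auto simp: G_def g_def intro!: ennreal_leI)
      qed
    qed
  qed (use s_pos closed A1 g in \<open>auto simp: G_def\<close>)
  then interpret riesz_field s g \<Sigma> G .
  have sol: "is_solution s \<Sigma> Q \<mu> \<longleftrightarrow> minimizer \<mu>" for \<mu>
  proof -
    have "weighted_energy s \<Sigma> Q \<mu> \<le> weighted_energy s \<Sigma> Q \<sigma> \<longleftrightarrow> J \<mu> \<le> J \<sigma>"
      if "prob_on \<Sigma> \<mu>" "prob_on \<Sigma> \<sigma>" for \<sigma>
      using weighted_energy_eq_J[OF rf G_def B QB that(1)] weighted_energy_eq_J[OF rf G_def B QB that(2)]
      by (cases "J \<mu>"; cases "J \<sigma>") (auto simp: enn2ereal_ennreal top_unique)
    then show ?thesis unfolding is_solution_def minimizer_def by blast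
  qed
  define q where "q = (\<lambda>x. ereal (norm x powr s) * (Q x - ereal Qinf))"
  \<comment> \<open>The origin is excluded: \<open>norm x powr s\<close> vanishes there, so
    \<open>q\<close> carries no information about the field at 0.\<close>
  have upper: "G x + ennreal (r * norm x powr (- s)) \<le> ennreal g"
    if h: "x \<in> \<Sigma>" "x \<noteq> 0" "0 \<le> r" "q x \<le> ereal (- r)" for x r
  proof -
    define t where "t = norm x powr s"
    have t: "0 < t" "norm x powr (- s) = 1 / t" using h(2) by (simp_all add: t_def powr_minus divide_inverse)
    obtain y where y: "Q x = ereal y"
      using h(4) QB[OF h(1)] t(1) unfolding q_def t_def[symmetric] by (cases "Q x") auto
    have "t * (y - Qinf) \<le> - r" using h(4) by (simp add: q_def y t_def)
    then have "y + r / t \<le> Qinf" using t(1) by (simp add: field_simps)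
    moreover have "0 \<le> y + B" using QB[OF h(1)] by (simp add: y)
    ultimately show ?thesis
      using h(1,3) t by (simp add: G_def y g_def ennreal_leI flip: ennreal_plus)
  qed
  have lower: "ennreal g \<le> G x + ennreal (r * norm x powr (- s))"
    if h: "x \<in> \<Sigma>" "x \<noteq> 0" "0 \<le> r" "ereal (- r) \<le> q x" for x r
  proof (cases "Q x")
    case (real y)
    define t where "t = norm x powr s"
    have t: "0 < t" "norm x powr (- s) = 1 / t" using h(2) by (simp_all add: t_def powr_minus divide_inverse)
    have "- r \<le> t * (y - Qinf)" using h(4) by (simp add: q_def real t_def)
    then have "Qinf \<le> y + r / t" using t(1) by (simp add: field_simps)
    moreover have "0 \<le> y + B" using QB[OF h(1)] by (simp add: real)
    ultimately show ?thesis
      using h(1,3) t by (simp add: G_def real g_def ennreal_leI flip: ennreal_plus)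
  next
    case PInf
    then show ?thesis using h(1) by (simp add: G_def)
  next
    case MInf
    then show ?thesis using QB[OF h(1)] by simp
  qed
  \<comment> \<open>The common form of the two alternatives in (i): a bound by -1 and a limit of at
    most -1 both give \<open>q x \<le> - r\<close> far out for every r < 1.\<close>
  have part1: "\<exists>\<mu>. minimizer \<mu>"
    if P: "P \<in> sets borel" "thin_at_infinity s P"
      and ev: "\<And>r. 0 \<le> r \<Longrightarrow> r < 1 \<Longrightarrow> \<forall>\<^sub>F x in at_inf_within (\<Sigma> - P). q x \<le> ereal (- r)" for P
  proof (rule ex_minimizer[OF P])
    fix \<delta> :: real assume \<delta>: "0 < \<delta>"
    \<comment> \<open>For \<delta> >= 1 the coefficient 1 - \<delta> is not positive, and r = 0
      dominates it.\<close>
    define r where "r = max 0 (1 - \<delta>)"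
    have r: "0 \<le> r" "r < 1" using \<delta> by (auto simp: r_def)
    obtain R where R: "\<forall>x\<in>\<Sigma> - P. R \<le> norm x \<longrightarrow> q x \<le> ereal (- r)"
      using ev[OF r] by (auto simp: eventually_at_inf_within)
    show "\<exists>R. \<forall>x\<in>\<Sigma> - P. R \<le> norm x \<longrightarrow> G x + ennreal ((1 - \<delta>) * norm x powr (- s)) \<le> ennreal g"
    proof (intro exI[of _ "max R 1"] ballI impI)
      fix x assume x: "x \<in> \<Sigma> - P" "max R 1 \<le> norm x"
      have "G x + ennreal ((1 - \<delta>) * norm x powr (- s)) \<le> G x + ennreal (r * norm x powr (- s))"
        by (intro add_left_mono ennreal_leI mult_right_mono) (simp_all add: r_def)
      also have "\<dots> \<le> ennreal g" using x R r by (intro upper) auto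
      finally show "G x + ennreal ((1 - \<delta>) * norm x powr (- s)) \<le> ennreal g" .
    qed
  qed
  have i: "\<exists>\<mu>. is_solution s \<Sigma> Q \<mu>"
    if h: "(\<forall>\<^sub>F x in at_inf_within \<Sigma>. q x \<le> -1)
      \<or> (\<exists>P L. P \<in> sets borel \<and> thin_at_infinity s P \<and> L \<le> -1 \<and> (q \<longlongrightarrow> L) (at_inf_within (\<Sigma> - P)))"
    using h unfolding sol
  proof (elim disjE exE conjE)
    assume ev: "\<forall>\<^sub>F x in at_inf_within \<Sigma>. q x \<le> -1"
    show "\<exists>\<mu>. minimizer \<mu>"
    proof (rule part1[OF sets.empty_sets thin_empty])
      fix r :: real assume r: "0 \<le> r" "r < 1"
      have "(-1 :: ereal) \<le> ereal (- r)" using r by (simp add: one_ereal_def)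
      then show "\<forall>\<^sub>F x in at_inf_within (\<Sigma> - {}). q x \<le> ereal (- r)"
        using ev by (auto elim!: eventually_mono)
    qed
  next
    fix P L assume P: "P \<in> sets borel" "thin_at_infinity s P" and L: "L \<le> -1"
      and lim: "(q \<longlongrightarrow> L) (at_inf_within (\<Sigma> - P))"
    show "\<exists>\<mu>. minimizer \<mu>"
    proof (rule part1[OF P])
      fix r :: real assume r: "0 \<le> r" "r < 1"
      have "(-1 :: ereal) < ereal (- r)" using r by (simp add: one_ereal_def)
      then have "\<forall>\<^sub>F x in at_inf_within (\<Sigma> - P). q x < ereal (- r)"
        using L by (intro order_tendstoD(2)[OF lim]) (rule le_less_trans)
      then show "\<forall>\<^sub>F x in at_inf_within (\<Sigma> - P). q x \<le> ereal (- r)"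
        by eventually_elim (rule less_imp_le)
    qed
  qed
  have ii: "L = -1"
    if lim: "(q \<longlongrightarrow> L) (at_inf_within \<Sigma>)" and "is_solution s \<Sigma> Q \<mu>" and un: "\<not> bounded (msupport \<mu>)" for L \<mu>
  proof (rule ccontr)
    have min: "minimizer \<mu>" using that(2) by (simp add: sol)
    assume "L \<noteq> -1"
    then consider "L < -1" | "-1 < L" by force
    then show False
    proof cases
      case 1
      from ereal_dense2[OF this] obtain z where z: "L < ereal z" "ereal z < -1" by blast
      define \<eta> where "\<eta> = (- z - 1) / 2"
      have \<eta>: "0 < \<eta>" "1 + 2 * \<eta> = - z" using z(2) by (simp_all add: \<eta>_def one_ereal_def field_simps)
      from order_tendstoD(2)[OF lim z(1)] obtain R where R: "\<forall>x\<in>\<Sigma>. R \<le> norm x \<longrightarrow> q x < ereal z"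
        by (auto simp: eventually_at_inf_within)
      show False
      proof (rule unbounded_msupport_minimizer_contradiction[OF min un \<eta>(1), of "max R 1"])
        fix x assume x: "x \<in> \<Sigma>" "max R 1 \<le> norm x"
        then show "G x + ennreal ((1 + 2 * \<eta>) * norm x powr (- s)) \<le> ennreal g"
          using R \<eta> by (intro upper) (auto intro: less_imp_le)
      qed
    next
      case 2
      \<comment> \<open>\<open>z\<close> must be negative because 1 + z serves as the slack
        \<delta>, which has to lie below 1.\<close>
      then have "-1 < min L 0" by simp
      from ereal_dense2[OF this] obtain z where z: "-1 < ereal z" "ereal z < min L 0" by blast
      then have z': "- 1 < z" "z < 0" "ereal z < L" by (simp_all add: one_ereal_def)
      from order_tendstoD(1)[OF lim z'(3)] obtain R where R: "\<forall>x\<in>\<Sigma>. R \<le> norm x \<longrightarrow> ereal z < q x"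
        by (auto simp: eventually_at_inf_within)
      have "bounded (msupport \<mu>)"
      proof (rule bounded_msupport_minimizer[OF min, of "1 + z" "max R 1"])
        fix x assume x: "x \<in> \<Sigma>" "max R 1 \<le> norm x"
        then show "ennreal g \<le> G x + ennreal ((1 - (1 + z)) * norm x powr (- s))"
          using R z' by (intro lower) (auto intro: less_imp_le)
      qed (use z' in auto)
      then show False using un by simp
    qed
  qed
  have iii: "\<not> (\<exists>\<mu>. is_solution s \<Sigma> Q \<mu>)"
    if "real DIM('a) - 2 \<le> s" and c: "c < 1" "\<forall>x\<in>\<Sigma>. - ereal c \<le> q x" for c
    unfolding sol
  proof (intro notI, elim exE)
    fix \<mu> assume min: "minimizer \<mu>"
    \<comment> \<open>\<open>c\<close> may be negative. Replacing it by \<open>max 0 c\<close>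
      weakens the bound but stays below 1.\<close>
    have "\<not> minimizer \<mu>"
    proof (rule no_minimizer[OF that(1), of "max 0 c"])
      fix x assume x: "x \<in> \<Sigma>" "x \<noteq> 0"
      have "ereal (- max 0 c) \<le> - ereal c" by simp
      also have "\<dots> \<le> q x" using c x by blast
      finally show "ennreal g \<le> G x + ennreal (max 0 c * norm x powr (- s))"
        using x by (intro lower) auto
    qed (use c in auto)
    then show False using min by simp
  qed
  show ?thesis
  proof (intro conjI impI allI)
  qed (erule i[unfolded q_def], (erule ii[unfolded q_def]; assumption), elim exE conjE, rule iii[unfolded q_def])
qed

end
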